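(* Let $W=W_{A_{n-1}}$, $W_{D_n}$ or $W_{B_n}$, and let $\ddot{\mathfrak H}^{\sim}_W$ be the rational covering double affine Hecke algebra of $W$. Then the elements $\tilde x^{\alpha}\tilde w\,\tilde y^{\gamma}$, where $\alpha,\gamma\in\mathbb Z_+^n$ and $\tilde w\in\widetilde W$, form a basis of $\ddot{\mathfrak H}^{\sim}_W$.
   Context: Ground field $\mathbb C$; $\mathbb Z_+$ denotes the nonnegative integers; $\tilde x^\alpha=\tilde x_1^{\alpha_1}\cdots\tilde x_n^{\alpha_n}$, $\tilde y^\gamma=\tilde y_1^{\gamma_1}\cdots\tilde y_n^{\gamma_n}$; $W_{A_{n-1}}=S_n$, and $n\ge 2$ in type $B_n$, $n\ge4$ in type $D_n$. The group $\widetilde W$ is the double cover of $W$ (extension of $W$ by $\{1,z\}$) generated by $z$ and $\tilde t_1,\tilde t_2,\dots$ with $z$ central of order $2$ and the following relations. Type $A_{n-1}$ (generators $\tilde t_1,\dots,\tilde t_{n-1}$): $\tilde t_i^2=1$, $\tilde t_i\tilde t_{i+1}\tilde t_i=\tilde t_{i+1}\tilde t_i\tilde t_{i+1}$, $\tilde t_i\tilde t_j=z\tilde t_j\tilde t_i$ if $|i-j|>1$. Type $B_n$ (generators $\tilde t_1,\dots,\tilde t_n$): the type $A_{n-1}$ relations for $\tilde t_1,\dots,\tilde t_{n-1}$, $\tilde t_n^2=1$, $\tilde t_i\tilde t_n=z\tilde t_n\tilde t_i$ ($1\le i\le n-2$), $(\tilde t_{n-1}\tilde t_n)^2=z(\tilde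 t_n\tilde t_{n-1})^2$. Type $D_n$ (generators $\tilde t_1,\dots,\tilde t_n$): the type $A_{n-1}$ relations for $\tilde t_1,\dots,\tilde t_{n-1}$, $\tilde t_n^2=1$, $\tilde t_{n-2}\tilde t_n\tilde t_{n-2}=\tilde t_n\tilde t_{n-2}\tilde t_n$, $\tilde t_i\tilde t_n=z\tilde t_n\tilde t_i$ for $i\ne n-2,n$. Put $\tilde t_{i\uparrow j}=\tilde t_i\tilde t_{i+1}\cdots\tilde t_j$ if $i\le j$, $1$ otherwise; $\tilde t_{i\downarrow j}=\tilde t_i\tilde t_{i-1}\cdots\tilde t_j$ if $i\ge j$, $1$ otherwise. For $1\le i<j\le n$ define in $\widetilde W$: $\{i,j\}=z^{j-i-1}\tilde t_{j-1}\cdots\tilde t_{i+1}\tilde t_i\tilde t_{i+1}\cdots\tilde t_{j-1}$, $\{j,i\}=z\{i,j\}$; $\overline{\{i,j\}}=\overline{\{j,i\}}=z^{j-i-1}\tilde t_{j\uparrow n-1}\tilde t_{i\uparrow n-2}\tilde t_n\tilde t_{n-2\downarrow i}\tilde t_{n-1\downarrow j}$ in type $D_n$, and $=z^{j-i}\tilde t_{j\uparrow n-1}\tilde t_{i\uparrow n-2}\tilde t_n\tilde t_{n-1}\tilde t_n\tilde t_{n-2\downarrow i}\tilde t_{n-1\downarrow j}$ in type $B_n$; $\{i\}=z^{n-i}\tilde t_i\cdots\tilde t_{n-1}\tilde t_n\tilde t_{n-1}\cdots\tilde t_i$ ($1\le i\le n$) in type $B_n$. The algebra $\ddot{\mathfrak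 H}^{\sim}_W$. Let $u\in\mathbb C$ (and $v\in\mathbb C$ in type $B_n$). It is generated by $\tilde x_i,\tilde y_i$ ($1\le i\le n$), $z$ and the $\tilde t_i$, subject to the relations of $\widetilde W$, $z$ central, and: $\tilde x_i\tilde x_j=z\tilde x_j\tilde x_i$, $\tilde y_i\tilde y_j=\tilde y_j\tilde y_i$ ($i\ne j$); for $1\le i\le n-1$: $\tilde t_i\tilde x_j=z\tilde x_j\tilde t_i$, $\tilde t_i\tilde y_j=\tilde y_j\tilde t_i$ ($j\ne i,i+1$), $\tilde t_i\tilde x_{i+1}=z\tilde x_i\tilde t_i$, $\tilde t_i\tilde y_{i+1}=\tilde y_i\tilde t_i$; and (with $[a,b]=ab-ba$) type $A_{n-1}$: $[\tilde y_j,\tilde x_i]=uz\{i,j\}$ ($j\neq i$), $[\tilde y_i,\tilde x_i]=-uz\sum_{k\ne i}\{i,k\}$; type $D_n$: $\tilde t_n\tilde x_j=z\tilde x_j\tilde t_n$, $\tilde t_n\tilde y_j=\tilde y_j\tilde t_n$ ($j\ne n-1,n$), $\tilde t_n\tilde x_n=-\tilde x_{n-1}\tilde t_n$, $\tilde t_n\tilde y_n=-\tilde y_{n-1}\tilde t_n$, $[\tilde y_j,\tilde x_i]=uz(\{i,j\}-\overline{\{i,j\}})$ ($j\ne i$), $[\tilde y_i,\tilde x_i]=-uz\sum_{k\ne i}(\{i,k\}+\overline{\{i,k\}})$; type $B_n$: $\tilde t_n\tilde x_i=z\tilde x_i\tilde t_n$, $\tilde t_n\tilde y_i=\tilde y_i\tilde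 t_n$ ($i\ne n$), $\tilde t_n\tilde x_n=-\tilde x_n\tilde t_n$, $\tilde t_n\tilde y_n=-\tilde y_n\tilde t_n$, $[\tilde y_j,\tilde x_i]=uz(\{i,j\}-\overline{\{i,j\}})$ ($j\ne i$), $[\tilde y_i,\tilde x_i]=-uz\sum_{k\ne i}(\{i,k\}+\overline{\{i,k\}})-vz\{i\}$. *)

theory Defs
  imports
    Complex_Main
    "HOL-Library.Poly_Mapping"
    "HOL-Algebra.QuotRing"
    "Jordan_Normal_Form.VS_Connect"
begin

section \<open>Presented groups\<close>

inductive_set word_cong :: "'g set \<Rightarrow> ('g list \<times> 'g list) set \<Rightarrow> ('g list \<times> 'g list) set"
  for A :: "'g set" and R :: "('g list \<times> 'g list) set" where
  rel: "\<lbrakk>(l, r) \<in> R; a \<in> lists A; b \<in> lists A\<rbrakk> \<Longrightarrow> (a @ l @ b, a @ r @ b) \<in> word_cong A R"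
| refl: "a \<in> lists A \<Longrightarrow> (a, a) \<in> word_cong A R"
| sym: "(a, b) \<in> word_cong A R \<Longrightarrow> (b, a) \<in> word_cong A R"
| trans: "\<lbrakk>(a, b) \<in> word_cong A R; (b, c) \<in> word_cong A R\<rbrakk> \<Longrightarrow> (a, c) \<in> word_cong A R"

text \<open>The monoid with generators \<open>A\<close> and relations \<open>R\<close>. If \<open>R\<close> makes every generator an
  involution, this is the group presented by \<open>A\<close> and \<open>R\<close>; formal inverses are then not needed.\<close>

definition presented_monoid :: "'g set \<Rightarrow> ('g list \<times> 'g list) set \<Rightarrow> 'g list set monoid" where
  "presented_monoid A R =
     \<lparr>carrier = lists A // word_cong A R,
      mult = (\<lambda>X Y. \<Union>x\<in>X. \<Union>y\<in>Y. word_cong A R `` {x @ y}),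
      one = word_cong A R `` {[]}\<rparr>"

lemma word_cong_lists:
  assumes "(a, b) \<in> word_cong A R" "R \<subseteq> lists A \<times> lists A"
  shows "a \<in> lists A \<and> b \<in> lists A"
  using assms by (induction rule: word_cong.induct) auto

lemma equiv_word_cong:
  assumes "R \<subseteq> lists A \<times> lists A"
  shows "equiv (lists A) (word_cong A R)"
proof (rule equivI)
  show "word_cong A R \<subseteq> lists A \<times> lists A"
    using word_cong_lists[OF _ assms] by auto
  show "refl_on (lists A) (word_cong A R)"
    by (auto simp: refl_on_def intro: word_cong.refl)
  show "Relation.sym (word_cong A R)"
    by (auto simp: Relation.sym_def intro: word_cong.sym)
  show "Relation.trans (word_cong A R)"
    by (auto simp: Relation.trans_def intro: word_cong.trans)
qed

lemma word_cong_context: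
  assumes "(a, b) \<in> word_cong A R" "c \<in> lists A" "d \<in> lists A"
  shows "(c @ a @ d, c @ b @ d) \<in> word_cong A R"
  using assms
proof (induction rule: word_cong.induct)
  case (rel l r a b)
  have "((c @ a) @ l @ (b @ d), (c @ a) @ r @ (b @ d)) \<in> word_cong A R"
    using rel by (intro word_cong.rel) auto
  then show ?case by simp
next
  case (refl a)
  then show ?case by (intro word_cong.refl) auto
next
  case (sym a b)
  then show ?case by (auto intro: word_cong.sym)
next
  case (trans a b e)
  then show ?case by (auto intro: word_cong.trans)
qed

lemma word_cong_append:
  assumes R: "R \<subseteq> lists A \<times> lists A"
    and "(a, a') \<in> word_cong A R" "(b, b') \<in> word_cong A R"
  shows "(a @ b, a' @ b') \<in> word_cong A R"
proof -
  have l: "a \<in> lists A" "a' \<in> lists A" "b \<in> lists A" "b' \<in> lists A"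
    using word_cong_lists[OF assms(2) R] word_cong_lists[OF assms(3) R] by auto
  have "(a @ b, a' @ b) \<in> word_cong A R"
    using word_cong_context[OF assms(2), of "[]" b] l by simp
  moreover have "(a' @ b, a' @ b') \<in> word_cong A R"
    using word_cong_context[OF assms(3), of a' "[]"] l by simp
  ultimately show ?thesis by (rule word_cong.trans)
qed

lemma presented_monoid_mult_class:
  assumes R: "R \<subseteq> lists A \<times> lists A" and "a \<in> lists A" "b \<in> lists A"
  shows "word_cong A R `` {a} \<otimes>\<^bsub>presented_monoid A R\<^esub> word_cong A R `` {b}
       = word_cong A R `` {a @ b}"
proof -
  note E = equiv_word_cong[OF R]
  have *: "word_cong A R `` {a' @ b'} = word_cong A R `` {a @ b}"
    if "(a, a') \<in> word_cong A R" "(b, b') \<in> word_cong A R" for a' b'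
    using equiv_class_eq[OF E word_cong_append[OF R that]] by simp
  have "(a, a) \<in> word_cong A R" "(b, b) \<in> word_cong A R"
    using assms by (simp_all only: word_cong.refl)
  then have ne: "word_cong A R `` {a} \<noteq> {}" "word_cong A R `` {b} \<noteq> {}"
    by auto
  have "(\<Union>x\<in>word_cong A R `` {a}. \<Union>y\<in>word_cong A R `` {b}. word_cong A R `` {x @ y})
      = (\<Union>x\<in>word_cong A R `` {a}. \<Union>y\<in>word_cong A R `` {b}. word_cong A R `` {a @ b})"
    using * by (intro SUP_cong HOL.refl) auto
  also have "\<dots> = word_cong A R `` {a @ b}"
    using ne by (simp add: UN_constant)
  finally show ?thesis
    by (simp add: presented_monoid_def)
qed

lemma group_presented_monoid:
  assumes R: "R \<subseteq> lists A \<times> lists A" and inv: "\<And>g. g \<in> A \<Longrightarrow> ([g, g], []) \<in> R"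
  shows "group (presented_monoid A R)"
proof -
  let ?G = "presented_monoid A R" and ?c = "\<lambda>a. word_cong A R `` {a}"
  note E = equiv_word_cong[OF R] and M = presented_monoid_mult_class[OF R]
  have car: "\<exists>a\<in>lists A. X = ?c a" if "X \<in> carrier ?G" for X
    using that by (auto simp: presented_monoid_def elim!: quotientE)
  have cl: "?c a \<in> carrier ?G" if "a \<in> lists A" for a
    using that by (auto simp: presented_monoid_def intro: quotientI)
  have one: "\<one>\<^bsub>?G\<^esub> = ?c []" by (simp add: presented_monoid_def)
  have rev: "(rev a @ a, []) \<in> word_cong A R" if "a \<in> lists A" for a
    using that
  proof (induction a)
    case Nil
    then show ?case by (auto intro: word_cong.refl)
  next
    case (Cons g a)
    then have "(rev a @ [g, g] @ a, rev a @ [] @ a) \<in> word_cong A R"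
      by (intro word_cong.rel inv) auto
    with Cons show ?case by (auto intro: word_cong.trans)
  qed
  show ?thesis
  proof (rule groupI)
    fix X Y Z assume "X \<in> carrier ?G" "Y \<in> carrier ?G" "Z \<in> carrier ?G"
    then obtain a b c where "a \<in> lists A" "b \<in> lists A" "c \<in> lists A" "X = ?c a" "Y = ?c b" "Z = ?c c"
      using car by metis
    then show "X \<otimes>\<^bsub>?G\<^esub> Y \<otimes>\<^bsub>?G\<^esub> Z = X \<otimes>\<^bsub>?G\<^esub> (Y \<otimes>\<^bsub>?G\<^esub> Z)"
      using M by (simp del: lists.simps)
  next
    fix X Y assume "X \<in> carrier ?G" "Y \<in> carrier ?G"
    then obtain a b where "a \<in> lists A" "b \<in> lists A" "X = ?c a" "Y = ?c b"
      using car by metis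
    then show "X \<otimes>\<^bsub>?G\<^esub> Y \<in> carrier ?G"
      using M cl[of "a @ b"] by simp
  next
    show "\<one>\<^bsub>?G\<^esub> \<in> carrier ?G" using cl[of "[]"] one by simp
  next
    fix X assume "X \<in> carrier ?G"
    then obtain a where a: "a \<in> lists A" "X = ?c a" using car by metis
    then show "\<one>\<^bsub>?G\<^esub> \<otimes>\<^bsub>?G\<^esub> X = X" using M[of "[]" a] one by simp
    have r: "rev a \<in> lists A" using a by auto
    have "?c (rev a) \<otimes>\<^bsub>?G\<^esub> X = \<one>\<^bsub>?G\<^esub>"
      using M[OF r a(1)] a(2) one equiv_class_eq[OF E rev[OF a(1)]] by simp
    then show "\<exists>Y\<in>carrier ?G. Y \<otimes>\<^bsub>?G\<^esub> X = \<one>\<^bsub>?G\<^esub>"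
      using cl[OF r] by blast
  qed
qed

section \<open>Presented associative algebras over the complex numbers\<close>

text \<open>The wrapper carries the additive notation that \<^type>\<open>poly_mapping\<close> expects of a monoid:
  addition of words is concatenation, and \<open>'g fmon \<Rightarrow>\<^sub>0 complex\<close> is the monoid algebra of words.\<close>

datatype 'g fmon = Word (letters: "'g list")

instantiation fmon :: (type) monoid_add
begin
definition zero_fmon :: "'a fmon" where "0 = Word []"
definition plus_fmon :: "'a fmon \<Rightarrow> 'a fmon \<Rightarrow> 'a fmon" where
  "a + b = Word (letters a @ letters b)"
instance by standard (auto simp: zero_fmon_def plus_fmon_def)
end

definition monomial :: "'g list \<Rightarrow> 'g fmon \<Rightarrow>\<^sub>0 complex" where
  "monomial w = Poly_Mapping.single (Word w) 1"

definition scal :: "complex \<Rightarrow> 'g fmon \<Rightarrow>\<^sub>0 complex" where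
  "scal c = Poly_Mapping.single 0 c"

definition free_algebra :: "'g set \<Rightarrow> ('g fmon \<Rightarrow>\<^sub>0 complex) ring" where
  "free_algebra A = class_ring\<lparr>carrier := {p. \<forall>w \<in> Poly_Mapping.keys p. letters w \<in> lists A}\<rparr>"

text \<open>The image in the algebra with generators \<open>A\<close> and relations \<open>p = 0\<close> (\<open>p \<in> R\<close>) of an element of
  the free algebra. The ideal \<^const>\<open>genideal\<close> is two-sided.\<close>

definition alg_class ::
  "'g set \<Rightarrow> ('g fmon \<Rightarrow>\<^sub>0 complex) set \<Rightarrow> ('g fmon \<Rightarrow>\<^sub>0 complex) \<Rightarrow> ('g fmon \<Rightarrow>\<^sub>0 complex) set" where
  "alg_class A R p = (Idl\<^bsub>free_algebra A\<^esub> R) +>\<^bsub>free_algebra A\<^esub> p"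

definition presented_algebra ::
  "'g set \<Rightarrow> ('g fmon \<Rightarrow>\<^sub>0 complex) set \<Rightarrow> (complex, ('g fmon \<Rightarrow>\<^sub>0 complex) set) module" where
  "presented_algebra A R =
     (let Q = free_algebra A Quot (Idl\<^bsub>free_algebra A\<^esub> R) in
       \<lparr>carrier = carrier Q, mult = mult Q, one = one Q, zero = zero Q, add = add Q,
        smult = (\<lambda>c X. alg_class A R (scal c) \<otimes>\<^bsub>Q\<^esub> X)\<rparr>)"

lemma free_algebra_simps [simp]:
  "mult (free_algebra A) = (*)" "add (free_algebra A) = (+)"
  "one (free_algebra A) = 1" "zero (free_algebra A) = 0"
  by (simp_all add: free_algebra_def)

lemma free_algebra_carrier:
  "p \<in> carrier (free_algebra A) \<longleftrightarrow> (\<forall>w\<in>Poly_Mapping.keys p. letters w \<in> lists A)"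
  by (simp add: free_algebra_def)

lemma monomial_in_free_algebra [simp]: "monomial w \<in> carrier (free_algebra A) \<longleftrightarrow> w \<in> lists A"
  by (simp add: free_algebra_carrier monomial_def)

lemma scal_in_free_algebra [simp]: "scal c \<in> carrier (free_algebra A)"
  by (simp add: free_algebra_carrier scal_def zero_fmon_def)

lemma zero_one_in_free_algebra [simp]:
  "0 \<in> carrier (free_algebra A)" "1 \<in> carrier (free_algebra A)"
  by (simp_all add: free_algebra_carrier zero_fmon_def)

lemma free_algebra_closed:
  assumes "p \<in> carrier (free_algebra A)" "q \<in> carrier (free_algebra A)"
  shows "p + q \<in> carrier (free_algebra A)" "p - q \<in> carrier (free_algebra A)"
    "- p \<in> carrier (free_algebra A)" "p * q \<in> carrier (free_algebra A)"
proof -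
  have 1: "p + q \<in> carrier (free_algebra A)" if "q \<in> carrier (free_algebra A)" for q
    using keys_add[of p q] assms that unfolding free_algebra_carrier by blast
  show "p + q \<in> carrier (free_algebra A)" by (rule 1) (rule assms)
  have k: "Poly_Mapping.keys (- r) = Poly_Mapping.keys r" for r :: "'a fmon \<Rightarrow>\<^sub>0 complex"
    by (auto simp: in_keys_iff)
  show "- p \<in> carrier (free_algebra A)"
    using assms by (simp add: free_algebra_carrier k)
  have "- q \<in> carrier (free_algebra A)"
    using assms by (simp add: free_algebra_carrier k)
  from 1[OF this] show "p - q \<in> carrier (free_algebra A)" by simp
  show "p * q \<in> carrier (free_algebra A)"
    using keys_mult[of p q] assms unfolding free_algebra_carrier
    by (fastforce simp: plus_fmon_def)
qed

lemma ring_free_algebra: "ring (free_algebra A)"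
proof (rule ringI)
  show "abelian_group (free_algebra A)"
  proof (rule abelian_groupI)
    fix p assume p: "p \<in> carrier (free_algebra A)"
    show "\<exists>q\<in>carrier (free_algebra A). q \<oplus>\<^bsub>free_algebra A\<^esub> p = \<zero>\<^bsub>free_algebra A\<^esub>"
      using free_algebra_closed(3)[OF p p] by (intro bexI[of _ "- p"]) auto
  qed (simp_all add: free_algebra_closed add.assoc add.commute)
  show "Group.monoid (free_algebra A)"
    by (rule monoidI) (simp_all add: free_algebra_closed mult.assoc)
qed (auto simp: algebra_simps)

context
  fixes A :: "'g set" and R :: "('g fmon \<Rightarrow>\<^sub>0 complex) set"
  assumes R: "R \<subseteq> carrier (free_algebra A)"
begin

lemma ideal_presented: "ideal (Idl\<^bsub>free_algebra A\<^esub> R) (free_algebra A)"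
  using ring.genideal_ideal[OF ring_free_algebra R] .

lemma presented_algebra_sel:
  "carrier (presented_algebra A R) = carrier (free_algebra A Quot (Idl\<^bsub>free_algebra A\<^esub> R))"
  "mult (presented_algebra A R) = mult (free_algebra A Quot (Idl\<^bsub>free_algebra A\<^esub> R))"
  "one (presented_algebra A R) = one (free_algebra A Quot (Idl\<^bsub>free_algebra A\<^esub> R))"
  "zero (presented_algebra A R) = zero (free_algebra A Quot (Idl\<^bsub>free_algebra A\<^esub> R))"
  "add (presented_algebra A R) = add (free_algebra A Quot (Idl\<^bsub>free_algebra A\<^esub> R))"
  "smult (presented_algebra A R) c X = alg_class A R (scal c) \<otimes>\<^bsub>presented_algebra A R\<^esub> X"
  by (simp_all add: presented_algebra_def Let_def)

lemma ring_presented_algebra: "ring (presented_algebra A R)"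
proof -
  interpret Q: ring "free_algebra A Quot (Idl\<^bsub>free_algebra A\<^esub> R)"
    using ideal.quotient_is_ring[OF ideal_presented] .
  show ?thesis
  proof (rule ringI)
    show "abelian_group (presented_algebra A R)"
    proof (rule abelian_groupI)
      fix X assume "X \<in> carrier (presented_algebra A R)"
      then show "\<exists>Y\<in>carrier (presented_algebra A R). Y \<oplus>\<^bsub>presented_algebra A R\<^esub> X = \<zero>\<^bsub>presented_algebra A R\<^esub>"
        using Q.l_neg Q.a_inv_closed unfolding presented_algebra_sel by blast
    qed (simp_all add: presented_algebra_sel(1-5) Q.a_ac)
    show "Group.monoid (presented_algebra A R)"
      by (rule monoidI) (auto simp: presented_algebra_sel(1-5) Q.m_assoc)
  qed (auto simp: presented_algebra_sel(1-5) Q.l_distr Q.r_distr)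
qed

lemma alg_class_hom: "alg_class A R \<in> Ring.ring_hom (free_algebra A) (presented_algebra A R)"
proof -
  have "alg_class A R = (+>\<^bsub>free_algebra A\<^esub>) (Idl\<^bsub>free_algebra A\<^esub> R)"
    by (simp add: fun_eq_iff alg_class_def)
  then show ?thesis
    using ideal.rcos_ring_hom[OF ideal_presented]
    by (simp add: Ring.ring_hom_def presented_algebra_sel(1-5))
qed

lemma alg_class_surj: "carrier (presented_algebra A R) = alg_class A R ` carrier (free_algebra A)"
  by (auto simp: presented_algebra_sel FactRing_def A_RCOSETS_def' a_r_coset_def' alg_class_def)

lemma alg_class_eq:
  assumes "p - q \<in> R" "p \<in> carrier (free_algebra A)" "q \<in> carrier (free_algebra A)"
  shows "alg_class A R p = alg_class A R q"
proof -
  interpret I: ideal "Idl\<^bsub>free_algebra A\<^esub> R" "free_algebra A" by (rule ideal_presented)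
  have "p - q \<in> (Idl\<^bsub>free_algebra A\<^esub> R)" using ring.genideal_self[OF ring_free_algebra R] assms by auto
  then have "p \<in> (Idl\<^bsub>free_algebra A\<^esub> R) +>\<^bsub>free_algebra A\<^esub> q"
    by (auto simp: a_r_coset_def' intro!: bexI[of _ "p - q"])
  then show ?thesis
    unfolding alg_class_def by (metis I.a_repr_independence assms(3) I.a_subgroup)
qed

lemma scal_add: "scal (c + d) = scal c + scal d"
  by (simp add: scal_def single_add)

lemma scal_mult: "scal (c * d) = scal c * scal d"
  by (simp add: scal_def mult_single)

lemma scal_one: "scal 1 = 1"
  by (simp add: scal_def)

lemma scal_central: "scal c * p = p * scal c"
proof -
  have "p = (\<Sum>k\<in>Poly_Mapping.keys p. Poly_Mapping.single k (Poly_Mapping.lookup p k))"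
    by (rule poly_mapping_eqI) (simp add: lookup_sum lookup_single when_def in_keys_iff sum.delta)
  moreover have "scal c * Poly_Mapping.single k a = Poly_Mapping.single k a * scal c" for k a
    by (simp add: scal_def mult_single mult.commute)
  ultimately show ?thesis
    by (metis (mono_tags, lifting) sum.cong sum_distrib_left sum_distrib_right)
qed

lemma vectorspace_presented_algebra: "vectorspace class_ring (presented_algebra A R)"
proof -
  interpret P: ring "presented_algebra A R" by (rule ring_presented_algebra)
  have S: "alg_class A R (scal c) \<in> carrier (presented_algebra A R)" for c
    using alg_class_surj by auto
  have add: "alg_class A R (scal (c + d))
      = alg_class A R (scal c) \<oplus>\<^bsub>presented_algebra A R\<^esub> alg_class A R (scal d)" for c d
    using ring_hom_add[OF alg_class_hom, of "scal c" "scal d"] by (simp add: scal_add)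
  have mul: "alg_class A R (scal (c * d))
      = alg_class A R (scal c) \<otimes>\<^bsub>presented_algebra A R\<^esub> alg_class A R (scal d)" for c d
    using ring_hom_mult[OF alg_class_hom, of "scal c" "scal d"] by (simp add: scal_mult)
  have one: "alg_class A R (scal 1) = \<one>\<^bsub>presented_algebra A R\<^esub>"
    using ring_hom_one[OF alg_class_hom] by (simp add: scal_one)
  have "Module.module class_ring (presented_algebra A R)"
  proof (rule moduleI)
    show "cring (class_ring :: complex ring)" by (rule class_cring.cring_axioms)
    show "abelian_group (presented_algebra A R)" by (rule P.abelian_group_axioms)
  qed (auto simp: presented_algebra_sel(6) S P.l_distr P.r_distr P.m_assoc add mul one)
  then show ?thesis
    by (simp add: vectorspace_def class_field)
qed

lemma presented_algebra_smult_assoc: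
  assumes "X \<in> carrier (presented_algebra A R)" "Y \<in> carrier (presented_algebra A R)"
  shows "(c \<odot>\<^bsub>presented_algebra A R\<^esub> X) \<otimes>\<^bsub>presented_algebra A R\<^esub> Y
      = c \<odot>\<^bsub>presented_algebra A R\<^esub> (X \<otimes>\<^bsub>presented_algebra A R\<^esub> Y)"
    "X \<otimes>\<^bsub>presented_algebra A R\<^esub> (c \<odot>\<^bsub>presented_algebra A R\<^esub> Y)
      = c \<odot>\<^bsub>presented_algebra A R\<^esub> (X \<otimes>\<^bsub>presented_algebra A R\<^esub> Y)"
proof -
  interpret P: ring "presented_algebra A R" by (rule ring_presented_algebra)
  have S: "alg_class A R (scal c) \<in> carrier (presented_algebra A R)" for c
    using alg_class_surj by auto
  show "(c \<odot>\<^bsub>presented_algebra A R\<^esub> X) \<otimes>\<^bsub>presented_algebra A R\<^esub> Y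
      = c \<odot>\<^bsub>presented_algebra A R\<^esub> (X \<otimes>\<^bsub>presented_algebra A R\<^esub> Y)"
    using assms S by (simp add: presented_algebra_sel(6) P.m_assoc)
  obtain p where p: "p \<in> carrier (free_algebra A)" "X = alg_class A R p"
    using assms alg_class_surj by auto
  have "alg_class A R (scal c) \<otimes>\<^bsub>presented_algebra A R\<^esub> X = X \<otimes>\<^bsub>presented_algebra A R\<^esub> alg_class A R (scal c)"
    using ring_hom_mult[OF alg_class_hom, of "scal c" p] ring_hom_mult[OF alg_class_hom, of p "scal c"]
      p scal_central[of c p] by simp
  then show "X \<otimes>\<^bsub>presented_algebra A R\<^esub> (c \<odot>\<^bsub>presented_algebra A R\<^esub> Y)
      = c \<odot>\<^bsub>presented_algebra A R\<^esub> (X \<otimes>\<^bsub>presented_algebra A R\<^esub> Y)"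
    using assms S by (simp add: presented_algebra_sel(6) flip: P.m_assoc)
qed

end

section \<open>The double covers of the Weyl groups\<close>

text \<open>\<open>TypeA\<close> with parameter \<open>n\<close> stands for \<open>A\<^bsub>n-1\<^esub>\<close>, \<open>TypeB\<close> for \<open>B\<^sub>n\<close> and \<open>TypeD\<close> for \<open>D\<^sub>n\<close>.\<close>

datatype weyl_type = TypeA | TypeB | TypeD

definition admissible_rank :: "weyl_type \<Rightarrow> nat \<Rightarrow> bool" where
  "admissible_rank ty n \<longleftrightarrow> n \<ge> (case ty of TypeA \<Rightarrow> 1 | TypeB \<Rightarrow> 2 | TypeD \<Rightarrow> 4)"

datatype cover_gen = Zc | Tc nat

definition cover_gens :: "weyl_type \<Rightarrow> nat \<Rightarrow> cover_gen set" where
  "cover_gens ty n = insert Zc (Tc ` (if ty = TypeA then {1..<n} else {1..n}))"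

definition cover_rels_A :: "nat \<Rightarrow> (cover_gen list \<times> cover_gen list) set" where
  "cover_rels_A n =
     {([Tc i, Tc i], []) | i. i \<in> {1..<n}} \<union>
     {([Tc i, Tc (i+1), Tc i], [Tc (i+1), Tc i, Tc (i+1)]) | i. 1 \<le> i \<and> i + 1 < n} \<union>
     {([Tc i, Tc j], [Zc, Tc j, Tc i]) | i j.
        i \<in> {1..<n} \<and> j \<in> {1..<n} \<and> \<bar>int i - int j\<bar> > 1}"

definition cover_rels_B :: "nat \<Rightarrow> (cover_gen list \<times> cover_gen list) set" where
  "cover_rels_B n =
     {([Tc n, Tc n], [])} \<union>
     {([Tc i, Tc n], [Zc, Tc n, Tc i]) | i. 1 \<le> i \<and> i \<le> n - 2} \<union>
     {([Tc (n-1), Tc n, Tc (n-1), Tc n], [Zc, Tc n, Tc (n-1), Tc n, Tc (n-1)])}"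

definition cover_rels_D :: "nat \<Rightarrow> (cover_gen list \<times> cover_gen list) set" where
  "cover_rels_D n =
     {([Tc n, Tc n], [])} \<union>
     {([Tc (n-2), Tc n, Tc (n-2)], [Tc n, Tc (n-2), Tc n])} \<union>
     {([Tc i, Tc n], [Zc, Tc n, Tc i]) | i. i \<in> {1..n} \<and> i \<noteq> n - 2 \<and> i \<noteq> n}"

definition cover_rels :: "weyl_type \<Rightarrow> nat \<Rightarrow> (cover_gen list \<times> cover_gen list) set" where
  "cover_rels ty n =
     {([Zc, Zc], [])} \<union> {([Zc, g], [g, Zc]) | g. g \<in> cover_gens ty n} \<union> cover_rels_A n \<union>
     (case ty of TypeA \<Rightarrow> {} | TypeB \<Rightarrow> cover_rels_B n | TypeD \<Rightarrow> cover_rels_D n)"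

definition weyl_cover :: "weyl_type \<Rightarrow> nat \<Rightarrow> cover_gen list set monoid" where
  "weyl_cover ty n = presented_monoid (cover_gens ty n) (cover_rels ty n)"

lemma cover_rels_lists:
  assumes "admissible_rank ty n"
  shows "cover_rels ty n \<subseteq> lists (cover_gens ty n) \<times> lists (cover_gens ty n)"
  using assms
  by (cases ty) (auto simp: admissible_rank_def cover_rels_def cover_rels_A_def cover_rels_B_def
      cover_rels_D_def cover_gens_def)

theorem group_weyl_cover:
  assumes "admissible_rank ty n"
  shows "group (weyl_cover ty n)"
  unfolding weyl_cover_def
proof (rule group_presented_monoid[OF cover_rels_lists[OF assms]])
  fix g assume "g \<in> cover_gens ty n"
  then show "([g, g], []) \<in> cover_rels ty n"
    by (cases ty) (auto simp: cover_gens_def cover_rels_def cover_rels_A_def cover_rels_B_def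
        cover_rels_D_def)
qed

text \<open>\<open>tup i j\<close> and \<open>tdown i j\<close> are the words \<open>t\<^sub>i t\<^bsub>i+1\<^esub> \<dots> t\<^sub>j\<close> and \<open>t\<^sub>i t\<^bsub>i-1\<^esub> \<dots> t\<^sub>j\<close>.
  The words \<open>root_elt i j\<close>, \<open>root_elt_bar ty n i j\<close> and \<open>root_elt_single n i\<close> represent the
  elements \<open>{i,j}\<close>, its barred version and \<open>{i}\<close> of the double cover.\<close>

definition tup :: "nat \<Rightarrow> nat \<Rightarrow> cover_gen list" where
  "tup i j = map Tc [i..<Suc j]"

definition tdown :: "nat \<Rightarrow> nat \<Rightarrow> cover_gen list" where
  "tdown i j = rev (tup j i)"

definition root_elt :: "nat \<Rightarrow> nat \<Rightarrow> cover_gen list" where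
  "root_elt i j =
     (let pos = (\<lambda>i j. replicate (j - i - 1) Zc @ tdown (j - 1) (i + 1) @ [Tc i] @ tup (i + 1) (j - 1))
      in if i < j then pos i j else Zc # pos j i)"

definition root_elt_bar :: "weyl_type \<Rightarrow> nat \<Rightarrow> nat \<Rightarrow> nat \<Rightarrow> cover_gen list" where
  "root_elt_bar ty n i0 j0 =
     (let i = min i0 j0; j = max i0 j0 in
      if ty = TypeB
      then replicate (j - i) Zc @ tup j (n - 1) @ tup i (n - 2) @ [Tc n, Tc (n - 1), Tc n]
             @ tdown (n - 2) i @ tdown (n - 1) j
      else replicate (j - i - 1) Zc @ tup j (n - 1) @ tup i (n - 2) @ [Tc n]
             @ tdown (n - 2) i @ tdown (n - 1) j)"

definition root_elt_single :: "nat \<Rightarrow> nat \<Rightarrow> cover_gen list" where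
  "root_elt_single n i = replicate (n - i) Zc @ tup i (n - 1) @ [Tc n] @ tdown (n - 1) i"

section \<open>The rational covering double affine Hecke algebra\<close>

datatype gen = GX nat | GY nat | GW cover_gen

type_synonym free_elt = "gen fmon \<Rightarrow>\<^sub>0 complex"

definition gens :: "weyl_type \<Rightarrow> nat \<Rightarrow> gen set" where
  "gens ty n = GX ` {1..n} \<union> GY ` {1..n} \<union> GW ` cover_gens ty n"

definition xg :: "nat \<Rightarrow> free_elt" where "xg i = monomial [GX i]"
definition yg :: "nat \<Rightarrow> free_elt" where "yg i = monomial [GY i]"
definition wd :: "cover_gen list \<Rightarrow> free_elt" where "wd l = monomial (map GW l)"
definition zg :: free_elt where "zg = wd [Zc]"
definition tg :: "nat \<Rightarrow> free_elt" where "tg i = wd [Tc i]"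

definition commutator :: "free_elt \<Rightarrow> free_elt \<Rightarrow> free_elt" where
  "commutator a b = a * b - b * a"

text \<open>The prescribed value of \<open>[y\<^sub>j, x\<^sub>i]\<close>. The parameter \<open>v\<close> only occurs in type \<open>B\<close>.\<close>

definition yx_value :: "weyl_type \<Rightarrow> nat \<Rightarrow> complex \<Rightarrow> complex \<Rightarrow> nat \<Rightarrow> nat \<Rightarrow> free_elt" where
  "yx_value ty n u v j i =
     (if j \<noteq> i then
        (case ty of
           TypeA \<Rightarrow> scal u * zg * wd (root_elt i j)
         | _ \<Rightarrow> scal u * zg * (wd (root_elt i j) - wd (root_elt_bar ty n i j)))
      else
        (case ty of
           TypeA \<Rightarrow> - (scal u * zg * (\<Sum>k\<in>{1..n} - {i}. wd (root_elt i k)))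
         | TypeD \<Rightarrow> - (scal u * zg *
             (\<Sum>k\<in>{1..n} - {i}. wd (root_elt i k) + wd (root_elt_bar ty n i k)))
         | TypeB \<Rightarrow> - (scal u * zg *
             (\<Sum>k\<in>{1..n} - {i}. wd (root_elt i k) + wd (root_elt_bar ty n i k)))
             - scal v * zg * wd (root_elt_single n i)))"

text \<open>Each element \<open>p\<close> of the following sets stands for the relation \<open>p = 0\<close>.\<close>

definition common_rels :: "weyl_type \<Rightarrow> nat \<Rightarrow> free_elt set" where
  "common_rels ty n =
     {wd l - wd r | l r. (l, r) \<in> cover_rels ty n} \<union>
     {zg * monomial [g] - monomial [g] * zg | g. g \<in> gens ty n} \<union>
     {xg i * xg j - zg * xg j * xg i | i j. i \<in> {1..n} \<and> j \<in> {1..n} \<and> i \<noteq> j} \<union>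
     {yg i * yg j - yg j * yg i | i j. i \<in> {1..n} \<and> j \<in> {1..n} \<and> i \<noteq> j} \<union>
     {tg i * xg j - zg * xg j * tg i | i j. i \<in> {1..<n} \<and> j \<in> {1..n} \<and> j \<noteq> i \<and> j \<noteq> i + 1} \<union>
     {tg i * yg j - yg j * tg i | i j. i \<in> {1..<n} \<and> j \<in> {1..n} \<and> j \<noteq> i \<and> j \<noteq> i + 1} \<union>
     {tg i * xg (i + 1) - zg * xg i * tg i | i. i \<in> {1..<n}} \<union>
     {tg i * yg (i + 1) - yg i * tg i | i. i \<in> {1..<n}}"

definition tn_rels_D :: "nat \<Rightarrow> free_elt set" where
  "tn_rels_D n =
     {tg n * xg j - zg * xg j * tg n | j. j \<in> {1..n} \<and> j \<noteq> n - 1 \<and> j \<noteq> n} \<union>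
     {tg n * yg j - yg j * tg n | j. j \<in> {1..n} \<and> j \<noteq> n - 1 \<and> j \<noteq> n} \<union>
     {tg n * xg n - (- xg (n - 1) * tg n)} \<union>
     {tg n * yg n - (- yg (n - 1) * tg n)}"

definition tn_rels_B :: "nat \<Rightarrow> free_elt set" where
  "tn_rels_B n =
     {tg n * xg i - zg * xg i * tg n | i. i \<in> {1..n} \<and> i \<noteq> n} \<union>
     {tg n * yg i - yg i * tg n | i. i \<in> {1..n} \<and> i \<noteq> n} \<union>
     {tg n * xg n - (- xg n * tg n)} \<union>
     {tg n * yg n - (- yg n * tg n)}"

definition hecke_rels :: "weyl_type \<Rightarrow> nat \<Rightarrow> complex \<Rightarrow> complex \<Rightarrow> free_elt set" where
  "hecke_rels ty n u v =
     common_rels ty n \<union>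
     (case ty of TypeA \<Rightarrow> {} | TypeB \<Rightarrow> tn_rels_B n | TypeD \<Rightarrow> tn_rels_D n) \<union>
     {commutator (yg j) (xg i) - yx_value ty n u v j i | i j. i \<in> {1..n} \<and> j \<in> {1..n}}"

definition covering_daha ::
  "weyl_type \<Rightarrow> nat \<Rightarrow> complex \<Rightarrow> complex \<Rightarrow> (complex, free_elt set) module" where
  "covering_daha ty n u v = presented_algebra (gens ty n) (hecke_rels ty n u v)"

definition daha_class ::
  "weyl_type \<Rightarrow> nat \<Rightarrow> complex \<Rightarrow> complex \<Rightarrow> free_elt \<Rightarrow> free_elt set" where
  "daha_class ty n u v = alg_class (gens ty n) (hecke_rels ty n u v)"

text \<open>The canonical map from the double cover to the algebra; an element of the double cover is a
  class of words, and all words in it have the same image.\<close>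

definition cover_map ::
  "weyl_type \<Rightarrow> nat \<Rightarrow> complex \<Rightarrow> complex \<Rightarrow> cover_gen list set \<Rightarrow> free_elt set" where
  "cover_map ty n u v w = the_elem ((\<lambda>l. daha_class ty n u v (wd l)) ` w)"

definition exponents :: "nat \<Rightarrow> (nat \<Rightarrow> nat) set" where
  "exponents n = {1..n} \<rightarrow>\<^sub>E UNIV"

definition x_pow :: "nat \<Rightarrow> (nat \<Rightarrow> nat) \<Rightarrow> free_elt" where
  "x_pow n \<alpha> = prod_list (map (\<lambda>i. xg i ^ \<alpha> i) [1..<Suc n])"

definition y_pow :: "nat \<Rightarrow> (nat \<Rightarrow> nat) \<Rightarrow> free_elt" where
  "y_pow n \<gamma> = prod_list (map (\<lambda>i. yg i ^ \<gamma> i) [1..<Suc n])"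

definition pbw_element ::
  "weyl_type \<Rightarrow> nat \<Rightarrow> complex \<Rightarrow> complex \<Rightarrow> (nat \<Rightarrow> nat) \<Rightarrow> cover_gen list set \<Rightarrow> (nat \<Rightarrow> nat) \<Rightarrow>
     free_elt set" where
  "pbw_element ty n u v \<alpha> w \<gamma> =
     daha_class ty n u v (x_pow n \<alpha>)
       \<otimes>\<^bsub>covering_daha ty n u v\<^esub> cover_map ty n u v w
       \<otimes>\<^bsub>covering_daha ty n u v\<^esub> daha_class ty n u v (y_pow n \<gamma>)"

lemma wd_in_free_algebra:
  "wd l \<in> carrier (free_algebra (gens ty n)) \<longleftrightarrow> l \<in> lists (cover_gens ty n)"
  by (auto simp: wd_def gens_def)

lemma root_elts_lists:
  assumes adm: "admissible_rank ty n" and i: "i \<in> {1..n}" and j: "j \<in> {1..n}"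
  shows "i \<noteq> j \<Longrightarrow> root_elt i j \<in> lists (cover_gens ty n)"
    "ty \<noteq> TypeA \<Longrightarrow> root_elt_bar ty' n i j \<in> lists (cover_gens ty n)"
    "ty \<noteq> TypeA \<Longrightarrow> root_elt_single n i \<in> lists (cover_gens ty n)"
proof -
  let ?G = "cover_gens ty n"
  have T: "Tc k \<in> ?G" if "1 \<le> k" "k < n \<or> k = n \<and> ty \<noteq> TypeA" for k
    using that by (auto simp: cover_gens_def)
  have Z: "Zc \<in> ?G" by (simp add: cover_gens_def)
  have rep: "replicate m Zc \<in> lists ?G" for m
    using Z by (induction m) auto
  have up: "tup a b \<in> lists ?G" if "1 \<le> a" "b < n" for a b
    using T that by (auto simp: tup_def)
  have down: "tdown a b \<in> lists ?G" if "1 \<le> b" "a < n" for a b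
    using T that by (auto simp: tdown_def tup_def)
  have pos: "replicate (b - a - 1) Zc @ tdown (b - 1) (a + 1) @ [Tc a] @ tup (a + 1) (b - 1) \<in> lists ?G"
    if "1 \<le> a" "a < b" "b \<le> n" for a b
    using that by (intro append_in_lists_conv[THEN iffD2] conjI rep down up) (auto intro: T)
  show "root_elt i j \<in> lists ?G" if "i \<noteq> j"
    using that pos[of i j] pos[of j i] i j Z by (cases "i < j") (auto simp: root_elt_def Let_def)
  have n: "n - 1 < n" "n - 2 < n" "1 \<le> n" using i by auto
  show "root_elt_bar ty' n i j \<in> lists ?G" if ty: "ty \<noteq> TypeA"
  proof -
    have "1 \<le> n - 1" using adm ty by (cases ty) (auto simp: admissible_rank_def)
    then have "Tc (n - 1) \<in> ?G" "Tc n \<in> ?G"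
      using T n ty by auto
    moreover have "1 \<le> min i j" "1 \<le> max i j" using i j by auto
    ultimately show ?thesis
      unfolding root_elt_bar_def Let_def using n rep up down
      by (simp add: append_in_lists_conv del: in_lists_conv_set)
  qed
  show "root_elt_single n i \<in> lists ?G" if ty: "ty \<noteq> TypeA"
  proof -
    have "Tc n \<in> ?G" "1 \<le> i" using T n ty i by auto
    then show ?thesis
      unfolding root_elt_single_def using n rep up down
      by (simp add: append_in_lists_conv del: in_lists_conv_set)
  qed
qed

lemma hecke_rels_carrier:
  assumes adm: "admissible_rank ty n"
  shows "hecke_rels ty n u v \<subseteq> carrier (free_algebra (gens ty n))"
proof -
  define F where "F = free_algebra (gens ty n)"
  note cl = free_algebra_closed[of _ "gens ty n", folded F_def]
  note wd_iff = wd_in_free_algebra[of _ ty n, folded F_def]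
  have x: "xg i \<in> carrier F" "yg i \<in> carrier F" if "i \<in> {1..n}" for i
    using that by (auto simp: F_def xg_def yg_def gens_def)
  have g: "monomial [g] \<in> carrier F" if "g \<in> gens ty n" for g
    using that by (auto simp: F_def)
  have z: "zg \<in> carrier F"
    by (auto simp: zg_def wd_iff cover_gens_def)
  have t: "tg i \<in> carrier F" if "i \<in> {1..n}" "ty = TypeA \<longrightarrow> i \<noteq> n" for i
    using that by (auto simp: tg_def wd_iff cover_gens_def)
  have w: "wd l \<in> carrier F" "wd r \<in> carrier F" if "(l, r) \<in> cover_rels ty n" for l r
    using that cover_rels_lists[OF adm] by (auto simp: wd_iff simp del: in_lists_conv_set)
  have s: "sum f K \<in> carrier F" if "\<And>k. k \<in> K \<Longrightarrow> f k \<in> carrier F" for f :: "nat \<Rightarrow> free_elt" and K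
    using that
  proof (induction K rule: infinite_finite_induct)
    case (insert k K)
    then show ?case by (auto intro!: cl(1))
  qed (auto simp: F_def)
  have sc: "scal c \<in> carrier F" for c
    by (simp add: F_def)
  have n: "1 \<le> n" "ty \<noteq> TypeA \<Longrightarrow> 2 \<le> n"
    using adm by (auto simp: admissible_rank_def split: weyl_type.splits)
  have r: "wd (root_elt i j) \<in> carrier F" if "i \<in> {1..n}" "j \<in> {1..n}" "i \<noteq> j" for i j
    using root_elts_lists(1)[OF adm] that by (simp add: wd_iff del: in_lists_conv_set)
  have rb: "wd (root_elt_bar ty' n i j) \<in> carrier F"
    if "i \<in> {1..n}" "j \<in> {1..n}" "ty \<noteq> TypeA" for i j ty'
    using root_elts_lists(2)[OF adm] that by (simp add: wd_iff del: in_lists_conv_set)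
  have rs: "wd (root_elt_single n i) \<in> carrier F" if "i \<in> {1..n}" "ty \<noteq> TypeA" for i
    using root_elts_lists(3)[OF adm, of i i] that
    by (simp add: wd_iff del: in_lists_conv_set)
  have 1: "common_rels ty n \<subseteq> carrier F"
  proof -
    have "{wd l - wd r |l r. (l, r) \<in> cover_rels ty n} \<subseteq> carrier F"
      using w cl(2) by blast
    then show ?thesis
      unfolding common_rels_def by (intro Un_least) (auto intro!: cl(2) cl(4) x g z t)
  qed
  have 2: "(case ty of TypeA \<Rightarrow> {} | TypeB \<Rightarrow> tn_rels_B n | TypeD \<Rightarrow> tn_rels_D n) \<subseteq> carrier F"
    using n by (cases ty) (auto simp: tn_rels_B_def tn_rels_D_def intro!: cl(1,2,4) cl(3)[OF _ z] x z t)
  have 3: "yx_value ty n u v j i \<in> carrier F" if "i \<in> {1..n}" "j \<in> {1..n}" for i j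
    using that unfolding yx_value_def
    by (cases ty) (auto intro!: cl(1,2,4) cl(3)[OF _ z] s z r rb rs sc)
  have 4: "commutator (yg j) (xg i) \<in> carrier F" if "i \<in> {1..n}" "j \<in> {1..n}" for i j
    unfolding commutator_def using that by (intro cl(2) cl(4) x)
  have "{commutator (yg j) (xg i) - yx_value ty n u v j i | i j. i \<in> {1..n} \<and> j \<in> {1..n}}
      \<subseteq> carrier F"
    using cl(2)[OF 4 3] by blast
  with 1 2 show ?thesis
    unfolding hecke_rels_def F_def by (intro Un_least)
qed

theorem covering_daha_algebra:
  assumes "admissible_rank ty n"
  shows "ring (covering_daha ty n u v)" "vectorspace class_ring (covering_daha ty n u v)"
  using ring_presented_algebra[OF hecke_rels_carrier[OF assms]]
    vectorspace_presented_algebra[OF hecke_rels_carrier[OF assms]]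
  by (simp_all add: covering_daha_def)

theorem cover_map_class:
  assumes adm: "admissible_rank ty n" and l: "l \<in> lists (cover_gens ty n)"
  shows "cover_map ty n u v (word_cong (cover_gens ty n) (cover_rels ty n) `` {l})
       = daha_class ty n u v (wd l)"
proof -
  let ?A = "cover_gens ty n" and ?R = "cover_rels ty n"
  let ?H = "covering_daha ty n u v" and ?F = "free_algebra (gens ty n)"
  note HR = hecke_rels_carrier[OF adm, of u v]
  have hom: "daha_class ty n u v \<in> Ring.ring_hom ?F ?H"
    unfolding daha_class_def covering_daha_def using alg_class_hom[OF HR] .
  have app: "wd (a @ b) = wd a * wd b" for a b
    by (simp add: wd_def monomial_def mult_single plus_fmon_def)
  have mult: "daha_class ty n u v (wd (a @ b))
      = daha_class ty n u v (wd a) \<otimes>\<^bsub>?H\<^esub> daha_class ty n u v (wd b)"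
    if "a \<in> lists ?A" "b \<in> lists ?A" for a b
    using ring_hom_mult[OF hom, of "wd a" "wd b"] that by (simp add: app wd_in_free_algebra)
  have eq: "daha_class ty n u v (wd a) = daha_class ty n u v (wd b)"
    if "(a, b) \<in> word_cong ?A ?R" for a b
    using that
  proof induction
    case (rel l r a b)
    have lr: "l \<in> lists ?A" "r \<in> lists ?A" using rel cover_rels_lists[OF adm] by auto
    have "wd l - wd r \<in> hecke_rels ty n u v"
      using rel by (auto simp: hecke_rels_def common_rels_def)
    then have "daha_class ty n u v (wd l) = daha_class ty n u v (wd r)"
      unfolding daha_class_def using lr by (intro alg_class_eq[OF HR]) (simp_all add: wd_in_free_algebra)
    then show ?case using rel lr by (simp add: mult)
  qed simp_all
  have "(l, l) \<in> word_cong ?A ?R" using l by (rule word_cong.refl)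
  then have "(\<lambda>k. daha_class ty n u v (wd k)) ` (word_cong ?A ?R `` {l}) = {daha_class ty n u v (wd l)}"
    using eq by blast
  then show ?thesis by (simp add: cover_map_def)
qed

end

theory Submission
  imports Defs "HOL-Combinatorics.Transposition" "HOL-Library.Multiset"
begin

text \<open>The algebra is made to act on the space with basis \<open>x\<^sup>a y\<^sup>M w\<close>, where \<open>a\<close> is a word, \<open>M\<close> a
  multiset and \<open>w\<close> an element of the double cover: at first the \<open>x\<^sub>i\<close> satisfy no relations among
  themselves. The generators of the double cover act by signed permutations, and \<open>y\<^sub>k\<close> is moved
  past the letters of \<open>a\<close> by means of the prescribed commutators. Since these commutators are
  permuted by the double cover, the relations between the \<open>t\<^sub>i\<close> and the \<open>y\<^sub>k\<close> hold; the Jacobi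
  identity \<open>[y\<^sub>a, [y\<^sub>b, x\<^sub>k]] = [y\<^sub>b, [y\<^sub>a, x\<^sub>k]]\<close> implies that the \<open>y\<^sub>k\<close> commute; and every \<open>y\<^sub>k\<close>
  commutes with \<open>x\<^sub>i x\<^sub>j - z x\<^sub>j x\<^sub>i\<close>. The latter elements therefore generate a submodule that lies in
  the kernel of the normal ordering of words. A PBW element applied to \<open>1\<close> and then normally ordered
  is a nonzero multiple of a basis vector which determines the element, whence linear independence.
  That the PBW elements span follows by moving all \<open>x\<^sub>i\<close> to the left and all \<open>y\<^sub>k\<close> to the right.\<close>

section \<open>Double covers acting on a set\<close>

text \<open>Letting the x_i act freely on words makes \<open>Y k\<close> definable by recursion on
  the word, with no well-definedness to check; on normally ordered monomials the same operator would
  have to be proved compatible with every reordering. The price is the submodule \<open>N\<close>,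
  which must be stable under all operators. With the group element placed to the right of the
  y-letters, the cover acts on letters by signed permutations and on the last component by left
  multiplication, so its relations can be tested one letter at a time. The obstacle is that the
  prescribed commutators are long words. How such a word passes x and y, and how the generators
  permute these words, has to come out of the defining relations with the right signs and powers of
  z. Twisted conjugation A -> z t A t absorbs those powers: every root element arises from a single
  generator by such conjugations, and properties of generators are transported along them. The
  element z is never specialised to 1 or -1, so that the whole cover acts at once.\<close>

abbreviation word_op :: "('g \<Rightarrow> 'v \<Rightarrow> 'v) \<Rightarrow> 'g list \<Rightarrow> 'v \<Rightarrow> 'v" where
  "word_op f l \<equiv> foldr f l"

text \<open>Only the permutation of indices is kept here; signs are recorded by
  \<open>sign_change\<close>, so the last generator of type B, a pure sign change, gives
  \<open>id\<close>.\<close>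

definition refl_perm :: "weyl_type \<Rightarrow> nat \<Rightarrow> nat \<Rightarrow> nat \<Rightarrow> nat" where
  "refl_perm ty n k =
     (if k < n then transpose k (k + 1) else if ty = TypeD then transpose (n - 1) n else id)"

text \<open>How the root elements are permuted follows from the relations of the cover alone, so the
  operators act on a bare set and \<open>Z\<close> remains an operator; linearity and signs enter
  only with the representation.\<close>

locale cover_action =
  fixes ty :: weyl_type and n :: nat and f :: "cover_gen \<Rightarrow> 'v \<Rightarrow> 'v"
  assumes adm: "admissible_rank ty n"
    and rel: "(l, r) \<in> cover_rels ty n \<Longrightarrow> word_op f l v = word_op f r v"
begin

abbreviation Z where "Z \<equiv> f Zc"
abbreviation T where "T i \<equiv> f (Tc i)"

lemma rank: "1 \<le> n" "ty \<noteq> TypeA \<Longrightarrow> 2 \<le> n" "ty = TypeD \<Longrightarrow> 4 \<le> n"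
  using adm by (auto simp: admissible_rank_def split: weyl_type.splits)

definition gen_index :: "nat \<Rightarrow> bool" where
  "gen_index k \<longleftrightarrow> 1 \<le> k \<and> (k < n \<or> k = n \<and> ty \<noteq> TypeA)"

lemma gen_index_less [simp]: "1 \<le> k \<Longrightarrow> k < n \<Longrightarrow> gen_index k"
  by (simp add: gen_index_def)

lemma gen_index_n [simp]: "gen_index n \<longleftrightarrow> ty \<noteq> TypeA"
  using rank(1) by (simp add: gen_index_def)

lemma ZZ [simp]: "Z (Z v) = v"
  using rel[of "[Zc, Zc]" "[]" v] by (simp add: cover_rels_def)

lemma TZ [simp]: "gen_index k \<Longrightarrow> T k (Z v) = Z (T k v)"
  using rel[of "[Zc, Tc k]" "[Tc k, Zc]" v]
  by (auto simp: cover_rels_def cover_gens_def gen_index_def)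

lemma TT [simp]: "gen_index k \<Longrightarrow> T k (T k v) = v"
  using rel[of "[Tc k, Tc k]" "[]" v] unfolding gen_index_def
  by (cases ty) (auto simp: cover_rels_def cover_rels_A_def cover_rels_B_def cover_rels_D_def)

lemma braid_A: "1 \<le> k \<Longrightarrow> k + 1 < n \<Longrightarrow> T k (T (k + 1) (T k v)) = T (k + 1) (T k (T (k + 1) v))"
  using rel[of "[Tc k, Tc (k + 1), Tc k]" "[Tc (k + 1), Tc k, Tc (k + 1)]" v]
  by (auto simp: cover_rels_def cover_rels_A_def)

lemma far_A:
  "1 \<le> k \<Longrightarrow> k < n \<Longrightarrow> 1 \<le> m \<Longrightarrow> m < n \<Longrightarrow> k + 1 < m \<or> m + 1 < k \<Longrightarrow> T k (T m v) = Z (T m (T k v))"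
  using rel[of "[Tc k, Tc m]" "[Zc, Tc m, Tc k]" v]
  by (auto simp: cover_rels_def cover_rels_A_def)

lemma far_B: "ty = TypeB \<Longrightarrow> 1 \<le> k \<Longrightarrow> k + 2 \<le> n \<Longrightarrow> T k (T n v) = Z (T n (T k v))"
  using rel[of "[Tc k, Tc n]" "[Zc, Tc n, Tc k]" v]
  by (force simp: cover_rels_def cover_rels_B_def)

lemma braid_B: "ty = TypeB \<Longrightarrow>
    T (n - 1) (T n (T (n - 1) (T n v))) = Z (T n (T (n - 1) (T n (T (n - 1) v))))"
  using rel[of "[Tc (n-1), Tc n, Tc (n-1), Tc n]" "[Zc, Tc n, Tc (n-1), Tc n, Tc (n-1)]" v]
  by (auto simp: cover_rels_def cover_rels_B_def)

lemma far_D: "ty = TypeD \<Longrightarrow> 1 \<le> k \<Longrightarrow> k < n \<Longrightarrow> k \<noteq> n - 2 \<Longrightarrow> T k (T n v) = Z (T n (T k v))"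
  using rel[of "[Tc k, Tc n]" "[Zc, Tc n, Tc k]" v]
  by (auto simp: cover_rels_def cover_rels_D_def)

lemma braid_D: "ty = TypeD \<Longrightarrow> T (n - 2) (T n (T (n - 2) v)) = T n (T (n - 2) (T n v))"
  using rel[of "[Tc (n-2), Tc n, Tc (n-2)]" "[Tc n, Tc (n-2), Tc n]" v]
  by (auto simp: cover_rels_def cover_rels_D_def)

text \<open>Conjugation by a generator, twisted by \<open>z\<close>. The twist turns the relations of the double cover
  into those of the Weyl group, which therefore acts on the operators commuting with \<open>Z\<close>.\<close>

definition conj :: "nat \<Rightarrow> ('v \<Rightarrow> 'v) \<Rightarrow> 'v \<Rightarrow> 'v" where
  "conj k A v = Z (T k (A (T k v)))"

definition comm_z :: "('v \<Rightarrow> 'v) \<Rightarrow> bool" where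
  "comm_z A \<longleftrightarrow> (\<forall>v. A (Z v) = Z (A v))"

lemma comm_zD: "comm_z A \<Longrightarrow> A (Z v) = Z (A v)"
  by (simp add: comm_z_def)

lemma comm_z_conj [intro, simp]: "gen_index k \<Longrightarrow> comm_z A \<Longrightarrow> comm_z (conj k A)"
  by (simp add: comm_z_def conj_def)

lemma comm_z_T [intro, simp]: "gen_index k \<Longrightarrow> comm_z (T k)"
  by (simp add: comm_z_def)

lemma conj_conj [simp]: "gen_index k \<Longrightarrow> conj k (conj k A) = A"
  by (simp add: conj_def fun_eq_iff)

lemma T_conj: "gen_index k \<Longrightarrow> T k (A v) = Z (conj k A (T k v))"
  by (simp add: conj_def)

definition anticomm :: "nat \<Rightarrow> nat \<Rightarrow> bool" where
  "anticomm k m \<longleftrightarrow> gen_index k \<and> gen_index m \<and> (\<forall>v. T k (T m v) = Z (T m (T k v)))"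

lemma anticomm_sym: "anticomm k m \<Longrightarrow> anticomm m k"
  by (simp add: anticomm_def)

lemma anticomm_A [simp]:
  "1 \<le> k \<Longrightarrow> k < n \<Longrightarrow> 1 \<le> m \<Longrightarrow> m < n \<Longrightarrow> k + 1 < m \<or> m + 1 < k \<Longrightarrow> anticomm k m"
  using far_A by (simp add: anticomm_def)

lemma anticomm_B: "ty = TypeB \<Longrightarrow> 1 \<le> k \<Longrightarrow> k + 2 \<le> n \<Longrightarrow> anticomm n k"
  unfolding anticomm_def gen_index_def by (simp add: far_B)

lemma anticomm_D: "ty = TypeD \<Longrightarrow> 1 \<le> k \<Longrightarrow> k < n \<Longrightarrow> k \<noteq> n - 2 \<Longrightarrow> anticomm n k"
  unfolding anticomm_def gen_index_def by (simp add: far_D)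

text \<open>Interchanging \<open>T k\<close> and \<open>T m\<close> costs one \<open>Z\<close> on
  each side of \<open>A\<close>; the two cancel because \<open>A\<close> commutes with
  \<open>Z\<close>.\<close>

lemma conj_commute: "anticomm k m \<Longrightarrow> comm_z A \<Longrightarrow> conj k (conj m A) = conj m (conj k A)"
  by (simp add: anticomm_def conj_def comm_z_def fun_eq_iff)

text \<open>The \<open>Z\<close> of the relation cancels against the twist in \<open>conj\<close>,
  so generators that commute up to \<open>z\<close> fix each other, as orthogonal reflections
  do.\<close>

lemma conj_anticomm_T: "anticomm k m \<Longrightarrow> conj k (T m) = T m"
  by (simp add: anticomm_def conj_def fun_eq_iff)

lemma conj_self_T: "gen_index k \<Longrightarrow> conj k (T k) = (\<lambda>v. Z (T k v))"
  by (simp add: conj_def fun_eq_iff)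

lemma conj_Z: "gen_index k \<Longrightarrow> conj k (\<lambda>v. Z (A v)) = (\<lambda>v. Z (conj k A v))"
  by (simp add: conj_def fun_eq_iff)

definition braid :: "nat \<Rightarrow> nat \<Rightarrow> bool" where
  "braid k m \<longleftrightarrow> gen_index k \<and> gen_index m \<and> (\<forall>v. T k (T m (T k v)) = T m (T k (T m v)))"

lemma braid_sym: "braid k m \<Longrightarrow> braid m k"
  by (simp add: braid_def)

lemma braid_consecutive [simp]: "1 \<le> k \<Longrightarrow> Suc k < n \<Longrightarrow> braid k (Suc k)" "1 \<le> k \<Longrightarrow> Suc k < n \<Longrightarrow> braid (Suc k) k"
  using braid_A by (simp_all add: braid_def)

lemma braid_n_D: "ty = TypeD \<Longrightarrow> braid n (n - 2)"
  using rank unfolding braid_def gen_index_def by (simp add: braid_D)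

lemma conj_braid: "braid k m \<Longrightarrow> conj k (conj m (conj k A)) = conj m (conj k (conj m A))"
  by (simp add: braid_def conj_def fun_eq_iff)

lemma conj_braid_T: "braid k m \<Longrightarrow> conj k (T m) = conj m (T k)"
  by (simp add: braid_def conj_def fun_eq_iff)

text \<open>Weyl group analogue: if s_k fixes a root, then s_m fixes the image of this root under
  s_k s_m. This takes the place of far commutation where neighbouring generators meet.\<close>

lemma conj_fixed_braid:
  assumes "braid k m" "conj k A = A"
  shows "conj m (conj k (conj m A)) = conj k (conj m A)"
  using conj_braid[OF assms(1), of A] assms(2) by simp

lemma conj_eq_iff: "gen_index k \<Longrightarrow> conj k A = B \<longleftrightarrow> A = conj k B"
  by (metis conj_conj)

section \<open>Operators of the root elements and conjugation by the generators of type A\<close>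

definition S :: "nat \<Rightarrow> nat \<Rightarrow> 'v \<Rightarrow> 'v" where "S i j = word_op f (root_elt i j)"
definition B :: "nat \<Rightarrow> nat \<Rightarrow> 'v \<Rightarrow> 'v" where "B i j = word_op f (root_elt_bar ty n i j)"
definition E :: "nat \<Rightarrow> 'v \<Rightarrow> 'v" where "E i = word_op f (root_elt_single n i)"

lemma S_sym: "i < j \<Longrightarrow> S j i = (\<lambda>v. Z (S i j v))"
  by (simp add: S_def root_elt_def fun_eq_iff)

lemma S_sym': "i \<noteq> j \<Longrightarrow> S j i = (\<lambda>v. Z (S i j v))"
  using S_sym[of i j] S_sym[of j i] by (cases "i < j") (simp_all add: fun_eq_iff)

lemma B_sym: "B j i = B i j"
  by (simp add: B_def root_elt_bar_def min.commute max.commute)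

lemma word_op_replicate_Z: "word_op f (replicate m Zc) = (Z ^^ m)"
  by (induction m) (simp_all add: fun_eq_iff funpow_swap1)

lemma S_base: "S i (i + 1) = T i"
  by (simp add: S_def root_elt_def tdown_def tup_def fun_eq_iff)

lemma T_Zpow: "gen_index k \<Longrightarrow> T k ((Z ^^ m) v) = (Z ^^ m) (T k v)"
  by (induction m) simp_all

text \<open>The word of \<open>{i,j+1}\<close> is that of \<open>{i,j}\<close> with
  \<open>t_j\<close> put on both ends and one more \<open>z\<close>, which is exactly a twisted
  conjugation; this accounts for the exponent of \<open>z\<close> in the definition.\<close>

lemma S_step: assumes "1 \<le> i" "i < j" "j < n" shows "S i (j + 1) = conj j (S i j)"
proof -
  have 1: "tdown j (i + 1) = Tc j # tdown (j - 1) (i + 1)" "tup (i + 1) j = tup (i + 1) (j - 1) @ [Tc j]"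
    using assms by (auto simp: tdown_def tup_def)
  have 2: "j - i = Suc (j - i - 1)" using assms by simp
  have "S i (j + 1) v = conj j (S i j) v" for v
  proof -
    have "root_elt i (j + 1) = Zc # replicate (j - i - 1) Zc @ Tc j # tdown (j - 1) (i + 1) @ [Tc i] @ tup (i + 1) (j - 1) @ [Tc j]"
      using assms 1 2 by (simp add: root_elt_def)
    moreover have "root_elt i j = replicate (j - i - 1) Zc @ tdown (j - 1) (i + 1) @ [Tc i] @ tup (i + 1) (j - 1)"
      using assms by (simp add: root_elt_def)
    ultimately show ?thesis
      using assms by (simp add: S_def conj_def word_op_replicate_Z T_Zpow)
  qed
  then show ?thesis by (simp add: fun_eq_iff)
qed

lemma comm_z_S_less: assumes "1 \<le> i" "i < j" "j \<le> n" shows "comm_z (S i j)"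
proof -
  have "Suc i \<le> j" using assms by simp
  then show ?thesis using assms(3)
  proof (induction j rule: dec_induct)
    case base
    then show ?case using assms S_base[of i] by simp
  next
    case (step j)
    then show ?case using assms S_step[of i j] by simp
  qed
qed

lemma comm_z_S [simp]: assumes "i \<in> {1..n}" "j \<in> {1..n}" "i \<noteq> j" shows "comm_z (S i j)"
proof (cases "i < j")
  case True
  then show ?thesis using assms comm_z_S_less by simp
next
  case False
  then have "comm_z (S j i)" using assms comm_z_S_less by simp
  moreover have "S i j = (\<lambda>v. Z (S j i v))" using False assms S_sym by simp
  ultimately show ?thesis by (simp add: comm_z_def)
qed

lemma conj_S_above:
  assumes "1 \<le> i" "i < j" "j < k" "k < n"
  shows "conj k (S i j) = S i j"
proof -
  have "Suc i \<le> j" using assms by simp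
  then show ?thesis using assms(3)
  proof (induction j rule: dec_induct)
    case base
    then show ?case using assms S_base[of i] by (simp add: conj_anticomm_T)
  next
    case (step j)
    then show ?case using assms S_step[of i j] comm_z_S_less[of i j] by (simp add: conj_commute)
  qed
qed

lemma conj_S_below:
  assumes "1 \<le> k" "k + 1 < i" "i < j" "j \<le> n"
  shows "conj k (S i j) = S i j"
proof -
  have "Suc i \<le> j" using assms by simp
  then show ?thesis using assms(4)
  proof (induction j rule: dec_induct)
    case base
    then show ?case using assms S_base[of i] by (simp add: conj_anticomm_T)
  next
    case (step j)
    then show ?case using assms S_step[of i j] comm_z_S_less[of i j] by (simp add: conj_commute)
  qed
qed

text \<open>The start \<open>j = k + 2\<close> is where the braid relation enters:
  \<open>S i (k + 2)\<close> arises from \<open>S i k\<close> by conjugation with \<open>k\<close>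
  and then \<open>k + 1\<close>, and \<open>S i k\<close> is fixed by \<open>k + 1\<close>.\<close>

lemma conj_S_between:
  assumes "1 \<le> i" "i < k" "k + 1 < j" "j \<le> n"
  shows "conj k (S i j) = S i j"
proof -
  have "k + 2 \<le> j" using assms by simp
  then show ?thesis using assms(4)
  proof (induction j rule: dec_induct)
    case base
    have "S i (k + 2) = conj (k + 1) (conj k (S i k))"
      using S_step[of i "k + 1"] S_step[of i k] assms base by simp
    then show ?case
      using conj_fixed_braid[of "k + 1" k "S i k"] conj_S_above[of i k "k + 1"] assms base by simp
  next
    case (step j)
    then show ?case using assms S_step[of i j] comm_z_S_less[of i j] by (simp add: conj_commute)
  qed
qed

text \<open>By the braid relation \<open>{i,i+2}\<close> is both the conjugate of \<open>t_i\<close>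
  by \<open>t_(i+1)\<close> and that of \<open>t_(i+1)\<close> by \<open>t_i\<close>. Larger
  \<open>j\<close> follow because \<open>t_i\<close> and the added letters commute up to
  \<open>z\<close>.\<close>

lemma conj_S_left:
  assumes "1 \<le> i" "i + 1 < j" "j \<le> n"
  shows "conj i (S i j) = S (i + 1) j"
proof -
  have "i + 2 \<le> j" using assms by simp
  then show ?thesis using assms(3)
  proof (induction j rule: dec_induct)
    case base
    have "S i (i + 2) = conj (i + 1) (T i)"
      using S_step[of i "i + 1"] S_base[of i] assms base by simp
    then show ?case
      using conj_braid_T[of "i + 1" i] S_base[of "i + 1"] assms base by simp
  next
    case (step j)
    then show ?case
      using assms S_step[of i j] S_step[of "i + 1" j] comm_z_S_less[of i j]
        conj_commute[of i j "S i j"] by simp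
  qed
qed

lemma conj_S_less:
  assumes k: "1 \<le> k" "k < n" and ij: "1 \<le> i" "i < j" "j \<le> n"
  shows "conj k (S i j) = S (refl_perm ty n k i) (refl_perm ty n k j)"
proof -
  note g = gen_index_less[OF k]
  \<comment> \<open>The possible positions of the adjacent pair \<open>k\<close>,
    \<open>k + 1\<close> relative to \<open>i < j\<close>.\<close>
  consider "j < k" | "k = j" | "i < k" "k + 1 = j" | "k + 1 < i" | "k + 1 = i" | "k = i" "i + 1 < j"
    | "k = i" "j = i + 1" | "i < k" "k + 1 < j"
    using ij by linarith
  then show ?thesis
  proof cases
    case 1
    then show ?thesis using k ij conj_S_above by (simp add: refl_perm_def transpose_def)
  next
    case 2
    then show ?thesis using k ij S_step[of i j] by (simp add: refl_perm_def transpose_def)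
  next
    case 3
    then have "conj k (S i j) = S i k" using k ij S_step[of i k] by auto
    then show ?thesis using 3 k by (auto simp add: refl_perm_def transpose_def)
  next
    case 4
    then show ?thesis using k ij conj_S_below by (simp add: refl_perm_def transpose_def)
  next
    case 5
    then have "conj k (S i j) = S k j" using k ij g conj_S_left[of k j] by (metis conj_conj)
    then show ?thesis using 5 k ij by (auto simp add: refl_perm_def transpose_def)
  next
    case 6
    then show ?thesis using k ij conj_S_left[of i j] by (simp add: refl_perm_def transpose_def)
  next
    case 7
    then show ?thesis using k ij S_base[of i] S_sym[of i "i + 1"] g conj_self_T[of i]
      by (simp add: refl_perm_def transpose_def)
  next
    case 8
    then show ?thesis using k ij conj_S_between by (simp add: refl_perm_def transpose_def)
  qed
qed

lemma conj_S:
  assumes k: "1 \<le> k" "k < n" and ij: "i \<in> {1..n}" "j \<in> {1..n}" "i \<noteq> j"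
  shows "conj k (S i j) = S (refl_perm ty n k i) (refl_perm ty n k j)"
proof (cases "i < j")
  case True
  then show ?thesis using conj_S_less assms by simp
next
  case False
  then have *: "S i j = (\<lambda>v. Z (S j i v))" using S_sym ij by simp
  have "refl_perm ty n k i \<noteq> refl_perm ty n k j"
    using ij k by (auto simp: refl_perm_def transpose_def split: if_splits)
  then have "S (refl_perm ty n k i) (refl_perm ty n k j) = (\<lambda>v. Z (S (refl_perm ty n k j) (refl_perm ty n k i) v))"
    by (intro S_sym') simp
  then show ?thesis
    using False conj_S_less[of k j i] assms by (simp add: * conj_Z)
qed


section \<open>The barred elements and the elements \<open>{i}\<close> of type B\<close>

lemma B_last: "ty = TypeD \<Longrightarrow> B (n - 1) n = T n" "ty = TypeB \<Longrightarrow> B (n - 1) n = conj n (T (n - 1))"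
  using rank(1,2) unfolding B_def root_elt_bar_def conj_def fun_eq_iff
  by (auto simp: tup_def tdown_def Let_def)

text \<open>The words of the barred elements are shortest at the pair \<open>(n - 1, n)\<close>, so
  inductions run downwards from there. For second index \<open>n\<close> the outer factor t_j ...
  t_(n-1) is empty and \<open>t_i\<close> is the outermost letter; for other pairs it is
  \<open>t_j\<close>, whence the separate \<open>B_right\<close>.\<close>

lemma B_left:
  assumes "1 \<le> i" "i < n - 1" shows "B i n = conj i (B (i + 1) n)"
proof -
  have 1: "tup i (n - 2) = Tc i # tup (i + 1) (n - 2)" "tdown (n - 2) i = tdown (n - 2) (i + 1) @ [Tc i]"
    using assms by (auto simp: tdown_def tup_def upt_rec)
  have 2: "n - i = Suc (n - Suc i)" "n - Suc i = Suc (n - Suc (Suc i))" using assms by simp_all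
  have 3: "tup n (n - 1) = []" "tdown (n - 1) n = []" using assms by (simp_all add: tup_def tdown_def)
  have 4: "gen_index i" "min i n = i" "max i n = n" "min (Suc i) n = Suc i" "max (Suc i) n = n"
    using assms by auto
  show ?thesis
  proof (cases "ty = TypeB")
    case True
    show ?thesis
      unfolding B_def root_elt_bar_def Let_def conj_def fun_eq_iff
      using True 1 3 2(1) by (simp add: word_op_replicate_Z T_Zpow[OF 4(1)] TZ[OF 4(1)] 4(2-))
  next
    case False
    show ?thesis
      unfolding B_def root_elt_bar_def Let_def conj_def fun_eq_iff
      using False 1 3 2(2) by (simp add: word_op_replicate_Z T_Zpow[OF 4(1)] TZ[OF 4(1)] 4(2-))
  qed
qed

lemma B_right:
  assumes "1 \<le> i" "i < j" "j < n" shows "B i j = conj j (B i (j + 1))"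
proof -
  have 1: "tup j (n - 1) = Tc j # tup (j + 1) (n - 1)" "tdown (n - 1) j = tdown (n - 1) (j + 1) @ [Tc j]"
    using assms by (auto simp: tdown_def tup_def upt_rec)
  have 2: "Suc j - i = Suc (j - i)" "j - i = Suc (j - Suc i)" using assms by simp_all
  have 4: "gen_index j" "min i j = i" "max i j = j" "min i (Suc j) = i" "max i (Suc j) = Suc j"
    using assms by auto
  show ?thesis
  proof (cases "ty = TypeB")
    case True
    show ?thesis
      unfolding B_def root_elt_bar_def Let_def conj_def fun_eq_iff
      using True 1 2(1) by (simp add: word_op_replicate_Z T_Zpow[OF 4(1)] TZ[OF 4(1)] 4(2-))
  next
    case False
    show ?thesis
      unfolding B_def root_elt_bar_def Let_def conj_def fun_eq_iff
      using False 1 2 by (simp add: word_op_replicate_Z T_Zpow[OF 4(1)] TZ[OF 4(1)] 4(2-))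
  qed
qed

lemma E_last: "E n = T n"
  using rank(1) by (simp add: E_def root_elt_single_def tup_def tdown_def fun_eq_iff)

lemma E_step:
  assumes "1 \<le> i" "i < n" shows "E i = conj i (E (i + 1))"
proof -
  have 1: "tup i (n - 1) = Tc i # tup (i + 1) (n - 1)" "tdown (n - 1) i = tdown (n - 1) (i + 1) @ [Tc i]"
    using assms by (auto simp: tdown_def tup_def upt_rec)
  have 2: "n - i = Suc (n - (i + 1))" using assms by simp_all
  have 4: "gen_index i" using assms by auto
  show ?thesis
    unfolding E_def root_elt_single_def fun_eq_iff conj_def 1 2
    by (simp add: word_op_replicate_Z T_Zpow 4)
qed

end

text \<open>Types \<open>B\<close> and \<open>D\<close> share this part because in both of them the reflection in
  \<open>e\<^bsub>n-1\<^esub> + e\<^sub>n\<close> commutes with the same reflections of type \<open>A\<^bsub>n-1\<^esub>\<close>.\<close>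

locale cover_action_BD = cover_action +
  assumes BD: "ty \<noteq> TypeA"
begin

declare BD [simp]

lemma n2: "2 \<le> n" using rank BD by simp

lemma cases_BD: "ty = TypeB \<or> ty = TypeD" using BD by (cases ty) auto

lemma gen_n [simp]: "gen_index n" using BD by simp

lemma anticomm_n: "1 \<le> k \<Longrightarrow> k + 2 < n \<Longrightarrow> anticomm n k"
  using cases_BD anticomm_B[of k] anticomm_D[of k] by fastforce

lemma comm_z_B_last: "comm_z (B (n - 1) n)"
proof (cases "ty = TypeD")
  case True
  then show ?thesis by (metis B_last(1) comm_z_T gen_n)
next
  case False
  then have "ty = TypeB" using cases_BD by simp
  moreover have "comm_z (conj n (T (n - 1)))" using n2 by simp
  ultimately show ?thesis by (metis B_last(2))
qed

text \<open>Among the generators of type A only the reflection s_(n-2) moves e_(n-1) + e_n. In type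
  D this is commutation with \<open>t_n\<close> up to \<open>z\<close>; in type B the case
  \<open>k = n - 1\<close> is the relation of length four.\<close>

lemma conj_B_last:
  assumes "1 \<le> k" "k < n" "k \<noteq> n - 2" shows "conj k (B (n - 1) n) = B (n - 1) n"
proof (cases "ty = TypeD")
  case True
  then show ?thesis using B_last(1) anticomm_D assms anticomm_sym conj_anticomm_T by metis
next
  case False
  then have ty: "ty = TypeB" using cases_BD by simp
  note B = B_last(2)[OF ty]
  show ?thesis
  proof (cases "k = n - 1")
    case True
    have g: "gen_index (n - 1)" using n2 by simp
    have "T (n - 1) (T n (T (n - 1) (T n (T (n - 1) v)))) = Z (T n (T (n - 1) (T n v)))" for v
      using braid_B[OF ty, of "T (n - 1) v"] g by simp
    then show ?thesis unfolding True B conj_def fun_eq_iff using g by simp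
  next
    case False
    then have "anticomm n k" "anticomm k (n - 1)" using assms anticomm_n[of k] by simp_all
    then show ?thesis
      unfolding B using n2 conj_commute[of n k "T (n - 1)"] conj_anticomm_T[of k "n - 1"] by simp
  qed
qed

lemma comm_z_B_n: "1 \<le> i \<Longrightarrow> i < n \<Longrightarrow> comm_z (B i n)"
proof (induction "n - 1 - i" arbitrary: i)
  case 0
  then have "i = n - 1" by simp
  then show ?case using comm_z_B_last by simp
next
  case (Suc m)
  then have "comm_z (B (i + 1) n)" by simp
  then show ?case using B_left[of i] Suc by simp
qed

lemma comm_z_B_less: "1 \<le> i \<Longrightarrow> i < j \<Longrightarrow> j \<le> n \<Longrightarrow> comm_z (B i j)"
proof (induction "n - j" arbitrary: j)
  case 0
  then show ?case using comm_z_B_n by simp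
next
  case (Suc m)
  then have "comm_z (B i (j + 1))" by simp
  then show ?case using B_right[of i j] Suc by simp
qed

lemma comm_z_B [simp]: "i \<in> {1..n} \<Longrightarrow> j \<in> {1..n} \<Longrightarrow> i \<noteq> j \<Longrightarrow> comm_z (B i j)"
  using comm_z_B_less[of i j] comm_z_B_less[of j i] B_sym[of i j] by (cases "i < j") auto

lemma conj_B_n_below: "1 \<le> k \<Longrightarrow> k + 1 < i \<Longrightarrow> i < n \<Longrightarrow> conj k (B i n) = B i n"
proof (induction "n - 1 - i" arbitrary: i)
  case 0
  then have "i = n - 1" by simp
  then show ?case using conj_B_last[of k] 0 by simp
next
  case (Suc m)
  then have "conj k (B (i + 1) n) = B (i + 1) n" by simp
  then show ?case using B_left[of i] Suc conj_commute[of k i "B (i + 1) n"] comm_z_B_n[of "i + 1"] by simp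
qed

lemma conj_B_below: "1 \<le> k \<Longrightarrow> k + 1 < i \<Longrightarrow> i < j \<Longrightarrow> j \<le> n \<Longrightarrow> conj k (B i j) = B i j"
proof (induction "n - j" arbitrary: j)
  case 0
  then show ?case using conj_B_n_below by simp
next
  case (Suc m)
  then have "conj k (B i (j + 1)) = B i (j + 1)" by simp
  then show ?case using B_right[of i j] Suc conj_commute[of k j "B i (j + 1)"] comm_z_B_less[of i "j + 1"] by simp
qed

lemma conj_B_left: "1 \<le> i \<Longrightarrow> i + 1 < j \<Longrightarrow> j \<le> n \<Longrightarrow> conj i (B (i + 1) j) = B i j"
proof (induction "n - j" arbitrary: j)
  case 0
  then show ?case using B_left[of i] by simp
next
  case (Suc m)
  then have "conj i (B (i + 1) (j + 1)) = B i (j + 1)" by simp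
  then show ?case
    using B_right[of i j] B_right[of "i + 1" j] Suc conj_commute[of i j "B (i + 1) (j + 1)"]
      comm_z_B_less[of "i + 1" "j + 1"] by simp
qed

lemma conj_B_n_between: "1 \<le> i \<Longrightarrow> i < k \<Longrightarrow> k + 1 < n \<Longrightarrow> conj k (B i n) = B i n"
proof (induction "n - 1 - i" arbitrary: i)
  case 0
  then show ?case by simp
next
  case (Suc m)
  show ?case
  proof (cases "k = i + 1")
    case True
    have "B i n = conj i (conj k (B (i + 2) n))"
      using B_left[of i] B_left[of "i + 1"] Suc True by simp
    then show ?thesis
      using conj_fixed_braid[of i k "B (i + 2) n"] conj_B_n_below[of i "i + 2"] Suc True by simp
  next
    case False
    then have "conj k (B (i + 1) n) = B (i + 1) n" using Suc by simp
    then show ?thesis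
      using B_left[of i] Suc False conj_commute[of k i "B (i + 1) n"] comm_z_B_n[of "i + 1"] by simp
  qed
qed

lemma conj_B_between: "1 \<le> i \<Longrightarrow> i < k \<Longrightarrow> k + 1 < j \<Longrightarrow> j \<le> n \<Longrightarrow> conj k (B i j) = B i j"
proof (induction "n - j" arbitrary: j)
  case 0
  then show ?case using conj_B_n_between by simp
next
  case (Suc m)
  then have "conj k (B i (j + 1)) = B i (j + 1)" by simp
  then show ?case using B_right[of i j] Suc conj_commute[of k j "B i (j + 1)"] comm_z_B_less[of i "j + 1"] by simp
qed

text \<open>Opposite to \<open>S\<close>, the word grows as \<open>j\<close> decreases, so this case
  rests on the one with \<open>k\<close> between the indices: for \<open>k = j + 1\<close> the
  operator comes from \<open>B i (j + 2)\<close>, which is fixed by \<open>j\<close>.\<close>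

lemma conj_B_above: "1 \<le> i \<Longrightarrow> i < j \<Longrightarrow> j < k \<Longrightarrow> k < n \<Longrightarrow> conj k (B i j) = B i j"
proof (induction "n - j" arbitrary: j)
  case 0
  then show ?case by simp
next
  case (Suc m)
  show ?case
  proof (cases "k = j + 1")
    case True
    have "B i j = conj j (conj k (B i (j + 2)))"
      using B_right[of i j] B_right[of i "j + 1"] Suc True by simp
    then show ?thesis
      using conj_fixed_braid[of j k "B i (j + 2)"] conj_B_between[of i j "j + 2"] Suc True by simp
  next
    case False
    then have "conj k (B i (j + 1)) = B i (j + 1)" using Suc by simp
    then show ?thesis
      using B_right[of i j] Suc False conj_commute[of k j "B i (j + 1)"] comm_z_B_less[of i "j + 1"] by simp
  qed
qed

text \<open>s_i followed by s_(i+1) carries e_(i+1) + e_(i+2) to e_i + e_(i+1); the braid relation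
  transports the invariance under \<open>i + 1\<close> of the former to invariance under
  \<open>i\<close> of the latter, starting from \<open>conj_B_last\<close>.\<close>

lemma conj_B_consecutive: "1 \<le> i \<Longrightarrow> i < n \<Longrightarrow> conj i (B i (i + 1)) = B i (i + 1)"
proof (induction "n - 1 - i" arbitrary: i)
  case 0
  then have "i = n - 1" by simp
  then show ?case using conj_B_last[of i] 0 n2 by simp
next
  case (Suc m)
  have IH: "conj (i + 1) (B (i + 1) (i + 2)) = B (i + 1) (i + 2)" using Suc by simp
  have "B i (i + 1) = conj (i + 1) (conj i (B (i + 1) (i + 2)))"
    using B_right[of i "i + 1"] conj_B_left[of i "i + 2"] Suc by simp
  then show ?case
    using conj_fixed_braid[of "i + 1" i "B (i + 1) (i + 2)"] IH Suc by simp
qed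

lemma conj_B_less:
  assumes k: "1 \<le> k" "k < n" and ij: "1 \<le> i" "i < j" "j \<le> n"
  shows "conj k (B i j) = B (refl_perm ty n k i) (refl_perm ty n k j)"
proof -
  note g = gen_index_less[OF k]
  consider "j < k" | "k = j" | "i < k" "k + 1 = j" | "k + 1 < i" | "k + 1 = i" | "k = i" "i + 1 < j"
    | "k = i" "j = i + 1" | "i < k" "k + 1 < j"
    using ij by linarith
  then show ?thesis
  proof cases
    case 1
    then show ?thesis using k ij conj_B_above by (simp add: refl_perm_def transpose_def)
  next
    case 2
    then have "conj k (B i j) = B i (j + 1)" using k ij g B_right[of i j] by simp
    then show ?thesis using 2 k ij by (simp add: refl_perm_def transpose_def)
  next
    case 3
    then have "conj k (B i j) = B i k" using k ij B_right[of i k] by auto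
    then show ?thesis using 3 k by (auto simp add: refl_perm_def transpose_def)
  next
    case 4
    then show ?thesis using k ij conj_B_below by (simp add: refl_perm_def transpose_def)
  next
    case 5
    then have "conj k (B i j) = B k j" using k ij conj_B_left[of k j] by auto
    then show ?thesis using 5 k ij by (auto simp add: refl_perm_def transpose_def)
  next
    case 6
    then have "conj k (B i j) = B (i + 1) j" using k ij g conj_B_left[of i j] by (metis conj_conj)
    then show ?thesis using k ij 6 by (simp add: refl_perm_def transpose_def)
  next
    case 7
    then show ?thesis using k ij conj_B_consecutive[of i] B_sym[of i "i + 1"]
      by (simp add: refl_perm_def transpose_def)
  next
    case 8
    then show ?thesis using k ij conj_B_between by (simp add: refl_perm_def transpose_def)
  qed
qed

lemma conj_B:
  assumes k: "1 \<le> k" "k < n" and ij: "i \<in> {1..n}" "j \<in> {1..n}" "i \<noteq> j"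
  shows "conj k (B i j) = B (refl_perm ty n k i) (refl_perm ty n k j)"
proof (cases "i < j")
  case True
  then show ?thesis using conj_B_less assms by simp
next
  case False
  then show ?thesis
    using conj_B_less[of k j i] assms B_sym[of i j] B_sym[of "refl_perm ty n k i"] by simp
qed

lemma conj_n_S_less: "1 \<le> i \<Longrightarrow> i < j \<Longrightarrow> j + 1 < n \<Longrightarrow> conj n (S i j) = S i j"
proof (induction j)
  case 0
  then show ?case by simp
next
  case (Suc j)
  show ?case
  proof (cases "i = j")
    case True
    then show ?thesis using S_base[of i] Suc by (simp add: conj_anticomm_T anticomm_n)
  next
    case False
    then have "conj n (S i j) = S i j" using Suc by simp
    then show ?thesis
      using S_step[of i j] conj_commute[of n j "S i j"] comm_z_S_less[of i j] anticomm_n[of j] Suc False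
      by simp
  qed
qed

end

section \<open>Type B: conjugation by the last generator\<close>

locale cover_action_B = cover_action +
  assumes B: "ty = TypeB"
begin

sublocale cover_action_BD by unfold_locales (simp add: B)

lemma anticomm_n_B: "1 \<le> k \<Longrightarrow> k + 2 \<le> n \<Longrightarrow> anticomm n k"
  using anticomm_B[OF B] .

lemma conj_n_S:
  assumes "1 \<le> i" "i < j" "j < n" shows "conj n (S i j) = S i j"
proof -
  have "i + 1 \<le> j" using assms by simp
  then show ?thesis using assms(3)
  proof (induction j rule: dec_induct)
    case base
    then show ?case using S_base[of i] assms by (simp add: conj_anticomm_T anticomm_n_B)
  next
    case (step j)
    then show ?case
      using S_step[of i j] conj_commute[of n j "S i j"] comm_z_S_less[of i j] anticomm_n_B[of j] assms
      by simp
  qed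
qed

text \<open>Changing the sign of e_n turns e_i - e_n into e_i + e_n. For \<open>i = n - 1\<close>
  this is \<open>B_last\<close>; smaller \<open>i\<close> are reached through generators that
  commute with \<open>t_n\<close> up to \<open>z\<close>.\<close>

lemma conj_n_S_n: "1 \<le> i \<Longrightarrow> i < n \<Longrightarrow> conj n (S i n) = B i n"
proof (induction "n - 1 - i" arbitrary: i)
  case 0
  then have "i = n - 1" by simp
  then show ?case using S_base[of "n - 1"] B_last(2)[OF B] 0 by simp
next
  case (Suc m)
  then have "conj n (S (i + 1) n) = B (i + 1) n" by simp
  moreover have "S i n = conj i (S (i + 1) n)" using conj_S_left[of i n] Suc by (metis conj_eq_iff gen_index_less less_diff_conv Suc_eq_plus1 zero_less_diff zero_less_Suc le_refl)
  ultimately show ?case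
    using Suc B_left[of i] conj_commute[of n i "S (i + 1) n"] comm_z_S_less[of "i + 1" n] anticomm_n_B[of i]
    by simp
qed

lemma conj_n_B_n: "1 \<le> i \<Longrightarrow> i < n \<Longrightarrow> conj n (B i n) = S i n"
  using conj_n_S_n conj_conj gen_n by metis

text \<open>The \<open>z\<close> in \<open>(t_(n-1) t_n)^2 = z (t_n t_(n-1))^2\<close> is used once
  on each side of \<open>A\<close> and cancels, so the twisted conjugations satisfy the braid
  relation of length four.\<close>

lemma conj_braid_B:
  assumes "comm_z A"
  shows "conj n (conj (n - 1) (conj n (conj (n - 1) A))) = conj (n - 1) (conj n (conj (n - 1) (conj n A)))"
proof -
  have g: "gen_index (n - 1)" using n2 by simp
  have "T n (T (n - 1) (T n (T (n - 1) (A (T (n - 1) (T n (T (n - 1) (T n v))))))))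
    = T (n - 1) (T n (T (n - 1) (T n (A (T n (T (n - 1) (T n (T (n - 1) v))))))))" for v
    using assms g by (simp add: braid_B[OF B, simplified] comm_zD)
  then show ?thesis using g by (simp add: conj_def fun_eq_iff)
qed

text \<open>For \<open>j = n - 1\<close> the element is obtained from \<open>S i (n - 1)\<close>,
  which is fixed by \<open>n\<close>, by conjugation with \<open>n - 1\<close>, \<open>n\<close>,
  \<open>n - 1\<close>; the braid relation of length four moves a further \<open>n\<close>
  through.\<close>

lemma conj_n_B: "1 \<le> i \<Longrightarrow> i < j \<Longrightarrow> j < n \<Longrightarrow> conj n (B i j) = B i j"
proof (induction "n - 1 - j" arbitrary: j)
  case 0
  then have j: "j = n - 1" by simp
  have "B i j = conj (n - 1) (conj n (conj (n - 1) (S i (n - 1))))"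
    using B_right[of i "n - 1"] conj_n_S_n[of i] S_step[of i "n - 1"] j 0 by simp
  then show ?case
    using conj_braid_B[of "S i (n - 1)"] conj_n_S[of i "n - 1"] comm_z_S_less[of i "n - 1"] 0 j by simp
next
  case (Suc m)
  then have "conj n (B i (j + 1)) = B i (j + 1)" by simp
  then show ?case
    using Suc B_right[of i j] conj_commute[of n j "B i (j + 1)"] comm_z_B_less[of i "j + 1"] anticomm_n_B[of j]
    by simp
qed

lemma comm_z_E [simp]: "1 \<le> i \<Longrightarrow> i \<le> n \<Longrightarrow> comm_z (E i)"
proof (induction "n - i" arbitrary: i)
  case 0
  then have "i = n" by simp
  then show ?case using E_last comm_z_T gen_n by metis
next
  case (Suc m)
  then have "comm_z (E (i + 1))" by simp
  then show ?case using E_step[of i] Suc by simp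
qed

lemma conj_E_below: "1 \<le> k \<Longrightarrow> k + 1 < i \<Longrightarrow> i \<le> n \<Longrightarrow> conj k (E i) = E i"
proof (induction "n - i" arbitrary: i)
  case 0
  then show ?case using E_last conj_anticomm_T[OF anticomm_sym[OF anticomm_n_B[of k]]] by simp
next
  case (Suc m)
  then have "conj k (E (i + 1)) = E (i + 1)" by simp
  then show ?case using E_step[of i] Suc conj_commute[of k i "E (i + 1)"] by simp
qed

lemma conj_E_above: "1 \<le> i \<Longrightarrow> i < k \<Longrightarrow> k < n \<Longrightarrow> conj k (E i) = E i"
proof (induction "n - i" arbitrary: i)
  case 0
  then show ?case by simp
next
  case (Suc m)
  show ?case
  proof (cases "k = i + 1")
    case True
    have "E i = conj i (conj k (E (i + 2)))"
      using E_step[of i] E_step[of "i + 1"] Suc True by simp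
    then show ?thesis
      using conj_fixed_braid[of i k "E (i + 2)"] conj_E_below[of i "i + 2"] Suc True by simp
  next
    case False
    then have "conj k (E (i + 1)) = E (i + 1)" using Suc by simp
    then show ?thesis using E_step[of i] Suc False conj_commute[of k i "E (i + 1)"] by simp
  qed
qed

lemma conj_E:
  assumes k: "1 \<le> k" "k < n" and i: "i \<in> {1..n}"
  shows "conj k (E i) = E (refl_perm ty n k i)"
proof -
  consider "k + 1 < i" | "k + 1 = i" | "k = i" | "i < k" by linarith
  then show ?thesis
  proof cases
    case 1
    then show ?thesis using k i conj_E_below by (simp add: refl_perm_def transpose_def)
  next
    case 2
    then have "conj k (E i) = E k" using k E_step[of k] by auto
    then show ?thesis using 2 k by (auto simp: refl_perm_def transpose_def)
  next
    case 3
    then have "conj k (E i) = E (i + 1)" using k E_step[of k] by auto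
    then show ?thesis using 3 k by (auto simp: refl_perm_def transpose_def)
  next
    case 4
    then show ?thesis using k i conj_E_above by (simp add: refl_perm_def transpose_def)
  qed
qed

text \<open>The reflection in e_n reverses its own root, which shows here as a factor
  \<open>z\<close>.\<close>

lemma conj_n_E_n: "conj n (E n) = (\<lambda>v. Z (E n v))"
  using E_last conj_self_T gen_n by simp

lemma conj_n_E: "1 \<le> i \<Longrightarrow> i < n \<Longrightarrow> conj n (E i) = E i"
proof (induction "n - 1 - i" arbitrary: i)
  case 0
  then have i: "i = n - 1" by simp
  have g: "gen_index (n - 1)" using n2 by simp
  have E: "E i = conj (n - 1) (T n)" using E_step[of "n - 1"] 0 i E_last by simp
  have "T n (T (n - 1) (T n (T (n - 1) (T n v)))) = Z (T (n - 1) (T n (T (n - 1) v)))" for v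
    using braid_B[OF B, of "T n v"] g by simp
  then show ?case using g by (simp add: E conj_def fun_eq_iff)
next
  case (Suc m)
  then have "conj n (E (i + 1)) = E (i + 1)" by simp
  then show ?case using E_step[of i] Suc conj_commute[of n i "E (i + 1)"] anticomm_n_B[of i] by simp
qed

end

section \<open>Type D: conjugation by the last generator\<close>

locale cover_action_D = cover_action +
  assumes D: "ty = TypeD"
begin

sublocale cover_action_BD by unfold_locales (simp add: D)

lemma n4: "4 \<le> n" using rank D by simp

lemma anticomm_n_D: "1 \<le> k \<Longrightarrow> k < n \<Longrightarrow> k \<noteq> n - 2 \<Longrightarrow> anticomm n k"
  using anticomm_D[OF D] .

lemma S_left: "1 \<le> i \<Longrightarrow> i + 1 < j \<Longrightarrow> j \<le> n \<Longrightarrow> S i j = conj i (S (i + 1) j)"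
  using conj_S_left[of i j] conj_eq_iff[of i] by simp

text \<open>The reflection of \<open>t_n\<close> sends e_(n-1) to -e_n, hence e_i - e_(n-1) to e_i +
  e_n. The start \<open>i = n - 2\<close> is the braid relation between \<open>t_(n-2)\<close> and
  \<open>t_n\<close>.\<close>

lemma conj_n_S_pred: "1 \<le> i \<Longrightarrow> i < n - 1 \<Longrightarrow> conj n (S i (n - 1)) = B i n"
proof (induction "n - 2 - i" arbitrary: i)
  case 0
  then have i: "i = n - 2" by simp
  then have "n - 1 = i + 1" using n4 by simp
  then show ?case
    using S_base[of i] B_last(1)[OF D] B_left[of i] 0 i conj_braid_T[OF braid_n_D[OF D]] by simp
next
  case (Suc m)
  then have "conj n (S (i + 1) (n - 1)) = B (i + 1) n" by simp
  then show ?case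
    using Suc S_left[of i "n - 1"] B_left[of i] conj_commute[of n i "S (i + 1) (n - 1)"]
      comm_z_S_less[of "i + 1" "n - 1"] anticomm_n_D[of i]
    by simp
qed

lemma conj_n_B_n: "1 \<le> i \<Longrightarrow> i < n - 1 \<Longrightarrow> conj n (B i n) = S i (n - 1)"
  using conj_n_S_pred conj_conj gen_n by metis

lemma conj_n_S_n:
  assumes "1 \<le> i" "i < n - 1" shows "conj n (S i n) = B i (n - 1)"
  using assms S_step[of i "n - 1"] B_right[of i "n - 1"] conj_n_S_pred[of i]
    conj_commute[of n "n - 1" "S i (n - 1)"] comm_z_S_less[of i "n - 1"] anticomm_n_D[of "n - 1"] n4
  by simp

lemma conj_n_B_pred: "1 \<le> i \<Longrightarrow> i < n - 1 \<Longrightarrow> conj n (B i (n - 1)) = S i n"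
  using conj_n_S_n conj_conj gen_n by metis

lemma conj_n_S_last: "conj n (S (n - 1) n) = S (n - 1) n"
  using S_base[of "n - 1"] n4 conj_anticomm_T[OF anticomm_n_D[of "n - 1"]] by simp

lemma conj_n_B_last: "conj n (B (n - 1) n) = (\<lambda>v. Z (B (n - 1) n v))"
  using B_last(1)[OF D] conj_self_T by simp

text \<open>For \<open>j = n - 2\<close> the element comes from \<open>S i n\<close> by conjugation
  with \<open>n\<close> and then \<open>n - 2\<close>; as \<open>S i n\<close> is fixed by
  \<open>n - 2\<close>, the braid relation makes the result fixed by \<open>n\<close>.\<close>

lemma conj_n_B_less: "1 \<le> i \<Longrightarrow> i < j \<Longrightarrow> j < n - 1 \<Longrightarrow> conj n (B i j) = B i j"
proof (induction "n - 2 - j" arbitrary: j)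
  case 0
  then have j: "j = n - 2" by simp
  then have "j + 1 = n - 1" using n4 by simp
  then have "B i j = conj j (conj n (S i n))"
    using B_right[of i j] conj_n_S_n[of i] 0 j by simp
  then show ?case
    using conj_fixed_braid[OF braid_sym[OF braid_n_D[OF D]], of "S i n"] conj_S_between[of i j n] 0 j by simp
next
  case (Suc m)
  then have "conj n (B i (j + 1)) = B i (j + 1)" by simp
  then show ?case
    using Suc B_right[of i j] conj_commute[of n j "B i (j + 1)"] comm_z_B_less[of i "j + 1"] anticomm_n_D[of j]
    by simp
qed

end

section \<open>Action of the generators on roots and indices\<close>

definition sign_change :: "weyl_type \<Rightarrow> nat \<Rightarrow> cover_gen \<Rightarrow> nat \<Rightarrow> bool" where
  "sign_change ty n c j \<longleftrightarrow>
     (case c of Zc \<Rightarrow> False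
      | Tc k \<Rightarrow> \<not> k < n \<and> (ty = TypeB \<and> j = n \<or> ty = TypeD \<and> (j = n - 1 \<or> j = n)))"

definition index_perm :: "weyl_type \<Rightarrow> nat \<Rightarrow> cover_gen \<Rightarrow> nat \<Rightarrow> nat" where
  "index_perm ty n c = (case c of Zc \<Rightarrow> id | Tc k \<Rightarrow> refl_perm ty n k)"

definition gen_sign :: "weyl_type \<Rightarrow> nat \<Rightarrow> cover_gen \<Rightarrow> nat \<Rightarrow> complex" where
  "gen_sign ty n c j = (if sign_change ty n c j then -1 else 1)"

text \<open>A generator \<open>t_k\<close> passes \<open>x_j\<close> with either a factor
  \<open>-1\<close> or a factor \<open>z\<close>, never both, so the exponent is 0 where the sign
  changes. Passing \<open>y_j\<close> costs the sign only.\<close>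

definition gen_z :: "weyl_type \<Rightarrow> nat \<Rightarrow> cover_gen \<Rightarrow> nat \<Rightarrow> nat" where
  "gen_z ty n c j = (if c = Zc \<or> sign_change ty n c j then 0 else 1)"

lemma refl_perm_range:
  assumes "admissible_rank ty n" "1 \<le> k" "j \<in> {1..n}"
  shows "refl_perm ty n k j \<in> {1..n}"
  using assms by (cases ty) (auto simp: refl_perm_def transpose_def admissible_rank_def)

lemma refl_perm_refl_perm [simp]: "refl_perm ty n k (refl_perm ty n k j) = j"
  by (simp add: refl_perm_def)

lemma refl_perm_eq_iff [simp]: "refl_perm ty n k i = refl_perm ty n k j \<longleftrightarrow> i = j"
  by (metis refl_perm_refl_perm)

lemma sign_change_refl_perm [simp]:
  "sign_change ty n (Tc k) (refl_perm ty n k j) = sign_change ty n (Tc k) j"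
  by (auto simp: sign_change_def refl_perm_def transpose_def)

lemma index_perm_eq_iff [simp]: "index_perm ty n c i = index_perm ty n c j \<longleftrightarrow> i = j"
  by (cases c) (simp_all add: index_perm_def)

context cover_action
begin

lemma T_S_less:
  assumes "1 \<le> k" "k < n" "i \<in> {1..n}" "j \<in> {1..n}" "i \<noteq> j"
  shows "T k (S i j v) = Z (S (refl_perm ty n k i) (refl_perm ty n k j) (T k v))"
  using T_conj[of k "S i j"] conj_S assms by simp

end

context cover_action_BD
begin

lemma T_B_less:
  assumes "1 \<le> k" "k < n" "i \<in> {1..n}" "j \<in> {1..n}" "i \<noteq> j"
  shows "T k (B i j v) = Z (B (refl_perm ty n k i) (refl_perm ty n k j) (T k v))"
  using T_conj[of k "B i j"] conj_B assms by simp

end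

context cover_action_B
begin

lemma T_n_less:
  assumes ij: "1 \<le> i" "i < j" "j \<le> n"
  shows "T n (S i j v) = Z ((if j = n then B i j else S i j) (T n v))"
    "T n (B i j v) = Z ((if j = n then S i j else B i j) (T n v))"
  using T_conj[of n "S i j"] T_conj[of n "B i j"] ij conj_n_S[of i j] conj_n_B[of i j]
    conj_n_S_n[of i] conj_n_B_n[of i] by auto

end

context cover_action_D
begin

lemma T_n_less:
  assumes ij: "1 \<le> i" "i < j" "j \<le> n"
  shows "T n (S i j v) = (if i = n - 1 then Z (S i j (T n v))
      else Z ((if n - 1 \<le> j then B i (refl_perm ty n n j) else S i j) (T n v)))"
    "T n (B i j v) = (if i = n - 1 then B i j (T n v)
      else Z ((if n - 1 \<le> j then S i (refl_perm ty n n j) else B i j) (T n v)))"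
proof -
  have p: "refl_perm ty n n = transpose (n - 1) n" by (simp add: refl_perm_def D)
  consider "j < n - 1" | "j = n - 1" | "j = n" "i < n - 1" | "i = n - 1" "j = n" using ij by linarith
  then have "T n (S i j v) = (if i = n - 1 then Z (S i j (T n v))
      else Z ((if n - 1 \<le> j then B i (refl_perm ty n n j) else S i j) (T n v))) \<and>
    T n (B i j v) = (if i = n - 1 then B i j (T n v)
      else Z ((if n - 1 \<le> j then S i (refl_perm ty n n j) else B i j) (T n v)))"
  proof cases
    case 1
    then show ?thesis
      using T_conj[of n "S i j"] T_conj[of n "B i j"] ij conj_n_S_less[of i j] conj_n_B_less[of i j] by simp
  next
    case 2
    then show ?thesis
      unfolding p using T_conj[of n "S i j"] T_conj[of n "B i j"] ij conj_n_S_pred[of i] conj_n_B_pred[of i]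
      by simp
  next
    case 3
    then show ?thesis
      unfolding p using T_conj[of n "S i j"] T_conj[of n "B i j"] ij conj_n_S_n[of i] conj_n_B_n[of i]
      by simp
  next
    case 4
    then show ?thesis
      using T_conj[of n "S i j"] T_conj[of n "B i j"] ij conj_n_S_last conj_n_B_last
      by simp
  qed
  then show "T n (S i j v) = (if i = n - 1 then Z (S i j (T n v))
      else Z ((if n - 1 \<le> j then B i (refl_perm ty n n j) else S i j) (T n v)))"
    "T n (B i j v) = (if i = n - 1 then B i j (T n v)
      else Z ((if n - 1 \<le> j then S i (refl_perm ty n n j) else B i j) (T n v)))"
    by blast+
qed

end

text \<open>\<open>S i j\<close> belongs to the root \<open>e\<^sub>i - e\<^sub>j\<close> and \<open>B i j\<close> to \<open>e\<^sub>i + e\<^sub>j\<close>; a generator that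
  changes the sign of exactly one of \<open>e\<^sub>i\<close>, \<open>e\<^sub>j\<close> interchanges the two kinds.\<close>

context cover_action
begin

lemma T_root_less:
  assumes k: "gen_index k" and ij: "1 \<le> i" "i < j" "j \<le> n"
  shows "T k (S i j v) = (Z ^^ gen_z ty n (Tc k) i)
      ((if sign_change ty n (Tc k) i = sign_change ty n (Tc k) j then S else B)
        (refl_perm ty n k i) (refl_perm ty n k j) (T k v))" (is ?S)
    and "ty \<noteq> TypeA \<Longrightarrow> T k (B i j v) = (Z ^^ gen_z ty n (Tc k) i)
      ((if sign_change ty n (Tc k) i = sign_change ty n (Tc k) j then B else S)
        (refl_perm ty n k i) (refl_perm ty n k j) (T k v))" (is "_ \<Longrightarrow> ?B")
proof -
  have *: "?S \<and> (ty \<noteq> TypeA \<longrightarrow> ?B)"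
  proof (cases "k < n")
    case True
    then have sc: "sign_change ty n (Tc k) m = False" "gen_z ty n (Tc k) m = 1" for m
      by (simp_all add: sign_change_def gen_z_def)
    have k1: "1 \<le> k" using k by (simp add: gen_index_def)
    have ?S unfolding sc using T_S_less[OF k1 True, of i j] ij by simp
    moreover have ?B if "ty \<noteq> TypeA"
    proof -
      interpret BD: cover_action_BD ty n f by unfold_locales (rule that)
      show ?thesis unfolding sc using BD.T_B_less[OF k1 True, of i j] ij by simp
    qed
    ultimately show ?thesis by blast
  next
    case False
    then have kn: "k = n" and A: "ty \<noteq> TypeA" using k by (auto simp: gen_index_def)
    show ?thesis
    proof (cases "ty = TypeB")
      case True
      interpret B: cover_action_B ty n f by unfold_locales (rule True)
      have sc: "sign_change ty n (Tc n) m \<longleftrightarrow> m = n" "gen_z ty n (Tc n) m = (if m = n then 0 else 1)"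
        and p: "refl_perm ty n n = id" for m
        by (simp_all add: sign_change_def gen_z_def refl_perm_def True)
      show ?thesis unfolding sc p kn using B.T_n_less[OF ij, of v] ij by (auto split: if_splits)
    next
      case False
      then have ty: "ty = TypeD" using A by (cases ty) auto
      interpret D: cover_action_D ty n f by unfold_locales (rule ty)
      have sc: "sign_change ty n (Tc n) m \<longleftrightarrow> m = n - 1 \<or> m = n"
          "gen_z ty n (Tc n) m = (if m = n - 1 \<or> m = n then 0 else 1)"
        and p: "refl_perm ty n n = transpose (n - 1) n" for m
        by (simp_all add: sign_change_def gen_z_def refl_perm_def ty)
      consider "j < n - 1" | "i < n - 1" "j = n - 1" | "i < n - 1" "j = n" | "i = n - 1" "j = n"
        using ij by linarith
      then show ?thesis
      proof cases
        case 4
        \<comment> \<open>Both indices change sign and are interchanged, so the claim contains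
          \<open>S n (n - 1)\<close>; its extra \<open>z\<close> makes up for the exponent 0 given
          by \<open>gen_z\<close>.\<close>
        have "S n (n - 1) w = Z (S (n - 1) n w)" for w
          using S_sym[of "n - 1" n] 4 ij by simp
        then show ?thesis
          unfolding sc kn p using D.T_n_less[OF ij, of v] ij 4 B_sym[of n "n - 1"] by simp
      qed (use D.T_n_less[OF ij, of v] ij in \<open>auto simp add: sc kn p\<close>)
    qed
  qed
  then show ?S by blast
  show ?B if "ty \<noteq> TypeA" using * that by blast
qed

text \<open>The exponent depends on \<open>i\<close> alone, and this is consistent with
  interchanging \<open>i\<close> and \<open>j\<close>: if exactly one of them changes sign, the two
  exponents differ by one, which balances the antisymmetry \<open>{j,i} = z{i,j}\<close> against the
  symmetry of the barred elements.\<close>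

lemma T_root:
  assumes k: "gen_index k" and ij: "i \<in> {1..n}" "j \<in> {1..n}" "i \<noteq> j"
  shows "T k (S i j v) = (Z ^^ gen_z ty n (Tc k) i)
      ((if sign_change ty n (Tc k) i = sign_change ty n (Tc k) j then S else B)
        (refl_perm ty n k i) (refl_perm ty n k j) (T k v))"
    and "ty \<noteq> TypeA \<Longrightarrow> T k (B i j v) = (Z ^^ gen_z ty n (Tc k) i)
      ((if sign_change ty n (Tc k) i = sign_change ty n (Tc k) j then B else S)
        (refl_perm ty n k i) (refl_perm ty n k j) (T k v))"
proof -
  let ?p = "refl_perm ty n k"
  have z: "gen_z ty n (Tc k) m = (if sign_change ty n (Tc k) m then 0 else 1)" for m
    by (simp add: gen_z_def)
  have s: "S i j w = Z (S j i w)" "S (?p j) (?p i) w = Z (S (?p i) (?p j) w)" for w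
    using S_sym'[of j i] S_sym'[of "?p i" "?p j"] ij by simp_all
  show "T k (S i j v) = (Z ^^ gen_z ty n (Tc k) i)
      ((if sign_change ty n (Tc k) i = sign_change ty n (Tc k) j then S else B) (?p i) (?p j) (T k v))"
  proof (cases "i < j")
    case True
    then show ?thesis using T_root_less(1)[OF k, of i j] ij by simp
  next
    case False
    then show ?thesis
      unfolding s(1) using T_root_less(1)[OF k, of j i v] ij k B_sym[of "?p j" "?p i"]
      by (auto simp: z s(2))
  qed
  show "T k (B i j v) = (Z ^^ gen_z ty n (Tc k) i)
      ((if sign_change ty n (Tc k) i = sign_change ty n (Tc k) j then B else S) (?p i) (?p j) (T k v))"
    if "ty \<noteq> TypeA"
  proof (cases "i < j")
    case True
    then show ?thesis using T_root_less(2)[OF k, of i j] ij that by simp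
  next
    case False
    then show ?thesis
      unfolding B_sym[of i j] using T_root_less(2)[OF k, of j i v] ij k B_sym[of "?p j" "?p i"] that
      by (auto simp: z s(2))
  qed
qed

lemma T_E:
  assumes ty: "ty = TypeB" and k: "gen_index k" and i: "i \<in> {1..n}"
  shows "T k (E i v) = (Z ^^ gen_z ty n (Tc k) i) (E (refl_perm ty n k i) (T k v))"
proof -
  interpret B: cover_action_B ty n f by unfold_locales (rule ty)
  show ?thesis
  proof (cases "k < n")
    case True
    then show ?thesis
      using T_conj[of k "E i"] B.conj_E[of k i] k i by (simp add: gen_index_def gen_z_def sign_change_def)
  next
    case False
    then have kn: "k = n" using k by (auto simp: gen_index_def)
    have sc: "gen_z ty n (Tc n) m = (if m = n then 0 else 1)"
      and p: "refl_perm ty n n = id" for m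
      by (simp_all add: sign_change_def gen_z_def refl_perm_def ty)
    show ?thesis
      unfolding sc p kn using T_conj[of n "E i"] B.conj_n_E[of i] B.conj_n_E_n i by auto
  qed
qed

end

section \<open>Linear maps between spaces of finitely supported functions\<close>

definition smul :: "complex \<Rightarrow> ('a \<Rightarrow>\<^sub>0 complex) \<Rightarrow> ('a \<Rightarrow>\<^sub>0 complex)" where
  "smul c v = Poly_Mapping.map ((*) c) v"

lemma lookup_smul [simp]: "Poly_Mapping.lookup (smul c v) k = c * Poly_Mapping.lookup v k"
  by (simp add: smul_def Poly_Mapping.map.rep_eq when_def)

lemma smul_simps [simp]:
  "smul 0 v = 0" "smul 1 v = v" "smul c 0 = 0" "smul a (smul b v) = smul (a * b) v"
  "smul c (Poly_Mapping.single k b) = Poly_Mapping.single k (c * b)"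
  by (rule poly_mapping_eqI; simp add: lookup_single when_def)+

lemma smul_distribs:
  "smul c (v + w) = smul c v + smul c w" "smul (b + c) v = smul b v + smul c v"
  "smul c (v - w) = smul c v - smul c w" "smul c (- v) = - smul c v" "smul (- c) v = - smul c v"
  by (rule poly_mapping_eqI; simp add: lookup_add lookup_minus algebra_simps)+

lemma smul_sum: "smul c (sum g A) = (\<Sum>a\<in>A. smul c (g a))"
  by (induction A rule: infinite_finite_induct) (simp_all add: smul_distribs)

definition lin :: "(('a \<Rightarrow>\<^sub>0 complex) \<Rightarrow> ('b \<Rightarrow>\<^sub>0 complex)) \<Rightarrow> bool" where
  "lin F \<longleftrightarrow> (\<forall>v w. F (v + w) = F v + F w) \<and> (\<forall>c v. F (smul c v) = smul c (F v))"

lemma lin_add: "lin F \<Longrightarrow> F (v + w) = F v + F w"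
  and lin_smul: "lin F \<Longrightarrow> F (smul c v) = smul c (F v)"
  by (simp_all add: lin_def)

lemma lin_zero: "lin F \<Longrightarrow> F 0 = 0"
  using lin_smul[of F 0 0] by simp

lemma lin_minus: "lin F \<Longrightarrow> F (- v) = - F v"
  using lin_smul[of F "-1" v] by (simp add: smul_distribs)

lemma lin_diff: "lin F \<Longrightarrow> F (v - w) = F v - F w"
  using lin_add[of F v "- w"] lin_minus[of F w] by simp

lemma lin_sum: "lin F \<Longrightarrow> F (sum g A) = (\<Sum>a\<in>A. F (g a))"
  by (induction A rule: infinite_finite_induct) (simp_all add: lin_zero lin_add)

lemmas linD = lin_add lin_smul lin_zero lin_minus lin_diff lin_sum

lemma lin_comp: "lin F \<Longrightarrow> lin G \<Longrightarrow> lin (\<lambda>v. F (G v))"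
  by (simp add: lin_def)

lemma lin_smul_map: "lin F \<Longrightarrow> lin (\<lambda>v. smul c (F v))"
  by (simp add: lin_def smul_distribs mult.commute)

lemma lin_zero_map: "lin (\<lambda>v. 0)"
  by (simp add: lin_def)

lemma lin_sum_map: "(\<And>a. a \<in> A \<Longrightarrow> lin (F a)) \<Longrightarrow> lin (\<lambda>v. \<Sum>a\<in>A. F a v)"
  by (simp add: lin_def sum.distrib smul_sum)

lemma lin_funpow: fixes F :: "('a \<Rightarrow>\<^sub>0 complex) \<Rightarrow> ('a \<Rightarrow>\<^sub>0 complex)" shows "lin F \<Longrightarrow> lin (F ^^ m)"
  by (induction m) (simp_all add: lin_def)

lemma lin_foldr: "(\<And>c. lin (F c)) \<Longrightarrow> lin (foldr F l)"
  by (induction l) (simp_all add: lin_def)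

lemma vec_expand: "v = (\<Sum>k\<in>Poly_Mapping.keys v. Poly_Mapping.single k (Poly_Mapping.lookup v k))"
  by (rule poly_mapping_eqI) (simp add: lookup_sum lookup_single when_def in_keys_iff sum.delta)

lemma vec_induct [case_names smul add basis]:
  assumes s: "\<And>c v. P v \<Longrightarrow> P (smul c v)"
    and a: "\<And>v w. P v \<Longrightarrow> P w \<Longrightarrow> P (v + w)"
    and b: "\<And>k. P (Poly_Mapping.single k 1)"
  shows "P v"
proof -
  have 0: "P 0" using s[of "Poly_Mapping.single k 1" 0 for k] b by simp
  have "P (Poly_Mapping.single k c)" for k c using s[OF b[of k], of c] by simp
  then have "P (\<Sum>k\<in>A. Poly_Mapping.single k (h k))" for A h
    by (induction A rule: infinite_finite_induct) (auto intro: 0 a)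
  then show ?thesis by (subst vec_expand)
qed

lemma lin_eqI:
  assumes "lin F" "lin G" "\<And>k. F (Poly_Mapping.single k 1) = G (Poly_Mapping.single k 1)"
  shows "F v = G v"
  by (induction v rule: vec_induct) (use assms in \<open>simp_all add: lin_def\<close>)

definition lext :: "('a \<Rightarrow> 'b \<Rightarrow>\<^sub>0 complex) \<Rightarrow> ('a \<Rightarrow>\<^sub>0 complex) \<Rightarrow> ('b \<Rightarrow>\<^sub>0 complex)" where
  "lext f v = (\<Sum>a\<in>Poly_Mapping.keys v. smul (Poly_Mapping.lookup v a) (f a))"

lemma lext_superset:
  assumes "finite A" "Poly_Mapping.keys v \<subseteq> A"
  shows "lext f v = (\<Sum>a\<in>A. smul (Poly_Mapping.lookup v a) (f a))"
  unfolding lext_def by (rule sum.mono_neutral_left) (use assms in \<open>auto simp: in_keys_iff\<close>)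

lemma lin_lext: "lin (lext f)"
  unfolding lin_def
proof safe
  fix v w :: "'a \<Rightarrow>\<^sub>0 complex"
  let ?A = "Poly_Mapping.keys v \<union> Poly_Mapping.keys w"
  have "Poly_Mapping.keys (v + w) \<subseteq> ?A" by (rule keys_add)
  then show "lext f (v + w) = lext f v + lext f w"
    using lext_superset[of ?A v f] lext_superset[of ?A w f] lext_superset[of ?A "v + w" f]
    by (simp add: lookup_add smul_distribs sum.distrib)
next
  fix c and v :: "'a \<Rightarrow>\<^sub>0 complex"
  have "Poly_Mapping.keys (smul c v) \<subseteq> Poly_Mapping.keys v" by (auto simp: in_keys_iff)
  then show "lext f (smul c v) = smul c (lext f v)"
    using lext_superset[of "Poly_Mapping.keys v" "smul c v" f] by (simp add: lext_def smul_sum)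
qed

lemma lext_single [simp]: "lext f (Poly_Mapping.single a c) = smul c (f a)"
  by (cases "c = 0") (simp_all add: lext_def)

section \<open>The representation space\<close>

type_synonym vec = "nat list \<times> nat multiset \<times> cover_gen list set \<Rightarrow>\<^sub>0 complex"

type_synonym nvec = "nat multiset \<times> nat multiset \<times> cover_gen list set \<Rightarrow>\<^sub>0 complex"

definition bvec :: "nat list \<Rightarrow> nat multiset \<Rightarrow> cover_gen list set \<Rightarrow> vec" where
  "bvec a M g = Poly_Mapping.single (a, M, g) 1"

definition X :: "nat \<Rightarrow> vec \<Rightarrow> vec" where
  "X j = lext (\<lambda>(a, M, g). bvec (j # a) M g)"

text \<open>Inserts a letter without moving it past the x. It is a device for building basis vectors
  in inductions; the true action of \<open>y_j\<close> is \<open>Y\<close>.\<close>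

definition Y0 :: "nat \<Rightarrow> vec \<Rightarrow> vec" where
  "Y0 j = lext (\<lambda>(a, M, g). bvec a (add_mset j M) g)"

lemma lin_X: "lin (X j)" and lin_Y0: "lin (Y0 j)"
  by (simp_all add: X_def Y0_def lin_lext)

lemma X_bvec [simp]: "X j (bvec a M g) = bvec (j # a) M g"
  and Y0_bvec [simp]: "Y0 j (bvec a M g) = bvec a (add_mset j M) g"
  by (simp_all add: X_def Y0_def bvec_def)

lemmas X_linear [simp] = linD[OF lin_X] and Y0_linear [simp] = linD[OF lin_Y0]

lemma lin_eq_bvecI:
  assumes "lin F" "lin G" "\<And>a M g. F (bvec a M g) = G (bvec a M g)"
  shows "F v = G v"
  by (rule lin_eqI[OF assms(1,2)]) (use assms(3) in \<open>force simp: bvec_def\<close>)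

lemma vec_X_induct [case_names smul add bvec X]:
  assumes "\<And>c v. P v \<Longrightarrow> P (smul c v)" "\<And>v w. P v \<Longrightarrow> P w \<Longrightarrow> P (v + w)"
    and b: "\<And>M g. P (bvec [] M g)" and X: "\<And>j v. P v \<Longrightarrow> P (X j v)"
  shows "P v"
proof (induction v rule: vec_induct)
  case (basis k)
  have "P (bvec a M g)" for a M g
    by (induction a) (use b X in \<open>auto simp flip: X_bvec\<close>)
  then show ?case by (cases k) (simp add: bvec_def)
qed (use assms in auto)

lemma vec_XY_induct [case_names smul add bvec Y0 X]:
  assumes "\<And>c v. P v \<Longrightarrow> P (smul c v)" "\<And>v w. P v \<Longrightarrow> P w \<Longrightarrow> P (v + w)"
    and b: "\<And>g. P (bvec [] {#} g)" and Y: "\<And>j v. P v \<Longrightarrow> P (Y0 j v)" and "\<And>j v. P v \<Longrightarrow> P (X j v)"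
  shows "P v"
proof (induction v rule: vec_X_induct)
  case (bvec M g)
  show ?case by (induction M) (use b Y in \<open>auto simp flip: Y0_bvec\<close>)
qed (use assms in auto)

text \<open>Left multiplication by a generator. Being the identity off the group, it satisfies the
  relations of the cover on every label, so the representation space needs no restriction.\<close>

definition cover_act :: "weyl_type \<Rightarrow> nat \<Rightarrow> cover_gen \<Rightarrow> cover_gen list set \<Rightarrow> cover_gen list set" where
  "cover_act ty n c g =
     (if c \<in> cover_gens ty n \<and> g \<in> carrier (weyl_cover ty n)
      then word_cong (cover_gens ty n) (cover_rels ty n) `` {[c]} \<otimes>\<^bsub>weyl_cover ty n\<^esub> g else g)"

lemma carrier_weyl_cover:
  "carrier (weyl_cover ty n) = lists (cover_gens ty n) // word_cong (cover_gens ty n) (cover_rels ty n)"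
  by (simp add: weyl_cover_def presented_monoid_def)

lemma word_class_carrier:
  "l \<in> lists (cover_gens ty n) \<Longrightarrow>
     word_cong (cover_gens ty n) (cover_rels ty n) `` {l} \<in> carrier (weyl_cover ty n)"
  by (auto simp: carrier_weyl_cover intro: quotientI)

lemma cover_act_word:
  assumes adm: "admissible_rank ty n" and l: "l \<in> lists (cover_gens ty n)" "b \<in> lists (cover_gens ty n)"
  shows "foldr (cover_act ty n) l (word_cong (cover_gens ty n) (cover_rels ty n) `` {b})
     = word_cong (cover_gens ty n) (cover_rels ty n) `` {l @ b}"
  using l(1)
proof induction
  case (Cons c l)
  then have "l @ b \<in> lists (cover_gens ty n)" using l(2) by auto
  then show ?case
    using Cons presented_monoid_mult_class[OF cover_rels_lists[OF adm], of "[c]" "l @ b"]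
      word_class_carrier[of "l @ b" ty n]
    by (simp add: cover_act_def weyl_cover_def)
qed simp

lemma cover_act_outside: "g \<notin> carrier (weyl_cover ty n) \<Longrightarrow> foldr (cover_act ty n) l g = g"
  by (induction l) (simp_all add: cover_act_def)

lemma cover_act_rel:
  assumes adm: "admissible_rank ty n" and lr: "(l, r) \<in> cover_rels ty n"
  shows "foldr (cover_act ty n) l g = foldr (cover_act ty n) r g"
proof (cases "g \<in> carrier (weyl_cover ty n)")
  case True
  let ?A = "cover_gens ty n" and ?R = "cover_rels ty n"
  from True obtain b where b: "b \<in> lists ?A" "g = word_cong ?A ?R `` {b}"
    unfolding carrier_weyl_cover by (rule quotientE)
  have lr': "l \<in> lists ?A" "r \<in> lists ?A" using lr cover_rels_lists[OF adm] by auto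
  have "(l @ b, r @ b) \<in> word_cong ?A ?R" using word_cong.rel[OF lr, of "[]" ?A b] b by simp
  then show ?thesis
    using equiv_class_eq[OF equiv_word_cong[OF cover_rels_lists[OF adm]]] cover_act_word[OF adm] b lr'
    by simp
qed (simp add: cover_act_outside)

lemma cover_act_Z:
  assumes "admissible_rank ty n"
  shows "cover_act ty n c (cover_act ty n Zc g) = cover_act ty n Zc (cover_act ty n c g)"
    "cover_act ty n Zc (cover_act ty n Zc g) = g"
proof -
  show "cover_act ty n Zc (cover_act ty n Zc g) = g"
    using cover_act_rel[OF assms, of "[Zc, Zc]" "[]" g] by (simp add: cover_rels_def)
  show "cover_act ty n c (cover_act ty n Zc g) = cover_act ty n Zc (cover_act ty n c g)"
  proof (cases "c \<in> cover_gens ty n")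
    case True
    then show ?thesis
      using cover_act_rel[OF assms, of "[Zc, c]" "[c, Zc]" g] by (simp add: cover_rels_def)
  qed (simp add: cover_act_def)
qed

section \<open>Action of words in the generators on single letters\<close>

fun word_perm :: "weyl_type \<Rightarrow> nat \<Rightarrow> cover_gen list \<Rightarrow> nat \<Rightarrow> nat" where
  "word_perm ty n [] j = j"
| "word_perm ty n (c # l) j = index_perm ty n c (word_perm ty n l j)"

fun word_sign :: "weyl_type \<Rightarrow> nat \<Rightarrow> cover_gen list \<Rightarrow> nat \<Rightarrow> complex" where
  "word_sign ty n [] j = 1"
| "word_sign ty n (c # l) j = word_sign ty n l j * gen_sign ty n c (word_perm ty n l j)"

fun word_z :: "weyl_type \<Rightarrow> nat \<Rightarrow> cover_gen list \<Rightarrow> nat \<Rightarrow> nat" where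
  "word_z ty n [] j = 0"
| "word_z ty n (c # l) j = word_z ty n l j + gen_z ty n c (word_perm ty n l j)"

text \<open>Only the parity of the exponent matters, \<open>z\<close> having order two. As
  \<open>z\<close> acts trivially on letters, a relation of the form \<open>l = z r\<close> also
  asks for equal data; its \<open>z\<close> is seen only on the group element.\<close>

definition same_action :: "weyl_type \<Rightarrow> nat \<Rightarrow> cover_gen list \<Rightarrow> cover_gen list \<Rightarrow> bool" where
  "same_action ty n l r \<longleftrightarrow> (\<forall>j. word_perm ty n l j = word_perm ty n r j \<and>
     word_sign ty n l j = word_sign ty n r j \<and> (even (word_z ty n l j) \<longleftrightarrow> even (word_z ty n r j)))"

lemma Zc_action [simp]: "gen_sign ty n Zc j = 1" "gen_z ty n Zc j = 0" "index_perm ty n Zc = id"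
  by (simp_all add: gen_sign_def gen_z_def sign_change_def index_perm_def)

lemma Tc_less_action [simp]:
  "i < n \<Longrightarrow> gen_sign ty n (Tc i) j = 1" "i < n \<Longrightarrow> gen_z ty n (Tc i) j = 1"
  "i < n \<Longrightarrow> index_perm ty n (Tc i) = transpose i (Suc i)"
  by (simp_all add: gen_sign_def gen_z_def sign_change_def index_perm_def refl_perm_def)

lemma Tc_n_action_B [simp]:
  "gen_sign TypeB n (Tc n) j = (if j = n then -1 else 1)"
  "gen_z TypeB n (Tc n) j = (if j = n then 0 else 1)"
  "index_perm TypeB n (Tc n) = id"
  by (simp_all add: gen_sign_def gen_z_def sign_change_def index_perm_def refl_perm_def)

lemma Tc_n_action_D [simp]:
  "gen_sign TypeD n (Tc n) j = (if j = n - 1 \<or> j = n then -1 else 1)"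
  "gen_z TypeD n (Tc n) j = (if j = n - 1 \<or> j = n then 0 else 1)"
  "index_perm TypeD n (Tc n) = transpose (n - 1) n"
  by (simp_all add: gen_sign_def gen_z_def sign_change_def index_perm_def refl_perm_def)

lemma same_action_involution: "same_action ty n [c, c] []"
  by (cases c) (simp_all add: same_action_def gen_sign_def gen_z_def index_perm_def)

lemma same_action_A: "(l, r) \<in> cover_rels_A n \<Longrightarrow> same_action ty n l r"
  unfolding cover_rels_A_def
proof (elim UnE CollectE exE conjE)
  fix i assume "(l, r) = ([Tc i, Tc i], [])"
  then show ?thesis using same_action_involution by simp
next
  fix i assume "(l, r) = ([Tc i, Tc (i + 1), Tc i], [Tc (i + 1), Tc i, Tc (i + 1)])" "i + 1 < n"
  then show ?thesis by (auto simp: same_action_def transpose_def)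
next
  fix i j assume "(l, r) = ([Tc i, Tc j], [Zc, Tc j, Tc i])" "i \<in> {1..<n}" "j \<in> {1..<n}" "1 < \<bar>int i - int j\<bar>"
  then show ?thesis by (auto simp: same_action_def transpose_def)
qed

lemma same_action_B:
  assumes "2 \<le> n" shows "(l, r) \<in> cover_rels_B n \<Longrightarrow> same_action TypeB n l r"
  unfolding cover_rels_B_def
proof (elim UnE CollectE exE conjE)
  assume "(l, r) \<in> {([Tc n, Tc n], [])}"
  then show ?thesis using same_action_involution by simp
next
  fix i assume "(l, r) = ([Tc i, Tc n], [Zc, Tc n, Tc i])" "1 \<le> i" "i \<le> n - 2"
  then show ?thesis using assms by (auto simp: same_action_def transpose_def)
next
  assume "(l, r) \<in> {([Tc (n-1), Tc n, Tc (n-1), Tc n], [Zc, Tc n, Tc (n-1), Tc n, Tc (n-1)])}"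
  then show ?thesis using assms by (auto simp: same_action_def transpose_def)
qed

lemma same_action_D:
  assumes "4 \<le> n" shows "(l, r) \<in> cover_rels_D n \<Longrightarrow> same_action TypeD n l r"
  unfolding cover_rels_D_def
proof (elim UnE CollectE exE conjE)
  assume "(l, r) \<in> {([Tc n, Tc n], [])}"
  then show ?thesis using same_action_involution by simp
next
  assume "(l, r) \<in> {([Tc (n-2), Tc n, Tc (n-2)], [Tc n, Tc (n-2), Tc n])}"
  moreover have "n = Suc (Suc (n - 2))" using assms by simp
  then obtain m where "n = Suc (Suc m)" by blast
  ultimately show ?thesis by (auto simp: same_action_def transpose_def)
next
  fix i assume i: "(l, r) = ([Tc i, Tc n], [Zc, Tc n, Tc i])" "i \<in> {1..n}" "i \<noteq> n - 2" "i \<noteq> n"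
  then have "i < n" by simp
  with i show ?thesis using assms by (auto simp: same_action_def transpose_def)
qed

lemma word_rel:
  assumes adm: "admissible_rank ty n" and lr: "(l, r) \<in> cover_rels ty n"
  shows "word_perm ty n l j = word_perm ty n r j \<and> word_sign ty n l j = word_sign ty n r j \<and>
     (even (word_z ty n l j) \<longleftrightarrow> even (word_z ty n r j))"
proof -
  have "same_action ty n [Zc, c] [c, Zc]" for c
    by (simp add: same_action_def)
  then have "same_action ty n l r"
    using lr same_action_A[of l r n] same_action_B[of n l r] same_action_D[of n l r] adm
      same_action_involution[of ty n Zc]
    by (cases ty) (auto simp: cover_rels_def admissible_rank_def)
  then show ?thesis by (simp add: same_action_def)
qed

section \<open>The double cover on the representation space\<close>

locale daha_rep =
  fixes ty :: weyl_type and n :: nat and p q :: complex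
  assumes adm: "admissible_rank ty n"
begin

text \<open>The result of carrying \<open>c\<close> to the right through all letters and multiplying
  it onto \<open>g\<close>; the central powers of \<open>z\<close> produced by the x-letters are
  collected at \<open>g\<close>.\<close>

definition cover_op :: "cover_gen \<Rightarrow> vec \<Rightarrow> vec" where
  "cover_op c = lext (\<lambda>(a, M, g).
     smul (prod_list (map (gen_sign ty n c) a) * prod_mset (image_mset (gen_sign ty n c) M))
       (bvec (map (index_perm ty n c) a) (image_mset (index_perm ty n c) M)
         ((cover_act ty n Zc ^^ sum_list (map (gen_z ty n c) a)) (cover_act ty n c g))))"

lemma lin_cover_op: "lin (cover_op c)" by (simp add: cover_op_def lin_lext)

lemmas cover_op_linear [simp] = linD[OF lin_cover_op] linD[OF lin_funpow[OF lin_cover_op]] linD[OF lin_foldr[of cover_op, OF lin_cover_op]]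

lemma cover_op_bvec: "cover_op c (bvec a M g) =
     smul (prod_list (map (gen_sign ty n c) a) * prod_mset (image_mset (gen_sign ty n c) M))
       (bvec (map (index_perm ty n c) a) (image_mset (index_perm ty n c) M)
         ((cover_act ty n Zc ^^ sum_list (map (gen_z ty n c) a)) (cover_act ty n c g)))"
  by (simp add: cover_op_def bvec_def)

lemma cover_op_Zc_bvec: "cover_op Zc (bvec a M g) = bvec a M (cover_act ty n Zc g)"
proof -
  have z: "sum_list (map (gen_z ty n Zc) a) = 0" by (induction a) simp_all
  have "prod_list (map (gen_sign ty n Zc) a) = 1" by (induction a) simp_all
  moreover have "prod_mset (image_mset (gen_sign ty n Zc) M) = 1"
    by (induction M) simp_all
  ultimately show ?thesis by (simp add: cover_op_bvec z)
qed

lemma Zpow_bvec: "(cover_op Zc ^^ m) (bvec a M g) = bvec a M ((cover_act ty n Zc ^^ m) g)"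
  by (induction m) (simp_all add: cover_op_Zc_bvec)

lemma cover_op_X: "cover_op c (X j v) =
    smul (gen_sign ty n c j) ((cover_op Zc ^^ gen_z ty n c j) (X (index_perm ty n c j) (cover_op c v)))"
proof (rule lin_eq_bvecI[where F = "\<lambda>v. cover_op c (X j v)"])
  show "cover_op c (X j (bvec a M g)) = smul (gen_sign ty n c j)
      ((cover_op Zc ^^ gen_z ty n c j) (X (index_perm ty n c j) (cover_op c (bvec a M g))))" for a M g
    by (simp add: cover_op_bvec Zpow_bvec funpow_add mult.assoc)
qed (simp_all add: lin_def mult.commute smul_distribs)

lemma cover_op_Y0: "cover_op c (Y0 j v) = smul (gen_sign ty n c j) (Y0 (index_perm ty n c j) (cover_op c v))"
  by (rule lin_eq_bvecI[where F = "\<lambda>v. cover_op c (Y0 j v)"])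
    (simp_all add: lin_def cover_op_bvec mult_ac smul_distribs)

lemma cover_op_ZX [simp]: "cover_op Zc (X j v) = X j (cover_op Zc v)" and cover_op_ZY0: "cover_op Zc (Y0 j v) = Y0 j (cover_op Zc v)"
  by (simp_all add: cover_op_X cover_op_Y0)

lemma Zpow_X [simp]: "(cover_op Zc ^^ m) (X j v) = X j ((cover_op Zc ^^ m) v)"
  by (induction m) simp_all

lemma cover_op_Z: "cover_op c (cover_op Zc v) = cover_op Zc (cover_op c v)"
proof (induction v rule: vec_XY_induct)
  case (bvec g)
  then show ?case by (simp add: cover_op_bvec cover_act_Z[OF adm])
next
  case (X j v)
  then show ?case by (simp add: cover_op_X funpow_swap1)
qed (simp_all add: cover_op_ZY0 cover_op_Y0)

lemma cover_op_ZZ [simp]: "cover_op Zc (cover_op Zc v) = v"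
  by (rule lin_eq_bvecI[where F = "\<lambda>v. cover_op Zc (cover_op Zc v)"])
    (simp_all add: cover_op_Zc_bvec cover_act_Z(2)[OF adm] lin_def)

lemma Zpow_eq: "(cover_op Zc ^^ m) v = (if even m then v else cover_op Zc v)"
  by (induction m) simp_all

lemma T_Z [simp]: "cover_op (Tc k) (cover_op Zc v) = cover_op Zc (cover_op (Tc k) v)"
  by (rule cover_op_Z)

lemma Zpow_Zpow: "(cover_op Zc ^^ a) ((cover_op Zc ^^ b) v) = (cover_op Zc ^^ (a + b)) v"
  by (simp add: funpow_add)

lemma cover_op_Zpow: "cover_op c ((cover_op Zc ^^ m) v) = (cover_op Zc ^^ m) (cover_op c v)"
  by (simp add: Zpow_eq cover_op_Z)

lemma word_op_X: "word_op cover_op l (X j v) =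
    smul (word_sign ty n l j) ((cover_op Zc ^^ word_z ty n l j) (X (word_perm ty n l j) (word_op cover_op l v)))"
  by (induction l) (simp_all add: cover_op_X cover_op_Zpow Zpow_Zpow add.commute)

lemma word_op_Y0: "word_op cover_op l (Y0 j v) =
    smul (word_sign ty n l j) (Y0 (word_perm ty n l j) (word_op cover_op l v))"
  by (induction l) (simp_all add: cover_op_Y0)

lemma word_op_bvec: "word_op cover_op l (bvec [] {#} g) = bvec [] {#} (foldr (cover_act ty n) l g)"
  by (induction l) (simp_all add: cover_op_bvec)

text \<open>Peeling off letters one at a time reduces the relation to its effect on a single letter,
  \<open>word_rel\<close>, and finally to left multiplication in the group.\<close>

lemma cover_op_rel: "(l, r) \<in> cover_rels ty n \<Longrightarrow> word_op cover_op l v = word_op cover_op r v"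
proof (induction v rule: vec_XY_induct)
  case (bvec g)
  then show ?case using cover_act_rel[OF adm] by (simp add: word_op_bvec)
next
  case (X j v)
  then show ?case using word_rel[OF adm, of l r j] by (simp add: word_op_X Zpow_eq)
next
  case (Y0 j v)
  then show ?case using word_rel[OF adm, of l r j] by (simp add: word_op_Y0)
qed simp_all

sublocale CA: cover_action ty n cover_op
  by unfold_locales (rule adm, rule cover_op_rel)

subsection \<open>The action of \<open>y\<close>\<close>

abbreviation Z where "Z \<equiv> cover_op Zc"

lemma Z_Zpow: "Z ((Z ^^ m) v) = (Z ^^ m) (Z v)"
  by (simp add: funpow_swap1)

text \<open>Zero in type A, as \<open>E'\<close> is outside type B, so that a single formula for
  \<open>U\<close> serves the three types.\<close>

definition B' :: "nat \<Rightarrow> nat \<Rightarrow> vec \<Rightarrow> vec" where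
  "B' i j v = (if ty = TypeA then 0 else CA.B i j v)"

definition E' :: "nat \<Rightarrow> vec \<Rightarrow> vec" where
  "E' i v = (if ty = TypeB then CA.E i v else 0)"

lemma B'_A: "ty = TypeA \<Longrightarrow> B' i j = (\<lambda>v. 0)"
  and B'_BD: "ty \<noteq> TypeA \<Longrightarrow> B' i j = CA.B i j"
  and E'_B: "ty = TypeB \<Longrightarrow> E' i = CA.E i"
  and E'_AD: "ty \<noteq> TypeB \<Longrightarrow> E' i = (\<lambda>v. 0)"
  unfolding B'_def E'_def fun_eq_iff by simp_all

lemma lin_S: "lin (CA.S i j)" and lin_B': "lin (B' i j)" and lin_E': "lin (E' i)"
proof -
  have "lin (CA.B i j)" "lin (CA.E i)"
    by (simp_all add: CA.B_def CA.E_def lin_foldr lin_cover_op)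
  then show "lin (B' i j)" "lin (E' i)"
    using lin_zero_map B'_A B'_BD E'_B E'_AD by metis+
  show "lin (CA.S i j)" by (simp add: CA.S_def lin_foldr lin_cover_op)
qed

lemmas SBE_linear [simp] = linD[OF lin_S] linD[OF lin_B'] linD[OF lin_E']

text \<open>The action of \<open>[y\<^sub>k, x\<^sub>i]\<close>. It is put to \<open>0\<close> for indices out of range; then all relations
  between \<open>X\<close> and \<open>Y\<close> hold without restriction on their indices.\<close>

definition U :: "nat \<Rightarrow> nat \<Rightarrow> vec \<Rightarrow> vec" where
  "U k i v =
     (if k \<notin> {1..n} \<or> i \<notin> {1..n} then 0
      else if k \<noteq> i then smul p (Z (CA.S i k v - B' i k v))
      else - smul p (Z (\<Sum>l\<in>{1..n} - {i}. CA.S i l v + B' i l v)) - smul q (Z (E' i v)))"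

lemma lin_U: "lin (U k i)"
  unfolding lin_def U_def
  by (auto simp: smul_distribs smul_sum sum.distrib sum_subtractf mult.commute)

lemmas U_linear [simp] = linD[OF lin_U]

lemma Z_U: "Z (U k i v) = U k i (Z v)"
proof -
  have "CA.E j (Z w) = Z (CA.E j w)" if "ty = TypeB" "j \<in> {1..n}" for j w
  proof -
    interpret B: cover_action_B ty n cover_op by unfold_locales (rule that)
    show ?thesis using B.comm_z_E[of j] that CA.comm_zD by simp
  qed
  then have E: "E' j (Z w) = Z (E' j w)" if "j \<in> {1..n}" for j w
    using that E'_B E'_AD cover_op_linear(3) by metis
  have "CA.B i j (Z w) = Z (CA.B i j w)" if "ty \<noteq> TypeA" "i \<in> {1..n}" "j \<in> {1..n}" "i \<noteq> j" for i j w
  proof -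
    interpret B: cover_action_BD ty n cover_op by unfold_locales (rule that)
    show ?thesis using B.comm_z_B[of i j] that CA.comm_zD by simp
  qed
  then have B: "B' i j (Z w) = Z (B' i j w)" if "i \<in> {1..n}" "j \<in> {1..n}" "i \<noteq> j" for i j w
    using that B'_A B'_BD cover_op_linear(3) by metis
  have S: "CA.S i j (Z w) = Z (CA.S i j w)" if "i \<in> {1..n}" "j \<in> {1..n}" "i \<noteq> j" for i j w
    using CA.comm_z_S that CA.comm_zD by simp
  show ?thesis
    by (auto simp: U_def S B E simp del: cover_op_ZZ intro!: sum.cong)
qed

text \<open>The relation prescribing \<open>[y\<^sub>k, x\<^sub>j]\<close> is used as a recursion that moves \<open>y\<^sub>k\<close> to the right.\<close>

primrec Y_word :: "nat \<Rightarrow> nat list \<Rightarrow> nat multiset \<Rightarrow> cover_gen list set \<Rightarrow> vec" where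
  "Y_word k [] M g = bvec [] (add_mset k M) g"
| "Y_word k (j # a) M g = X j (Y_word k a M g) + U k j (bvec a M g)"

definition Y :: "nat \<Rightarrow> vec \<Rightarrow> vec" where
  "Y k = lext (\<lambda>(a, M, g). Y_word k a M g)"

lemma lin_Y: "lin (Y k)" by (simp add: Y_def lin_lext)

lemmas Y_linear [simp] = linD[OF lin_Y]

lemma Y_bvec: "Y k (bvec a M g) = Y_word k a M g" by (simp add: Y_def bvec_def)

lemma Y_X: "Y k (X j v) = X j (Y k v) + U k j v"
  by (rule lin_eq_bvecI[where F = "\<lambda>v. Y k (X j v)"]) (simp_all add: lin_def Y_bvec smul_distribs)

lemma Z_Y: "Y k (Z v) = Z (Y k v)"
  by (induction v rule: vec_X_induct) (simp_all add: cover_op_Zc_bvec Y_bvec Y_X Z_U)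

lemma Zpow_Y: "Y k ((Z ^^ m) v) = (Z ^^ m) (Y k v)"
  by (simp add: Zpow_eq Z_Y)

lemma Zpow_U: "U k i ((Z ^^ m) v) = (Z ^^ m) (U k i v)"
  by (simp add: Zpow_eq Z_U)

text \<open>If a generator flips the sign of exactly one of two indices it interchanges
  \<open>S\<close> and \<open>B'\<close>; then \<open>S - B'\<close> changes sign and
  \<open>S + B'\<close> does not, in accordance with the product of signs off and on the diagonal.
  On the diagonal the sum is reindexed by the permutation of the generator.\<close>

lemma T_U:
  assumes m: "CA.gen_index m"
  shows "cover_op (Tc m) (U k i v) = smul (gen_sign ty n (Tc m) k * gen_sign ty n (Tc m) i)
    ((Z ^^ gen_z ty n (Tc m) i) (U (refl_perm ty n m k) (refl_perm ty n m i) (cover_op (Tc m) v)))"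
proof -
  let ?P = "refl_perm ty n m" and ?T = "cover_op (Tc m)" and ?s = "gen_sign ty n (Tc m)"
    and ?z = "gen_z ty n (Tc m)"
  have m1: "1 \<le> m" using m by (simp add: CA.gen_index_def)
  note range = refl_perm_range[OF adm m1]
  have P_iff: "?P j \<in> {1..n} \<longleftrightarrow> j \<in> {1..n}" for j
    by (metis range refl_perm_refl_perm)
  have A: "ty = TypeA \<Longrightarrow> \<not> sign_change ty n (Tc m) j" for j
    by (simp add: sign_change_def)
  have TS: "?T (CA.S i j w) = (Z ^^ ?z i) ((if ?s i = ?s j then CA.S else B') (?P i) (?P j) (?T w))"
    and TB: "?T (B' i j w) = (Z ^^ ?z i) ((if ?s i = ?s j then B' else CA.S) (?P i) (?P j) (?T w))"
    if ij: "i \<in> {1..n}" "j \<in> {1..n}" "i \<noteq> j" for i j w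
  proof -
    have s: "?s i = ?s j \<longleftrightarrow> sign_change ty n (Tc m) i = sign_change ty n (Tc m) j"
      by (auto simp: gen_sign_def)
    show "?T (CA.S i j w) = (Z ^^ ?z i) ((if ?s i = ?s j then CA.S else B') (?P i) (?P j) (?T w))"
    proof (cases "ty = TypeA")
      case True
      show ?thesis unfolding CA.T_root(1)[OF m ij] s using A[OF True] by simp
    next
      case False
      show ?thesis unfolding CA.T_root(1)[OF m ij] s B'_BD[OF False] by simp
    qed
    show "?T (B' i j w) = (Z ^^ ?z i) ((if ?s i = ?s j then B' else CA.S) (?P i) (?P j) (?T w))"
    proof (cases "ty = TypeA")
      case True
      note B = B'_A[OF True]
      show ?thesis unfolding s B using A[OF True] by (simp add: B)
    next
      case False
      then show ?thesis
        using CA.T_root(2)[OF m ij False, of w] B'_BD[OF False] unfolding s by simp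
    qed
  qed
  have D: "?T (CA.S i j w - B' i j w) = smul (?s j * ?s i) ((Z ^^ ?z i) (CA.S (?P i) (?P j) (?T w) - B' (?P i) (?P j) (?T w)))"
    and F: "?T (CA.S i j w + B' i j w) = (Z ^^ ?z i) (CA.S (?P i) (?P j) (?T w) + B' (?P i) (?P j) (?T w))"
    if ij: "i \<in> {1..n}" "j \<in> {1..n}" "i \<noteq> j" for i j w
  proof -
    let ?a = "(Z ^^ ?z i) (CA.S (?P i) (?P j) (?T w))" and ?b = "(Z ^^ ?z i) (B' (?P i) (?P j) (?T w))"
    have *: "?s i = ?s j \<and> ?T (CA.S i j w) = ?a \<and> ?T (B' i j w) = ?b \<or>
        ?s i = - ?s j \<and> ?T (CA.S i j w) = ?b \<and> ?T (B' i j w) = ?a"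
      using TS[OF ij, of w] TB[OF ij, of w] by (auto simp: gen_sign_def)
    have sq: "?s j * ?s j = 1" by (simp add: gen_sign_def)
    show "?T (CA.S i j w - B' i j w) = smul (?s j * ?s i) ((Z ^^ ?z i) (CA.S (?P i) (?P j) (?T w) - B' (?P i) (?P j) (?T w)))"
      using * by (elim disjE conjE) (simp_all add: sq smul_distribs)
    show "?T (CA.S i j w + B' i j w) = (Z ^^ ?z i) (CA.S (?P i) (?P j) (?T w) + B' (?P i) (?P j) (?T w))"
      using * by (elim disjE conjE) (simp_all add: add.commute)
  qed
  have E: "?T (E' i w) = (Z ^^ ?z i) (E' (?P i) (?T w))" if "i \<in> {1..n}" for i w
  proof (cases "ty = TypeB")
    case True
    show ?thesis unfolding E'_B[OF True] by (rule CA.T_E[OF True m that])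
  next
    case False
    show ?thesis unfolding E'_AD[OF False] by simp
  qed
  show ?thesis
  proof (cases "k \<in> {1..n} \<and> i \<in> {1..n}")
    case False
    then show ?thesis using P_iff by (auto simp: U_def)
  next
    case True
    show ?thesis
    proof (cases "k = i")
      case False
      let ?w = "CA.S (?P i) (?P k) (?T v) - B' (?P i) (?P k) (?T v)"
      have "?T (U k i v) = smul p (Z (?T (CA.S i k v - B' i k v)))"
        using True False by (simp add: U_def)
      also have "\<dots> = smul p (Z (smul (?s k * ?s i) ((Z ^^ ?z i) ?w)))"
        using D[of i k v] True False by metis
      also have "\<dots> = smul (?s k * ?s i) ((Z ^^ ?z i) (smul p (Z ?w)))"
        by (simp add: Z_Zpow smul_distribs mult_ac)
      also have "smul p (Z ?w) = U (?P k) (?P i) (?T v)"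
        using True False P_iff unfolding U_def by simp
      finally show ?thesis .
    next
      case ki: True
      have P1: "?P x \<in> {1..n} - {?P i}" if "x \<in> {1..n} - {i}" for x
        using that range[of x] by simp
      have P2: "?P x \<in> {1..n} - {i}" if "x \<in> {1..n} - {?P i}" for x
        using that range[of x] by (metis Diff_iff insert_iff empty_iff refl_perm_refl_perm)
      have bij: "bij_betw ?P ({1..n} - {i}) ({1..n} - {?P i})"
        by (rule bij_betw_byWitness[where f' = ?P]) (use P1 P2 in \<open>simp_all add: image_subsetI del: Diff_iff\<close>)
      let ?S = "\<Sum>l\<in>{1..n} - {?P i}. CA.S (?P i) l (?T v) + B' (?P i) l (?T v)"
      have "?T (\<Sum>l\<in>{1..n} - {i}. CA.S i l v + B' i l v)
        = (\<Sum>l\<in>{1..n} - {i}. (Z ^^ ?z i) (CA.S (?P i) (?P l) (?T v) + B' (?P i) (?P l) (?T v)))"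
        by (subst cover_op_linear(6), intro sum.cong refl F) (use True in auto)
      also have "\<dots> = (\<Sum>l\<in>{1..n} - {?P i}. (Z ^^ ?z i) (CA.S (?P i) l (?T v) + B' (?P i) l (?T v)))"
        using bij by (rule sum.reindex_bij_betw)
      finally have S: "?T (\<Sum>l\<in>{1..n} - {i}. CA.S i l v + B' i l v)
        = (Z ^^ ?z i) ?S"
        by (simp only: cover_op_linear(12))
      have s: "?s i * ?s i = 1" by (simp add: gen_sign_def)
      have "?T (U k i v) = - smul p (Z (?T (\<Sum>l\<in>{1..n} - {i}. CA.S i l v + B' i l v))) - smul q (Z (?T (E' i v)))"
        using True ki by (simp add: U_def del: cover_op_linear(6))
      also have "\<dots> = - smul p (Z ((Z ^^ ?z i) ?S)) - smul q (Z ((Z ^^ ?z i) (E' (?P i) (?T v))))"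
        unfolding S E[OF conjunct2[OF True]] by (rule HOL.refl)
      also have "\<dots> = (Z ^^ ?z i) (- smul p (Z ?S) - smul q (Z (E' (?P i) (?T v))))"
        by (simp only: Z_Zpow cover_op_linear(8,10,11))
      also have "- smul p (Z ?S) - smul q (Z (E' (?P i) (?T v))) = U (?P k) (?P i) (?T v)"
        using True ki P_iff[of i] unfolding U_def by simp
      finally show ?thesis unfolding ki s by simp
    qed
  qed
qed

lemma cover_op_U:
  assumes "c \<in> cover_gens ty n"
  shows "cover_op c (U k i v) = smul (gen_sign ty n c k * gen_sign ty n c i)
    ((Z ^^ gen_z ty n c i) (U (index_perm ty n c k) (index_perm ty n c i) (cover_op c v)))"
proof (cases c)
  case Zc
  then show ?thesis by (simp add: Z_U)
next
  case (Tc m)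
  then have "CA.gen_index m"
    using assms by (auto simp: cover_gens_def CA.gen_index_def split: if_splits)
  then show ?thesis using T_U Tc by (simp add: index_perm_def)
qed

lemma gen_sign_square [simp]: "gen_sign ty n c j * gen_sign ty n c j = 1"
  by (simp add: gen_sign_def)

text \<open>On an empty word \<open>Y k\<close> only adds a letter. In the recursion the summands
  \<open>X j (Y k v)\<close> and \<open>U k j v\<close> acquire the same sign and the same power of
  \<open>z\<close>, the second one by \<open>cover_op_U\<close>.\<close>

lemma cover_op_Y:
  assumes c: "c \<in> cover_gens ty n"
  shows "cover_op c (Y k v) = smul (gen_sign ty n c k) (Y (index_perm ty n c k) (cover_op c v))"
proof (induction v rule: vec_X_induct)
  case (bvec M g)
  show ?case by (simp add: Y_bvec cover_op_bvec mult_ac)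
next
  case (X j v)
  then show ?case
    by (simp add: Y_X cover_op_X cover_op_U[OF c] Zpow_Y Zpow_U smul_distribs mult_ac)
qed (simp_all add: smul_distribs mult.commute)

section \<open>Root elements moving past x and y\<close>

definition reflecting :: "(vec \<Rightarrow> vec) \<Rightarrow> (nat \<Rightarrow> nat) \<Rightarrow> (nat \<Rightarrow> bool) \<Rightarrow> bool" where
  "reflecting A s ng \<longleftrightarrow> lin A \<and> (\<forall>v. A (Z v) = Z (A v)) \<and>
     (\<forall>j v. A (X j v) = (if ng j then - X (s j) (A v) else Z (X (s j) (A v)))) \<and>
     (\<forall>j v. A (Y j v) = (if ng j then - Y (s j) (A v) else Y (s j) (A v)))"

lemma Tc_gens: "CA.gen_index k \<Longrightarrow> Tc k \<in> cover_gens ty n"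
  by (auto simp: cover_gens_def CA.gen_index_def)

lemma T_X:
  "cover_op (Tc k) (X j v) = (if sign_change ty n (Tc k) j then - X (refl_perm ty n k j) (cover_op (Tc k) v)
     else Z (X (refl_perm ty n k j) (cover_op (Tc k) v)))"
  unfolding cover_op_X[of "Tc k"] by (simp add: gen_sign_def gen_z_def index_perm_def smul_distribs)

lemma T_Y:
  assumes "CA.gen_index k"
  shows "cover_op (Tc k) (Y j v) = (if sign_change ty n (Tc k) j then - Y (refl_perm ty n k j) (cover_op (Tc k) v)
     else Y (refl_perm ty n k j) (cover_op (Tc k) v))"
  by (simp add: cover_op_Y[OF Tc_gens[OF assms]] gen_sign_def index_perm_def smul_distribs)

lemma reflecting_T:
  "CA.gen_index k \<Longrightarrow> reflecting (cover_op (Tc k)) (refl_perm ty n k) (sign_change ty n (Tc k))"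
  by (simp add: reflecting_def lin_cover_op T_X T_Y)

lemma reflecting_Z: "reflecting A s ng \<Longrightarrow> reflecting (\<lambda>v. Z (A v)) s ng"
  by (simp add: reflecting_def lin_comp[OF lin_cover_op] Z_Y)

text \<open>Passing \<open>x_j\<close> through three factors, each contributes either a sign or a
  \<open>z\<close>. An odd number of signs thus leaves a sign and no \<open>z\<close>, an even
  number leaves one \<open>z\<close>: conjugates obey the same rule as a generator. For y only the
  signs are counted.\<close>

lemma reflecting_conj:
  assumes A: "reflecting A s ng" and k: "CA.gen_index k"
    and s': "\<And>j. s' j = refl_perm ty n k (s (refl_perm ty n k j))"
    and ng': "\<And>j. ng' j \<longleftrightarrow> (ng (refl_perm ty n k j) \<noteq>
          (sign_change ty n (Tc k) j \<noteq> sign_change ty n (Tc k) (s (refl_perm ty n k j))))"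
  shows "reflecting (CA.conj k A) s' ng'"
proof -
  have lA: "lin A" and ZA: "\<And>v. A (Z v) = Z (A v)"
    and XA: "\<And>j v. A (X j v) = (if ng j then - X (s j) (A v) else Z (X (s j) (A v)))"
    and YA: "\<And>j v. A (Y j v) = (if ng j then - Y (s j) (A v) else Y (s j) (A v))"
    using A by (auto simp: reflecting_def)
  note lA' = linD[OF lA]
  have "lin (CA.conj k A)"
    by (simp add: lin_def CA.conj_def lA')
  moreover have "CA.conj k A (Z v) = Z (CA.conj k A v)" for v
    using CA.comm_z_conj[OF k, of A] ZA by (simp add: CA.comm_z_def)
  moreover have "CA.conj k A (X j v) = (if ng' j then - X (s' j) (CA.conj k A v) else Z (X (s' j) (CA.conj k A v)))"
    for j v
    by (auto simp: CA.conj_def T_X XA ZA lA' ng' s')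
  moreover have "CA.conj k A (Y j v) = (if ng' j then - Y (s' j) (CA.conj k A v) else Y (s' j) (CA.conj k A v))"
    for j v
    by (auto simp: CA.conj_def T_Y[OF k] YA ZA lA' ng' s' Z_Y)
  ultimately show ?thesis by (simp add: reflecting_def)
qed

lemma reflecting_cong:
  "reflecting A s ng \<Longrightarrow> (\<And>j. s j = s' j) \<Longrightarrow> (\<And>j. ng j = ng' j) \<Longrightarrow> reflecting A s' ng'"
  by (simp add: reflecting_def)

lemma not_sign_change_less [simp]: "k < n \<Longrightarrow> \<not> sign_change ty n (Tc k) j"
  by (simp add: sign_change_def)

lemma refl_perm_less: "k < n \<Longrightarrow> refl_perm ty n k = transpose k (k + 1)"
  by (simp add: refl_perm_def)

lemma reflecting_S_less:
  assumes "1 \<le> i" "i < j" "j \<le> n"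
  shows "reflecting (CA.S i j) (transpose i j) (\<lambda>_. False)"
proof -
  have "Suc i \<le> j" using assms by simp
  then show ?thesis using assms(3)
  proof (induction j rule: dec_induct)
    case base
    then show ?case
      using reflecting_cong[OF reflecting_T[of i], of "transpose i (Suc i)"] assms CA.S_base[of i]
      by (simp add: refl_perm_less)
  next
    case (step j)
    then have "reflecting (CA.S i j) (transpose i j) (\<lambda>_. False)" by simp
    then have "reflecting (CA.conj j (CA.S i j)) (transpose i (Suc j)) (\<lambda>_. False)"
      by (rule reflecting_conj) (use step assms in \<open>auto simp: refl_perm_less transpose_def\<close>)
    then show ?case using CA.S_step[of i j] step assms by simp
  qed
qed

lemma reflecting_S:
  assumes "i \<in> {1..n}" "j \<in> {1..n}" "i \<noteq> j"
  shows "reflecting (CA.S i j) (transpose i j) (\<lambda>_. False)"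
proof (cases "i < j")
  case True
  then show ?thesis using reflecting_S_less assms by simp
next
  case False
  then show ?thesis
    using reflecting_Z[OF reflecting_S_less[of j i]] CA.S_sym[of j i] assms
    by (simp add: transpose_commute)
qed

lemma reflecting_B_less:
  assumes A: "ty \<noteq> TypeA" and ij: "1 \<le> i" "i < j" "j \<le> n"
  shows "reflecting (CA.B i j) (transpose i j) (\<lambda>k. k = i \<or> k = j)"
proof -
  interpret BD: cover_action_BD ty n cover_op by unfold_locales (rule A)
  have last: "reflecting (CA.B (n - 1) n) (transpose (n - 1) n) (\<lambda>k. k = n - 1 \<or> k = n)"
  proof (cases "ty = TypeD")
    case True
    then show ?thesis
      using reflecting_cong[OF reflecting_T[OF BD.gen_n], of "transpose (n - 1) n"] CA.B_last(1)
      by (simp add: refl_perm_def sign_change_def)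
  next
    case False
    then have ty: "ty = TypeB" using BD.cases_BD by simp
    have n: "n - 1 < n" "CA.gen_index (n - 1)" "n - 1 \<noteq> n" "n - 1 + 1 = n" using BD.n2 by simp_all
    have sc: "sign_change ty n (Tc n) k \<longleftrightarrow> k = n" and P: "refl_perm ty n n = id" for k
      by (simp_all add: sign_change_def ty refl_perm_def)
    show ?thesis
      unfolding CA.B_last(2)[OF ty]
      by (rule reflecting_conj[OF reflecting_T[OF n(2)] BD.gen_n])
        (use n in \<open>auto simp: sc P refl_perm_less transpose_def simp del: One_nat_def\<close>)
  qed
  have step: "reflecting (CA.B i n) (transpose i n) (\<lambda>k. k = i \<or> k = n)" if "1 \<le> i" "i < n" for i
    using that
  proof (induction "n - 1 - i" arbitrary: i)
    case 0
    then have "i = n - 1" by simp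
    then show ?case using last by simp
  next
    case (Suc m)
    then have "reflecting (CA.B (i + 1) n) (transpose (i + 1) n) (\<lambda>k. k = i + 1 \<or> k = n)" by simp
    then have "reflecting (CA.conj i (CA.B (i + 1) n)) (transpose i n) (\<lambda>k. k = i \<or> k = n)"
      by (rule reflecting_conj) (use Suc in \<open>auto simp: refl_perm_less transpose_def\<close>)
    then show ?case using CA.B_left[of i] Suc by simp
  qed
  show ?thesis using ij
  proof (induction "n - j" arbitrary: j)
    case 0
    then show ?case using step by simp
  next
    case (Suc m)
    then have "reflecting (CA.B i (j + 1)) (transpose i (j + 1)) (\<lambda>k. k = i \<or> k = j + 1)" by simp
    then have "reflecting (CA.conj j (CA.B i (j + 1))) (transpose i j) (\<lambda>k. k = i \<or> k = j)"
      by (rule reflecting_conj) (use Suc in \<open>auto simp: refl_perm_less transpose_def\<close>)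
    then show ?case using CA.B_right[of i j] Suc by simp
  qed
qed

lemma reflecting_B':
  assumes "i \<in> {1..n}" "j \<in> {1..n}" "i \<noteq> j"
  shows "reflecting (B' i j) (transpose i j) (\<lambda>k. k = i \<or> k = j)"
proof (cases "ty = TypeA")
  case True
  show ?thesis unfolding B'_A[OF True] by (simp add: reflecting_def lin_def)
next
  case False
  then have "B' i j = CA.B i j" by (rule B'_BD)
  moreover have "reflecting (CA.B i j) (transpose i j) (\<lambda>k. k = i \<or> k = j)"
  proof (cases "i < j")
    case True
    then show ?thesis using reflecting_B_less[OF False] assms by simp
  next
    case F: False
    then have "reflecting (CA.B j i) (transpose j i) (\<lambda>k. k = j \<or> k = i)"
      using reflecting_B_less[OF False, of j i] assms by simp
    then show ?thesis
      unfolding CA.B_sym[of i j] by (rule reflecting_cong) (auto simp: transpose_commute)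
  qed
  ultimately show ?thesis by simp
qed

lemma reflecting_E':
  assumes "i \<in> {1..n}" shows "reflecting (E' i) id (\<lambda>k. k = i)"
proof (cases "ty = TypeB")
  case False
  show ?thesis unfolding E'_AD[OF False] by (simp add: reflecting_def lin_def)
next
  case True
  then interpret B: cover_action_B ty n cover_op by unfold_locales
  have sc: "sign_change ty n (Tc n) k \<longleftrightarrow> k = n" and P: "refl_perm ty n n = id" for k
    by (simp_all add: sign_change_def True refl_perm_def)
  have "reflecting (CA.E i) id (\<lambda>k. k = i)"
    using assms
  proof (induction "n - i" arbitrary: i)
    case 0
    then have i: "i = n" by simp
    show ?case
      unfolding i CA.E_last using reflecting_cong[OF reflecting_T[OF B.gen_n]] P sc by simp
  next
    case (Suc m)
    then have "reflecting (CA.E (i + 1)) id (\<lambda>k. k = i + 1)" by simp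
    then have "reflecting (CA.conj i (CA.E (i + 1))) id (\<lambda>k. k = i)"
      by (rule reflecting_conj) (use Suc in \<open>auto simp: refl_perm_less transpose_def\<close>)
    then show ?case using CA.E_step[of i] Suc by simp
  qed
  moreover have "E' i = CA.E i" by (rule E'_B[OF True])
  ultimately show ?thesis by simp
qed

end

section \<open>The relations of the algebra\<close>

text \<open>Meant for the diagonal commutators, which sum over the reflections involving one index:
  only the summand pairing this index with \<open>j\<close> moves \<open>X j\<close> or
  \<open>Y j\<close> to another letter.\<close>

lemma sum_diff_single:
  fixes f g :: "'a \<Rightarrow> 'b::ab_group_add"
  assumes "finite A" "\<And>l. l \<in> A \<Longrightarrow> l \<noteq> j \<Longrightarrow> f l = g l"
  shows "sum f A - sum g A = (if j \<in> A then f j - g j else 0)"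
proof -
  have "sum f A - sum g A = (\<Sum>l\<in>A. if l = j then f j - g j else 0)"
    unfolding sum_subtractf[symmetric] using assms(2) by (intro sum.cong) auto
  then show ?thesis using assms(1) by simp
qed

context daha_rep
begin

lemma reflecting_X: "reflecting A s ng \<Longrightarrow> A (X j v) = (if ng j then - X (s j) (A v) else Z (X (s j) (A v)))"
  and reflecting_Y: "reflecting A s ng \<Longrightarrow> A (Y j v) = (if ng j then - Y (s j) (A v) else Y (s j) (A v))"
  by (simp_all add: reflecting_def)

lemma SB_Y:
  assumes "i \<in> {1..n}" "j \<in> {1..n}" "i \<noteq> j"
  shows "a \<noteq> i \<Longrightarrow> a \<noteq> j \<Longrightarrow> CA.S i j (Y a v) = Y a (CA.S i j v)"
    "a \<noteq> i \<Longrightarrow> a \<noteq> j \<Longrightarrow> B' i j (Y a v) = Y a (B' i j v)"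
    "CA.S i j (Y i v) = Y j (CA.S i j v)" "CA.S i j (Y j v) = Y i (CA.S i j v)"
    "B' i j (Y i v) = - Y j (B' i j v)" "B' i j (Y j v) = - Y i (B' i j v)"
  using reflecting_Y[OF reflecting_S[OF assms]] reflecting_Y[OF reflecting_B'[OF assms]] by simp_all

lemma SB_X:
  assumes "i \<in> {1..n}" "j \<in> {1..n}" "i \<noteq> j"
  shows "a \<noteq> i \<Longrightarrow> a \<noteq> j \<Longrightarrow> CA.S i j (X a v) = Z (X a (CA.S i j v))"
    "a \<noteq> i \<Longrightarrow> a \<noteq> j \<Longrightarrow> B' i j (X a v) = Z (X a (B' i j v))"
    "CA.S i j (X i v) = Z (X j (CA.S i j v))" "CA.S i j (X j v) = Z (X i (CA.S i j v))"
    "B' i j (X i v) = - X j (B' i j v)" "B' i j (X j v) = - X i (B' i j v)"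
  using reflecting_X[OF reflecting_S[OF assms]] reflecting_X[OF reflecting_B'[OF assms]] by simp_all

lemma E'_XY:
  assumes "i \<in> {1..n}" "a \<noteq> i"
  shows "E' i (X a v) = Z (X a (E' i v))" "E' i (Y a v) = Y a (E' i v)"
  using reflecting_X[OF reflecting_E'[OF assms(1)]] reflecting_Y[OF reflecting_E'[OF assms(1)]] assms
  by simp_all

lemma B'_sym: "B' j i = B' i j"
  using CA.B_sym[of j i] by (simp add: B'_def fun_eq_iff)

lemma S_sym_app: "i \<noteq> j \<Longrightarrow> CA.S j i v = Z (CA.S i j v)"
  using CA.S_sym'[of i j] by simp

section \<open>The Jacobi identity and commutation of the y\<close>

lemma U_offdiag: "k \<in> {1..n} \<Longrightarrow> i \<in> {1..n} \<Longrightarrow> k \<noteq> i \<Longrightarrow> U k i v = smul p (Z (CA.S i k v - B' i k v))"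
  and U_diag: "k \<in> {1..n} \<Longrightarrow>
    U k k v = - smul p (Z (\<Sum>l\<in>{1..n} - {k}. CA.S k l v + B' k l v)) - smul q (Z (E' k v))"
  and U_outside: "k \<notin> {1..n} \<or> i \<notin> {1..n} \<Longrightarrow> U k i v = 0"
  unfolding U_def by simp_all

lemma U_Y: "a \<noteq> b \<Longrightarrow> a \<noteq> k \<Longrightarrow> k \<noteq> b \<Longrightarrow> U b k (Y a v) = Y a (U b k v)"
  by (cases "b \<in> {1..n} \<and> k \<in> {1..n}") (auto simp: U_offdiag U_outside SB_Y Z_Y)

lemma U_diag_Y:
  assumes k: "k \<in> {1..n}" and a: "a \<noteq> k"
  shows "Y a (U k k v) - U k k (Y a v) = (if a \<in> {1..n}
     then - smul p (Z (Y a (CA.S k a v + B' k a v) - (CA.S k a (Y a v) + B' k a (Y a v)))) else 0)"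
proof -
  let ?f = "\<lambda>l. Y a (CA.S k l v + B' k l v)" and ?g = "\<lambda>l. CA.S k l (Y a v) + B' k l (Y a v)"
  have "Y a (U k k v) - U k k (Y a v)
    = - smul p (Z (sum ?f ({1..n} - {k}) - sum ?g ({1..n} - {k})))"
    using E'_XY[OF k a] by (simp add: U_diag[OF k] smul_distribs Z_Y)
  also have "sum ?f ({1..n} - {k}) - sum ?g ({1..n} - {k}) = (if a \<in> {1..n} - {k} then ?f a - ?g a else 0)"
    by (rule sum_diff_single) (use a k in \<open>auto simp: SB_Y\<close>)
  finally show ?thesis using a by simp
qed

text \<open>For \<open>a\<close> in range both sides equal p z (y_k (S - B) - y_a (S + B)), where S
  and B stand for \<open>CA.S k a v\<close> and \<open>B' k a v\<close>: these exchange the two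
  y-letters, B with a sign.\<close>

lemma Jacobi_diag:
  assumes k: "k \<in> {1..n}" and a: "a \<noteq> k"
  shows "Y a (U k k v) - U k k (Y a v) = Y k (U a k v) - U a k (Y k v)"
proof (cases "a \<in> {1..n}")
  case True
  then show ?thesis
    using U_diag_Y[OF k a, of v] k a by (simp add: U_offdiag SB_Y Z_Y smul_distribs algebra_simps)
next
  case False
  then have "Y a (U k k v) - U k k (Y a v) = 0" using U_diag_Y[OF k a, of v] by (simp only: if_False)
  then show ?thesis using False by (simp add: U_outside)
qed

text \<open>For three distinct indices both sides vanish, since the reflections in e_k - e_b and e_k
  + e_b fix e_a and likewise with \<open>a\<close> and \<open>b\<close> interchanged. What remains
  are the cases of a diagonal commutator.\<close>

lemma Jacobi: "Y a (U b k v) - U b k (Y a v) = Y b (U a k v) - U a k (Y b v)"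
proof -
  consider "k \<notin> {1..n}" | "a = b" | "k \<in> {1..n}" "a \<noteq> k" "k = b" | "k \<in> {1..n}" "b \<noteq> k" "k = a"
    | "a \<noteq> b" "k \<noteq> a" "k \<noteq> b" by blast
  then show ?thesis
  proof cases
    case 3
    then show ?thesis using Jacobi_diag by simp
  next
    case 4
    then show ?thesis using Jacobi_diag[of k b v] by simp
  qed (auto simp: U_outside U_Y)
qed

lemma Y_commute: "Y a (Y b v) = Y b (Y a v)"
proof (induction v rule: vec_X_induct)
  case (bvec M g)
  then show ?case by (simp add: Y_bvec add_mset_commute)
next
  case (X j v)
  then show ?case using Jacobi[of a b j v] by (simp add: Y_X algebra_simps)
qed simp_all

section \<open>Compatibility of y with the relations between the x\<close>

lemma U_X: "i \<noteq> j \<Longrightarrow> i \<noteq> k \<Longrightarrow> k \<noteq> j \<Longrightarrow> U k j (X i v) = Z (X i (U k j v))"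
  by (cases "k \<in> {1..n} \<and> j \<in> {1..n}") (auto simp: U_offdiag U_outside SB_X)

lemma U_diag_X:
  assumes k: "k \<in> {1..n}" and j: "j \<noteq> k"
  shows "U k k (X j v) - Z (X j (U k k v)) = (if j \<in> {1..n}
     then - smul p (Z (CA.S k j (X j v) + B' k j (X j v) - Z (X j (CA.S k j v + B' k j v)))) else 0)"
proof -
  let ?f = "\<lambda>l. CA.S k l (X j v) + B' k l (X j v)" and ?g = "\<lambda>l. Z (X j (CA.S k l v + B' k l v))"
  have "U k k (X j v) - Z (X j (U k k v)) = - smul p (Z (sum ?f ({1..n} - {k}) - sum ?g ({1..n} - {k})))"
    using E'_XY[OF k j] by (simp add: U_diag[OF k] smul_distribs)
  also have "sum ?f ({1..n} - {k}) - sum ?g ({1..n} - {k}) = (if j \<in> {1..n} - {k} then ?f j - ?g j else 0)"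
    by (rule sum_diff_single) (use j k in \<open>auto simp: SB_X\<close>)
  finally show ?thesis using j by simp
qed

text \<open>The sum in \<open>U k k\<close> contributes only its summand for \<open>j\<close>; owing
  to \<open>{j,k} = z{k,j}\<close> it cancels against the two off-diagonal terms.\<close>

lemma X_relation_diag:
  assumes j: "j \<noteq> k"
  shows "X k (U k j v) + U k k (X j v) = Z (X j (U k k v)) + Z (U k j (X k v))"
proof (cases "k \<in> {1..n}")
  case k: True
  show ?thesis
  proof (cases "j \<in> {1..n}")
    case True
    have "CA.S j k w = Z (CA.S k j w)" for w using S_sym_app[of k j] j by simp
    moreover have "U k k (X j v) = Z (X j (U k k v)) - smul p (Z (CA.S k j (X j v) + B' k j (X j v) - Z (X j (CA.S k j v + B' k j v))))"
      using U_diag_X[OF k j, of v] True by (simp add: algebra_simps)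
    moreover have "U k j w = smul p (Z (CA.S j k w - B' k j w))" for w
      using U_offdiag[OF k True] j B'_sym[of j k] by simp
    ultimately show ?thesis
      using SB_X[OF k True] j by (simp add: smul_distribs)
  next
    case False
    then have "U k k (X j v) = Z (X j (U k k v))" using U_diag_X[OF k j, of v] by (simp only: if_False) simp
    then show ?thesis using False by (simp add: U_outside)
  qed
qed (simp add: U_outside)

text \<open>This is the vanishing of the commutator of \<open>y_k\<close> with x_i x_j - z x_j x_i,
  expanded by \<open>Y_X\<close>.\<close>

lemma X_relation:
  assumes "i \<noteq> j"
  shows "X i (U k j v) + U k i (X j v) = Z (X j (U k i v)) + Z (U k j (X i v))"
proof -
  consider "k = i" | "k = j" | "k \<noteq> i" "k \<noteq> j" by blast
  then show ?thesis
  proof cases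
    case 1
    then show ?thesis using X_relation_diag assms by simp
  next
    case 2
    \<comment> \<open>The case \<open>k = i\<close> for the exchanged pair, multiplied by
      \<open>z\<close>: the x-relations for \<open>(i, j)\<close> and \<open>(j, i)\<close> differ
      by the factor \<open>-z\<close>.\<close>
    have "Z (X j (U j i v) + U j j (X i v)) = Z (Z (X i (U j j v)) + Z (U j i (X j v)))"
      using X_relation_diag[of i j v] assms by simp
    then show ?thesis using 2 by (simp add: add.commute)
  next
    case 3
    then show ?thesis using assms by (simp add: U_X)
  qed
qed

lemma Y_X_relation:
  assumes "i \<noteq> j"
  shows "Y k (X i (X j v) - Z (X j (X i v))) = X i (X j (Y k v)) - Z (X j (X i (Y k v)))"
  using X_relation[OF assms, of k v] by (simp add: Y_X Z_Y Z_U algebra_simps)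

text \<open>The submodule generated by the relations between the \<open>x\<^sub>i\<close>, which do not hold on words.\<close>

inductive_set N :: "vec set" where
  rel: "i \<noteq> j \<Longrightarrow> X i (X j v) - Z (X j (X i v)) \<in> N"
| X: "v \<in> N \<Longrightarrow> X i v \<in> N"
| add: "v \<in> N \<Longrightarrow> w \<in> N \<Longrightarrow> v + w \<in> N"
| smul: "v \<in> N \<Longrightarrow> smul c v \<in> N"

lemma N_zero: "0 \<in> N"
  using N.smul[OF N.rel[of 0 1 0], of 0] by simp

lemma N_minus: "v \<in> N \<Longrightarrow> - v \<in> N"
  using N.smul[of v "-1"] by (simp add: smul_distribs)

lemma N_diff: "v \<in> N \<Longrightarrow> w \<in> N \<Longrightarrow> v - w \<in> N"
  using N.add[OF _ N_minus, of v w] by simp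

lemma N_sum: "(\<And>a. a \<in> A \<Longrightarrow> g a \<in> N) \<Longrightarrow> sum g A \<in> N"
  by (induction A rule: infinite_finite_induct) (auto intro: N_zero N.add)

lemma Zpow_N: "v \<in> N \<Longrightarrow> (Z ^^ m) v \<in> N"
proof -
  assume "v \<in> N"
  then have "Z v \<in> N"
  proof induction
    case (rel i j v)
    then show ?case using N.rel[of i j "Z v"] by simp
  qed (auto intro: N.intros)
  then show ?thesis using \<open>v \<in> N\<close> by (simp add: Zpow_eq)
qed

lemma cover_op_N: "v \<in> N \<Longrightarrow> cover_op c v \<in> N"
proof (induction rule: N.induct)
  case (rel i j v)
  let ?i = "index_perm ty n c i" and ?j = "index_perm ty n c j"
    and ?w = "(Z ^^ (gen_z ty n c i + gen_z ty n c j)) (cover_op c v)"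
  have "cover_op c (X i (X j v) - Z (X j (X i v))) =
      smul (gen_sign ty n c i * gen_sign ty n c j) (X ?i (X ?j ?w) - Z (X ?j (X ?i ?w)))"
    unfolding cover_op_linear cover_op_Z cover_op_X[of c] smul_distribs
    by (simp add: Zpow_Zpow Z_Zpow mult.commute add.commute)
  then show ?case using N.smul[OF N.rel[of ?i ?j ?w]] rel by simp
next
  case (X v i)
  then show ?case unfolding cover_op_X[of c] by (auto intro!: N.smul N.X Zpow_N)
qed (auto intro: N.intros)

lemma word_op_N: "v \<in> N \<Longrightarrow> word_op cover_op l v \<in> N"
  by (induction l) (auto intro: cover_op_N)

lemma U_N: "v \<in> N \<Longrightarrow> U k i v \<in> N"
proof -
  assume v: "v \<in> N"
  have "CA.S i l v \<in> N" "CA.B i l v \<in> N" "CA.E i v \<in> N" for i l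
    unfolding CA.S_def CA.B_def CA.E_def using v by (rule word_op_N)+
  then have "CA.S i l v \<in> N" "B' i l v \<in> N" "E' i v \<in> N" for i l
    using B'_A B'_BD E'_B E'_AD N_zero by metis+
  then show ?thesis
    unfolding U_def by (auto intro!: N_zero N.smul N_diff N_minus N_sum N.add cover_op_N simp del: cover_op_linear)
qed

lemma Y_N: "v \<in> N \<Longrightarrow> Y k v \<in> N"
proof (induction rule: N.induct)
  case (rel i j v)
  then show ?case unfolding Y_X_relation[OF rel] by (rule N.rel)
next
  case (X v i)
  then show ?case unfolding Y_X by (intro N.add N.X U_N)
qed (auto intro: N.intros)

text \<open>Normal ordering of the \<open>x\<close>-letters; each transposition of two distinct letters costs a \<open>z\<close>.\<close>

definition nbasis :: "nat multiset \<Rightarrow> nat multiset \<Rightarrow> cover_gen list set \<Rightarrow> nvec" where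
  "nbasis A M g = Poly_Mapping.single (A, M, g) 1"

text \<open>The multiset stands for its nondecreasing word. A new \<open>x_j\<close> travels past
  the strictly smaller letters, each at the cost of a \<open>z\<close>, and stops before its
  equals.\<close>

definition X1 :: "nat \<Rightarrow> nvec \<Rightarrow> nvec" where
  "X1 j = lext (\<lambda>(A, M, g). nbasis (add_mset j A) M ((cover_act ty n Zc ^^ size (filter_mset (\<lambda>k. k < j) A)) g))"

definition Z1 :: "nvec \<Rightarrow> nvec" where
  "Z1 = lext (\<lambda>(A, M, g). nbasis A M (cover_act ty n Zc g))"

lemma lin_X1: "lin (X1 j)" and lin_Z1: "lin Z1"
  by (simp_all add: X1_def Z1_def lin_lext)

lemmas XZ1_linear [simp] = linD[OF lin_X1] linD[OF lin_Z1]

lemma X1_nbasis: "X1 j (nbasis A M g) = nbasis (add_mset j A) M ((cover_act ty n Zc ^^ size (filter_mset (\<lambda>k. k < j) A)) g)"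
  and Z1_nbasis: "Z1 (nbasis A M g) = nbasis A M (cover_act ty n Zc g)"
  by (simp_all add: X1_def Z1_def nbasis_def)

lemma lin_eq_nbasisI:
  assumes "lin F" "lin G" "\<And>A M g. F (nbasis A M g) = G (nbasis A M g)"
  shows "F v = G v"
  by (rule lin_eqI[OF assms(1,2)]) (use assms(3) in \<open>force simp: nbasis_def\<close>)

lemma Z1_X1: "Z1 (X1 j v) = X1 j (Z1 v)"
  by (rule lin_eq_nbasisI[where F = "\<lambda>v. Z1 (X1 j v)"])
    (simp_all add: lin_def X1_nbasis Z1_nbasis funpow_swap1)

lemma cover_act_Zpow: "(cover_act ty n Zc ^^ m) g = (if even m then g else cover_act ty n Zc g)"
  by (induction m) (simp_all add: cover_act_Z(2)[OF adm])

text \<open>Inserting \<open>i\<close> first adds one letter for \<open>j\<close> to pass, whereas a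
  \<open>j\<close> already present is not passed by \<open>i\<close>; the exponents of the two
  orders differ by one.\<close>

lemma X1_swap_less:
  assumes "i < j"
  shows "X1 i (X1 j v) = Z1 (X1 j (X1 i v))"
proof (rule lin_eq_nbasisI[where F = "\<lambda>v. X1 i (X1 j v)"])
  fix A M g
  let ?z = "cover_act ty n Zc" and ?a = "size {#k \<in># A. k < i#}" and ?b = "size {#k \<in># A. k < j#}"
  have "(?z ^^ ?a) ((?z ^^ ?b) g) = ?z ((?z ^^ Suc ?b) ((?z ^^ ?a) g))"
    by (simp add: cover_act_Zpow cover_act_Z(2)[OF adm])
  then show "X1 i (X1 j (nbasis A M g)) = Z1 (X1 j (X1 i (nbasis A M g)))"
    unfolding X1_nbasis Z1_nbasis add_mset_commute[of i j] using assms by simp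
qed (simp_all add: lin_def)

lemma Z1_Z1: "Z1 (Z1 v) = v"
  by (rule lin_eq_nbasisI[where F = "\<lambda>v. Z1 (Z1 v)"])
    (simp_all add: lin_def Z1_nbasis cover_act_Z(2)[OF adm])

lemma X1_swap: "i \<noteq> j \<Longrightarrow> X1 i (X1 j v) = Z1 (X1 j (X1 i v))"
  using X1_swap_less Z1_Z1 by (metis linorder_neqE_nat)

primrec nord_word :: "nat list \<Rightarrow> nat multiset \<Rightarrow> cover_gen list set \<Rightarrow> nvec" where
  "nord_word [] M g = nbasis {#} M g"
| "nord_word (j # a) M g = X1 j (nord_word a M g)"

definition nord :: "vec \<Rightarrow> nvec" where
  "nord = lext (\<lambda>(a, M, g). nord_word a M g)"

lemma lin_nord: "lin nord" by (simp add: nord_def lin_lext)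

lemmas nord_linear [simp] = linD[OF lin_nord]

lemma nord_bvec: "nord (bvec a M g) = nord_word a M g"
  by (simp add: nord_def bvec_def)

lemma nord_X: "nord (X j v) = X1 j (nord v)"
  by (rule lin_eq_bvecI[where F = "\<lambda>v. nord (X j v)"]) (simp_all add: lin_def nord_bvec)

lemma nord_Z: "nord (Z v) = Z1 (nord v)"
  by (induction v rule: vec_X_induct) (simp_all add: cover_op_Zc_bvec nord_bvec nord_X Z1_nbasis Z1_X1)

lemma nord_N: "v \<in> N \<Longrightarrow> nord v = 0"
proof (induction rule: N.induct)
  case (rel i j v)
  then show ?case by (simp add: nord_X nord_Z X1_swap[OF rel] Z1_X1)
qed (simp_all add: nord_X)

lemma nord_word_sorted: "sorted a \<Longrightarrow> nord_word a M g = nbasis (mset a) M g"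
proof (induction a)
  case (Cons j a)
  then have *: "filter_mset (\<lambda>k. k < j) (mset a) = {#}"
    by (intro multiset_eqI) (auto simp: count_eq_zero_iff)
  show ?case using Cons by (simp add: X1_nbasis *)
qed simp

end

section \<open>Evaluation of the free algebra\<close>

lemma smul_eq_scal_mult: "smul c a = scal c * a"
proof -
  have "scal c * a = (\<Sum>k\<in>Poly_Mapping.keys a. scal c * Poly_Mapping.single k (Poly_Mapping.lookup a k))"
    by (subst vec_expand[of a]) (simp add: sum_distrib_left)
  also have "\<dots> = smul c (\<Sum>k\<in>Poly_Mapping.keys a. Poly_Mapping.single k (Poly_Mapping.lookup a k))"
    by (simp add: scal_def mult_single smul_sum)
  also have "\<dots> = smul c a" by (simp only: vec_expand[of a, symmetric])
  finally show ?thesis ..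
qed

lemma scal_commute: "scal c * a = a * scal c"
  by (rule scal_central[of "{}" UNIV]) simp

lemma smul_mult:
  fixes a b :: "'g fmon \<Rightarrow>\<^sub>0 complex"
  shows "smul c a * b = smul c (a * b)" "a * smul c b = smul c (a * b)"
  unfolding smul_eq_scal_mult by (metis mult.assoc scal_commute)+

lemma monomial_mult: "monomial a * monomial b = monomial (a @ b)"
  by (simp add: monomial_def mult_single plus_fmon_def)

lemma monomial_Nil: "monomial [] = 1"
  by (simp add: monomial_def zero_fmon_def flip: single_one)

lemma monomial_power: "monomial [g] ^ k = monomial (replicate k g)"
  by (induction k) (simp_all add: monomial_Nil monomial_mult)

definition exp_word :: "nat \<Rightarrow> (nat \<Rightarrow> nat) \<Rightarrow> nat list" where
  "exp_word n \<alpha> = concat (map (\<lambda>i. replicate (\<alpha> i) i) [1..<Suc n])"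

lemma prod_list_monomial:
  "prod_list (map (\<lambda>i. monomial [g i] ^ \<alpha> i) l) = monomial (map g (concat (map (\<lambda>i. replicate (\<alpha> i) i) l)))"
  by (induction l) (simp_all add: monomial_Nil monomial_mult monomial_power)

lemma x_pow_monomial: "x_pow n \<alpha> = monomial (map GX (exp_word n \<alpha>))"
  and y_pow_monomial: "y_pow n \<alpha> = monomial (map GY (exp_word n \<alpha>))"
  unfolding x_pow_def y_pow_def xg_def yg_def exp_word_def by (rule prod_list_monomial)+

lemma set_exp_word: "set (exp_word n \<alpha>) \<subseteq> {1..n}"
  by (auto simp: exp_word_def)

lemma sorted_exp_word: "sorted (exp_word n \<alpha>)"
proof (induction n)
  case (Suc n)
  have "exp_word (Suc n) \<alpha> = exp_word n \<alpha> @ replicate (\<alpha> (Suc n)) (Suc n)"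
    by (simp add: exp_word_def)
  then show ?case using Suc set_exp_word[of n \<alpha>] by (force simp: sorted_append)
qed (simp add: exp_word_def)

lemma count_exp_word: "count (mset (exp_word n \<alpha>)) i = (if i \<in> {1..n} then \<alpha> i else 0)"
proof (induction n)
  case (Suc n)
  have "exp_word (Suc n) \<alpha> = exp_word n \<alpha> @ replicate (\<alpha> (Suc n)) (Suc n)"
    by (simp add: exp_word_def)
  then show ?case using Suc by auto
qed (simp add: exp_word_def)

lemma exp_word_inj: "\<alpha> \<in> exponents n \<Longrightarrow> \<beta> \<in> exponents n \<Longrightarrow> mset (exp_word n \<alpha>) = mset (exp_word n \<beta>) \<Longrightarrow> \<alpha> = \<beta>"
  unfolding exponents_def
  by (rule PiE_ext) (auto dest: arg_cong[of _ _ count] fun_cong simp: count_exp_word fun_eq_iff split: if_splits)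

lemma inj_word_perm: "inj (word_perm ty n l)"
  by (induction l) (auto simp: inj_def)

lemma word_sign_nonzero: "word_sign ty n l j \<noteq> 0"
  by (induction l) (auto simp: gen_sign_def)

lemma yx_value_eq:
  "yx_value ty n u v j i =
    (let bar = (\<lambda>k. if ty = TypeA then 0 else wd (root_elt_bar ty n i k)) in
     if j \<noteq> i then scal u * zg * (wd (root_elt i j) - bar j)
     else - (scal u * zg * (\<Sum>k\<in>{1..n} - {i}. wd (root_elt i k) + bar k))
       - (if ty = TypeB then scal v * zg * wd (root_elt_single n i) else 0))"
  by (cases ty) (simp_all add: yx_value_def)

context daha_rep
begin

primrec gen_op :: "gen \<Rightarrow> vec \<Rightarrow> vec" where
  "gen_op (GX i) = X i"
| "gen_op (GY i) = Y i"
| "gen_op (GW c) = cover_op c"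

definition ev :: "free_elt \<Rightarrow> vec \<Rightarrow> vec" where
  "ev a v = lext (\<lambda>w. foldr gen_op (letters w) v) a"

lemma lin_gen_op: "lin (gen_op g)"
  by (cases g) (simp_all add: lin_X lin_Y lin_cover_op)

lemma ev_left [simp]:
  "ev (a + b) v = ev a v + ev b v" "ev (smul c a) v = smul c (ev a v)" "ev 0 v = 0"
  "ev (- a) v = - ev a v" "ev (a - b) v = ev a v - ev b v"
  "ev (sum f A) v = (\<Sum>k\<in>A. ev (f k) v)"
  unfolding ev_def by (rule linD[OF lin_lext])+

lemma lin_ev: "lin (ev a)"
proof -
  have "ev a = (\<lambda>v. \<Sum>w\<in>Poly_Mapping.keys a. smul (Poly_Mapping.lookup a w) (foldr gen_op (letters w) v))"
    by (simp add: fun_eq_iff ev_def lext_def)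
  moreover have "lin (\<lambda>v. \<Sum>w\<in>Poly_Mapping.keys a. smul (Poly_Mapping.lookup a w) (foldr gen_op (letters w) v))"
    by (intro lin_sum_map lin_smul_map lin_foldr lin_gen_op)
  ultimately show ?thesis by simp
qed

lemmas ev_right [simp] = linD[OF lin_ev]

lemma ev_single [simp]: "ev (Poly_Mapping.single w c) v = smul c (foldr gen_op (letters w) v)"
  by (simp add: ev_def)

lemma ev_mult [simp]: "ev (a * b) v = ev a (ev b v)"
proof (induction a rule: vec_induct)
  case (basis w)
  show ?case
    by (induction b rule: vec_induct) (simp_all add: smul_mult distrib_left mult_single plus_fmon_def
        linD[OF lin_foldr, of gen_op, OF lin_gen_op])
qed (simp_all add: smul_mult distrib_right)

lemma ev_monomial: "ev (monomial l) v = foldr gen_op l v"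
  by (simp add: monomial_def)

lemma ev_wd [simp]: "ev (wd l) v = word_op cover_op l v"
  unfolding wd_def ev_monomial by (induction l) simp_all

lemma ev_gens [simp]: "ev (xg i) v = X i v" "ev (yg i) v = Y i v" "ev zg v = Z v" "ev (tg i) v = cover_op (Tc i) v"
  "ev (scal c) v = smul c v"
  by (simp_all add: xg_def yg_def zg_def tg_def ev_monomial) (simp add: scal_def zero_fmon_def)

lemma ev_N: "v \<in> N \<Longrightarrow> ev a v \<in> N"
proof (induction a rule: vec_induct)
  case (basis w)
  have "gen_op g x \<in> N" if "x \<in> N" for g x
    using that by (cases g) (auto intro: N.X Y_N cover_op_N)
  then have "foldr gen_op l v \<in> N" for l
    using basis by (induction l) auto
  then show ?case by simp
qed (auto intro: N.smul N.add)

lemma ev_yx_value: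
  assumes "i \<in> {1..n}" "j \<in> {1..n}"
  shows "ev (yx_value ty n p q j i) v = U j i v"
proof -
  define bar where "bar = (\<lambda>k. if ty = TypeA then 0 else wd (root_elt_bar ty n i k))"
  have bar: "ev (bar k) w = B' i k w" for k w
  proof (cases "ty = TypeA")
    case True
    then have "bar k = 0" by (simp add: bar_def)
    then show ?thesis unfolding B'_A[OF True] by simp
  next
    case False
    then have "bar k = wd (root_elt_bar ty n i k)" by (simp add: bar_def)
    then show ?thesis unfolding B'_BD[OF False] by (simp add: CA.B_def)
  qed
  have single: "ev (if ty = TypeB then scal q * zg * wd (root_elt_single n i) else 0) v = smul q (Z (E' i v))"
  proof (cases "ty = TypeB")
    case True
    show ?thesis unfolding E'_B[OF True] if_P[OF True] by (simp add: CA.E_def)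
  next
    case False
    show ?thesis unfolding E'_AD[OF False] if_not_P[OF False] by simp
  qed
  have "yx_value ty n p q j i = (if j \<noteq> i then scal p * zg * (wd (root_elt i j) - bar j)
     else - (scal p * zg * (\<Sum>k\<in>{1..n} - {i}. wd (root_elt i k) + bar k))
       - (if ty = TypeB then scal q * zg * wd (root_elt_single n i) else 0))"
    unfolding yx_value_eq bar_def Let_def ..
  then show ?thesis
    using single assms
    by (auto simp: U_offdiag U_diag bar CA.S_def smul_distribs smul_sum sum.distrib)
qed

text \<open>Every relation acts as zero except the one between two x, which acts by a generator of
  \<open>N\<close>.\<close>

lemma common_rels_N: "a \<in> common_rels ty n \<Longrightarrow> ev a v \<in> N"
  unfolding common_rels_def
proof (elim UnE CollectE exE conjE)
  fix l r assume "a = wd l - wd r" "(l, r) \<in> cover_rels ty n"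
  then show ?thesis using cover_op_rel by (simp add: N_zero)
next
  fix g assume "a = zg * monomial [g] - monomial [g] * zg" "g \<in> gens ty n"
  then show ?thesis by (cases g) (simp_all add: ev_monomial Z_Y cover_op_Z N_zero del: cover_op_ZZ)
next
  fix i j assume "a = xg i * xg j - zg * xg j * xg i" "i \<noteq> j"
  then show ?thesis using N.rel[of i j v] by simp
next
  fix i j assume "a = yg i * yg j - yg j * yg i"
  then show ?thesis using Y_commute[of i j v] by (simp add: N_zero)
next
  fix i j assume "a = tg i * xg j - zg * xg j * tg i" "i \<in> {1..<n}" "j \<noteq> i" "j \<noteq> i + 1"
  then show ?thesis unfolding \<open>a = _\<close> ev_left ev_mult ev_gens T_X
    by (simp add: N_zero refl_perm_less transpose_def)
next
  fix i j assume "a = tg i * yg j - yg j * tg i" "i \<in> {1..<n}" "j \<noteq> i" "j \<noteq> i + 1"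
  then show ?thesis using T_Y[of i j v] by (simp add: N_zero refl_perm_less)
next
  fix i assume "a = tg i * xg (i + 1) - zg * xg i * tg i" "i \<in> {1..<n}"
  then show ?thesis unfolding \<open>a = _\<close> ev_left ev_mult ev_gens T_X
    by (simp add: N_zero refl_perm_less)
next
  fix i assume "a = tg i * yg (i + 1) - yg i * tg i" "i \<in> {1..<n}"
  then show ?thesis using T_Y[of i "i + 1" v] by (simp add: N_zero refl_perm_less)
qed

lemma tn_rels_B_N:
  assumes ty: "ty = TypeB"
  shows "a \<in> tn_rels_B n \<Longrightarrow> ev a v \<in> N"
proof -
  have sc: "sign_change ty n (Tc n) k \<longleftrightarrow> k = n" and P: "refl_perm ty n n = id" for k
    by (simp_all add: sign_change_def ty refl_perm_def)
  have "ty \<noteq> TypeA" using ty by simp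
  then have g: "CA.gen_index n" by simp
  assume "a \<in> tn_rels_B n"
  then show ?thesis
    unfolding tn_rels_B_def
    by (elim UnE CollectE exE conjE singletonE) (simp_all only: ev_left ev_mult ev_gens T_X T_Y[OF g] sc P, simp_all add: N_zero)
qed

lemma tn_rels_D_N:
  assumes ty: "ty = TypeD"
  shows "a \<in> tn_rels_D n \<Longrightarrow> ev a v \<in> N"
proof -
  have sc: "sign_change ty n (Tc n) k \<longleftrightarrow> k = n - 1 \<or> k = n" and P: "refl_perm ty n n = transpose (n - 1) n" for k
    by (simp_all add: sign_change_def ty refl_perm_def)
  have "ty \<noteq> TypeA" using ty by simp
  then have g: "CA.gen_index n" by simp
  assume "a \<in> tn_rels_D n"
  then show ?thesis
    unfolding tn_rels_D_def
    by (elim UnE CollectE exE conjE singletonE) (simp_all only: ev_left ev_mult ev_gens T_X T_Y[OF g] sc P, simp_all add: N_zero)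
qed

lemma hecke_rels_N: "a \<in> hecke_rels ty n p q \<Longrightarrow> ev a v \<in> N"
  unfolding hecke_rels_def
proof (elim UnE CollectE exE conjE)
  assume "a \<in> common_rels ty n"
  then show ?thesis by (rule common_rels_N)
next
  assume a: "a \<in> (case ty of TypeA \<Rightarrow> {} | TypeB \<Rightarrow> tn_rels_B n | TypeD \<Rightarrow> tn_rels_D n)"
  consider "ty = TypeA" | "ty = TypeB" | "ty = TypeD" by (cases ty)
  then show ?thesis
  proof cases
    case 1
    then show ?thesis using a by simp
  next
    case 2
    have "a \<in> tn_rels_B n" using a 2 by simp
    with 2 show ?thesis by (rule tn_rels_B_N)
  next
    case 3
    have "a \<in> tn_rels_D n" using a 3 by simp
    with 3 show ?thesis by (rule tn_rels_D_N)
  qed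
next
  fix i j assume "a = commutator (yg j) (xg i) - yx_value ty n p q j i" "i \<in> {1..n}" "j \<in> {1..n}"
  then show ?thesis by (simp add: commutator_def ev_yx_value Y_X N_zero)
qed

abbreviation F where "F \<equiv> free_algebra (gens ty n)"

text \<open>Stability of \<open>N\<close> under all operators gives closure under left
  multiplication; closure under right multiplication holds because the condition is imposed on every
  \<open>v\<close>.\<close>

lemma ideal_N: "ideal {a \<in> carrier F. \<forall>v. ev a v \<in> N} F"
proof (rule idealI)
  interpret F: ring F by (rule ring_free_algebra)
  show "ring F" by (rule ring_free_algebra)
  show "subgroup {a \<in> carrier F. \<forall>v. ev a v \<in> N} (add_monoid F)"
  proof (rule subgroup.intro)
    fix a assume a: "a \<in> {a \<in> carrier F. \<forall>v. ev a v \<in> N}"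
    have "\<ominus>\<^bsub>F\<^esub> a = - a"
      by (rule F.minus_equality) (use a in \<open>auto simp: free_algebra_closed\<close>)
    then have inv: "inv\<^bsub>add_monoid F\<^esub> a = - a" by (simp only: a_inv_def)
    show "inv\<^bsub>add_monoid F\<^esub> a \<in> {a \<in> carrier F. \<forall>v. ev a v \<in> N}"
      unfolding inv using a by (auto simp: free_algebra_closed intro: N_minus)
  qed (auto simp: free_algebra_closed N_zero intro: N.add)
qed (auto simp: free_algebra_closed intro: ev_N)

lemma genideal_N:
  assumes "a \<in> Idl\<^bsub>F\<^esub> (hecke_rels ty n p q)"
  shows "ev a v \<in> N"
proof -
  have "Idl\<^bsub>F\<^esub> (hecke_rels ty n p q) \<subseteq> {a \<in> carrier F. \<forall>v. ev a v \<in> N}"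
    using hecke_rels_carrier[OF adm, of p q] hecke_rels_N
    by (intro ring.genideal_minimal[OF ring_free_algebra ideal_N]) auto
  then show ?thesis using assms by auto
qed

definition word_class :: "cover_gen list \<Rightarrow> cover_gen list set" where
  "word_class l = word_cong (cover_gens ty n) (cover_rels ty n) `` {l}"

text \<open>Since \<open>nord\<close> kills \<open>N\<close>, these coordinates vanish on the ideal
  of relations and separate classes in the quotient.\<close>

definition coord :: "free_elt \<Rightarrow> nvec" where
  "coord a = nord (ev a (bvec [] {#} (word_class [])))"

lemma lin_coord: "lin coord"
  by (simp add: lin_def coord_def)

lemma coord_genideal: "a \<in> Idl\<^bsub>F\<^esub> (hecke_rels ty n p q) \<Longrightarrow> coord a = 0"
  unfolding coord_def by (intro nord_N genideal_N)

lemma word_op_bvec_mset: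
  "\<exists>c. c \<noteq> 0 \<and> word_op cover_op l (bvec [] M g) =
     smul c (bvec [] (image_mset (word_perm ty n l) M) (foldr (cover_act ty n) l g))"
proof (induction M)
  case empty
  show ?case by (rule exI[of _ 1]) (simp add: word_op_bvec)
next
  case (add j M)
  then obtain c where "c \<noteq> 0" "word_op cover_op l (bvec [] M g) =
     smul c (bvec [] (image_mset (word_perm ty n l) M) (foldr (cover_act ty n) l g))" by blast
  then show ?case
    using word_op_Y0[of l j "bvec [] M g"] word_sign_nonzero[of ty n l j]
    by (intro exI[of _ "word_sign ty n l j * c"]) simp
qed

text \<open>Carrying the word to the right past the y-letters permutes them and costs only signs,
  collected in \<open>c\<close>. The x-letters of \<open>x_pow\<close> are already sorted, so normal
  ordering adds no \<open>z\<close>.\<close>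

lemma coord_pbw:
  assumes "l \<in> lists (cover_gens ty n)"
  shows "\<exists>c. c \<noteq> 0 \<and> coord (x_pow n \<alpha> * wd l * y_pow n \<gamma>) =
    smul c (nbasis (mset (exp_word n \<alpha>)) (image_mset (word_perm ty n l) (mset (exp_word n \<gamma>))) (word_class l))"
proof -
  have x: "foldr gen_op (map GX a) (bvec [] M g) = bvec a M g" for a M g
    by (induction a) simp_all
  have y: "foldr gen_op (map GY a) (bvec [] M g) = bvec [] (mset a + M) g" for a M g
    by (induction a) (simp_all add: Y_bvec)
  obtain c where c: "c \<noteq> 0" "word_op cover_op l (bvec [] (mset (exp_word n \<gamma>)) (word_class [])) =
     smul c (bvec [] (image_mset (word_perm ty n l) (mset (exp_word n \<gamma>))) (foldr (cover_act ty n) l (word_class [])))"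
    using word_op_bvec_mset by blast
  have l: "foldr (cover_act ty n) l (word_class []) = word_class l"
    using cover_act_word[OF adm assms, of "[]"] by (simp add: word_class_def)
  have "ev (x_pow n \<alpha> * wd l * y_pow n \<gamma>) (bvec [] {#} (word_class [])) =
    smul c (bvec (exp_word n \<alpha>) (image_mset (word_perm ty n l) (mset (exp_word n \<gamma>))) (word_class l))"
    unfolding x_pow_monomial y_pow_monomial ev_mult ev_wd ev_monomial y
    using c l by (simp add: linD[OF lin_foldr, of gen_op, OF lin_gen_op] x)
  then have "coord (x_pow n \<alpha> * wd l * y_pow n \<gamma>) =
    smul c (nbasis (mset (exp_word n \<alpha>)) (image_mset (word_perm ty n l) (mset (exp_word n \<gamma>))) (word_class l))"
    by (simp add: coord_def nord_bvec nord_word_sorted sorted_exp_word)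
  then show ?thesis using c(1) by blast
qed

end

section \<open>Spanning\<close>

lemma gens_iff: "GX i \<in> gens ty n \<longleftrightarrow> i \<in> {1..n}" "GY i \<in> gens ty n \<longleftrightarrow> i \<in> {1..n}"
  "GW c \<in> gens ty n \<longleftrightarrow> c \<in> cover_gens ty n"
  by (auto simp: gens_def)

context daha_rep
begin

section \<open>Congruence modulo the defining relations\<close>

definition I :: "free_elt set" where "I = Idl\<^bsub>F\<^esub> (hecke_rels ty n p q)"

lemma ideal_I: "ideal I F"
  unfolding I_def by (rule ideal_presented[OF hecke_rels_carrier[OF adm]])

lemma I_carrier: "a \<in> I \<Longrightarrow> a \<in> carrier F"
  using additive_subgroup.a_Hcarr[OF ideal.axioms(1)[OF ideal_I]] .

lemma I_rel: "a \<in> hecke_rels ty n p q \<Longrightarrow> a \<in> I"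
  unfolding I_def using ring.genideal_self[OF ring_free_algebra hecke_rels_carrier[OF adm]] by blast

lemma I_mult:
  assumes "a \<in> I" "b \<in> carrier F" shows "a * b \<in> I" "b * a \<in> I"
  using ideal.I_r_closed[OF ideal_I assms] ideal.I_l_closed[OF ideal_I assms] by simp_all

lemma I_add: "a \<in> I \<Longrightarrow> b \<in> I \<Longrightarrow> a + b \<in> I"
  using additive_subgroup.a_closed[OF ideal.axioms(1)[OF ideal_I], of a b] by simp

lemma smul_in_free_algebra: "a \<in> carrier F \<Longrightarrow> smul c a \<in> carrier F"
  by (simp add: smul_eq_scal_mult free_algebra_closed)

lemma I_smul: "a \<in> I \<Longrightarrow> smul c a \<in> I"
  by (simp add: smul_eq_scal_mult I_mult)

lemma I_minus: "a \<in> I \<Longrightarrow> - a \<in> I"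
  using I_smul[of a "-1"] by (simp add: smul_distribs)

lemma I_diff: "a \<in> I \<Longrightarrow> b \<in> I \<Longrightarrow> a - b \<in> I"
  using I_add[OF _ I_minus, of a b] by simp

lemma I_zero: "0 \<in> I"
  using additive_subgroup.zero_closed[OF ideal.axioms(1)[OF ideal_I]] by simp

definition cong :: "free_elt \<Rightarrow> free_elt \<Rightarrow> bool" where
  "cong a b \<longleftrightarrow> a - b \<in> I"

lemma cong_refl: "cong a a"
  by (simp add: cong_def I_zero)

lemma cong_trans: "cong a b \<Longrightarrow> cong b c \<Longrightarrow> cong a c"
  using I_add[of "a - b" "b - c"] by (simp add: cong_def)

lemma cong_sym: "cong a b \<Longrightarrow> cong b a"
  using I_minus[of "a - b"] by (simp add: cong_def)

lemma cong_mult_left: "cong a b \<Longrightarrow> c \<in> carrier F \<Longrightarrow> cong (c * a) (c * b)"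
  using I_mult(2)[of "a - b" c] by (simp add: cong_def right_diff_distrib)

lemma cong_mult_right: "cong a b \<Longrightarrow> c \<in> carrier F \<Longrightarrow> cong (a * c) (b * c)"
  using I_mult(1)[of "a - b" c] by (simp add: cong_def left_diff_distrib)

lemma cong_smul: "cong a b \<Longrightarrow> cong (smul c a) (smul c b)"
  using I_smul[of "a - b" c] by (simp add: cong_def smul_distribs)

lemma x_F [simp]: "i \<in> {1..n} \<Longrightarrow> xg i \<in> carrier F"
  and y_F [simp]: "i \<in> {1..n} \<Longrightarrow> yg i \<in> carrier F"
  and gw_F [simp]: "c \<in> cover_gens ty n \<Longrightarrow> monomial [GW c] \<in> carrier F"
  by (simp_all add: xg_def yg_def gens_def)

lemma Zc_gens [simp]: "Zc \<in> cover_gens ty n"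
  by (simp add: cover_gens_def)

lemma zg_eq: "zg = monomial [GW Zc]" and tg_eq: "tg i = monomial [GW (Tc i)]"
  by (simp_all add: zg_def tg_def wd_def)

lemma zg_F [simp]: "zg \<in> carrier F"
  by (simp add: zg_eq del: monomial_in_free_algebra)

lemma common_rel: "a \<in> common_rels ty n \<Longrightarrow> a \<in> I"
  by (rule I_rel) (simp add: hecke_rels_def)

lemma z_central: "g \<in> gens ty n \<Longrightarrow> cong (zg * monomial [g]) (monomial [g] * zg)"
  unfolding cong_def by (rule common_rel) (auto simp: common_rels_def)

lemma cover_rel_cong: "(l, r) \<in> cover_rels ty n \<Longrightarrow> cong (wd l) (wd r)"
  unfolding cong_def by (rule common_rel) (auto simp: common_rels_def)

lemma zz: "cong (zg * zg) 1"
  using cover_rel_cong[of "[Zc, Zc]" "[]"]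
  by (simp add: cover_rels_def wd_def zg_def monomial_mult monomial_Nil)

lemma tt: "CA.gen_index i \<Longrightarrow> cong (tg i * tg i) 1"
proof -
  assume "CA.gen_index i"
  then have "([Tc i, Tc i], []) \<in> cover_rels ty n"
    unfolding CA.gen_index_def
    by (cases ty) (auto simp: cover_rels_def cover_rels_A_def cover_rels_B_def cover_rels_D_def)
  then show ?thesis
    using cover_rel_cong[of "[Tc i, Tc i]" "[]"] by (simp add: wd_def tg_def monomial_mult monomial_Nil)
qed

lemma zt: "CA.gen_index i \<Longrightarrow> cong (zg * tg i) (tg i * zg)"
  using z_central[of "GW (Tc i)"] Tc_gens by (auto simp: tg_eq gens_def)

lemma tg_F [simp]: "CA.gen_index i \<Longrightarrow> tg i \<in> carrier F"
  using Tc_gens by (simp add: tg_eq del: monomial_in_free_algebra)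

text \<open>As the \<open>t\<^sub>i\<close> are involutions modulo the relations, each of the relations between \<open>t\<^sub>i\<close> and
  \<open>x\<close> or \<open>y\<close> can be read in both directions.\<close>

lemma swap_z:
  assumes t: "CA.gen_index i" and x: "x \<in> carrier F" "x' \<in> carrier F" and r: "cong (tg i * x) (zg * x' * tg i)"
  shows "cong (tg i * x') (zg * x * tg i)"
proof -
  let ?t = "tg i"
  \<comment> \<open>The given relation is multiplied by \<open>t\<close> on both sides and by
    \<open>-z\<close>; the other terms are multiples of t t - 1, z t - t z and z z - 1 that repair
    the order of factors. Expanding in the free algebra leaves only the left-hand side.\<close>
  have "?t * x' - zg * x * ?t = - (zg * (?t * (?t * x - zg * x' * ?t) * ?t)) + zg * ((?t * ?t - 1) * (x * ?t))
     + zg * ((zg * ?t - ?t * zg) * (x' * (?t * ?t))) - (zg * zg - 1) * (?t * x' * (?t * ?t)) - (?t * x') * (?t * ?t - 1)"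
    by (simp add: algebra_simps)
  moreover have "- (zg * (?t * (?t * x - zg * x' * ?t) * ?t)) \<in> I"
    using r[unfolded cong_def] t by (intro I_minus I_mult(2)[OF I_mult(1)[OF I_mult(2)]]) simp_all
  moreover have "zg * ((?t * ?t - 1) * (x * ?t)) \<in> I"
    using tt[OF t] x t unfolding cong_def by (intro I_mult(2)[OF I_mult(1)] free_algebra_closed(4)) simp_all
  moreover have "zg * ((zg * ?t - ?t * zg) * (x' * (?t * ?t))) \<in> I"
    using zt[OF t] x t unfolding cong_def by (intro I_mult(2)[OF I_mult(1)] free_algebra_closed(4)) simp_all
  moreover have "(zg * zg - 1) * (?t * x' * (?t * ?t)) \<in> I"
    using zz x t unfolding cong_def by (intro I_mult(1) free_algebra_closed(4)) simp_all
  moreover have "(?t * x') * (?t * ?t - 1) \<in> I"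
    using tt[OF t] x t unfolding cong_def by (intro I_mult(2) free_algebra_closed(4)) simp_all
  ultimately show ?thesis unfolding cong_def by (simp only: I_add I_diff)
qed

text \<open>The sign \<open>s = 1\<close> serves the y-relations of the generators of type A,
  \<open>s = -1\<close> those of the last generator in type D.\<close>

lemma swap_sign:
  assumes t: "CA.gen_index i" and x: "x \<in> carrier F" "x' \<in> carrier F"
    and s: "s * s = 1" and r: "cong (tg i * x) (smul s (x' * tg i))"
  shows "cong (tg i * x') (smul s (x * tg i))"
proof -
  let ?t = "tg i"
  have "?t * x' - smul s (x * ?t) = smul (- s) (?t * (?t * x - smul s (x' * ?t)) * ?t)
     + smul s ((?t * ?t - 1) * (x * ?t)) - (?t * x') * (?t * ?t - 1)"
    using s by (simp add: algebra_simps smul_mult smul_distribs)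
  moreover have "smul (- s) (?t * (?t * x - smul s (x' * ?t)) * ?t) \<in> I"
    using r[unfolded cong_def] t by (intro I_smul I_mult(1)[OF I_mult(2)]) simp_all
  moreover have "smul s ((?t * ?t - 1) * (x * ?t)) \<in> I"
    using tt[OF t] x t unfolding cong_def by (intro I_smul I_mult(1) free_algebra_closed(4)) simp_all
  moreover have "(?t * x') * (?t * ?t - 1) \<in> I"
    using tt[OF t] x t unfolding cong_def by (intro I_mult(2) free_algebra_closed(4)) simp_all
  ultimately show ?thesis unfolding cong_def by (simp only: I_add I_diff)
qed

definition moved_x :: "cover_gen \<Rightarrow> nat \<Rightarrow> free_elt" where
  "moved_x c j = smul (gen_sign ty n c j) (zg ^ gen_z ty n c j * xg (index_perm ty n c j) * monomial [GW c])"

definition moved_y :: "cover_gen \<Rightarrow> nat \<Rightarrow> free_elt" where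
  "moved_y c j = smul (gen_sign ty n c j) (yg (index_perm ty n c j) * monomial [GW c])"

lemma move_less:
  assumes i: "i \<in> {1..<n}" and j: "j \<in> {1..n}"
  shows "cong (tg i * xg j) (moved_x (Tc i) j)" "cong (tg i * yg j) (moved_y (Tc i) j)"
proof -
  have g: "CA.gen_index i" and ii: "i \<in> {1..n}" "i + 1 \<in> {1..n}" using i by auto
  have m: "moved_x (Tc i) j = zg * xg (transpose i (i + 1) j) * tg i"
    "moved_y (Tc i) j = smul 1 (yg (transpose i (i + 1) j) * tg i)"
    using i by (simp_all add: moved_x_def moved_y_def tg_eq)
  have X: "cong (tg i * xg (i + 1)) (zg * xg i * tg i)" and Y: "cong (tg i * yg (i + 1)) (smul 1 (yg i * tg i))"
    unfolding cong_def by (rule common_rel; use i in \<open>auto simp: common_rels_def\<close>)+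
  consider "j = i" | "j = i + 1" | "j \<noteq> i" "j \<noteq> i + 1" by blast
  then have "cong (tg i * xg j) (zg * xg (transpose i (i + 1) j) * tg i) \<and>
    cong (tg i * yg j) (smul 1 (yg (transpose i (i + 1) j) * tg i))"
  proof cases
    case 1
    then show ?thesis
      using swap_z[OF g _ _ X] swap_sign[OF g _ _ _ Y] ii by simp
  next
    case 2
    then show ?thesis using X Y by simp
  next
    case 3
    have "cong (tg i * xg j) (zg * xg j * tg i)" "cong (tg i * yg j) (smul 1 (yg j * tg i))"
      unfolding cong_def by (rule common_rel; use i j 3 in \<open>auto simp: common_rels_def\<close>)+
    then show ?thesis using 3 by simp
  qed
  then show "cong (tg i * xg j) (moved_x (Tc i) j)" "cong (tg i * yg j) (moved_y (Tc i) j)"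
    unfolding m by blast+
qed

lemma move_n_B:
  assumes ty: "ty = TypeB" and j: "j \<in> {1..n}"
  shows "cong (tg n * xg j) (moved_x (Tc n) j)" "cong (tg n * yg j) (moved_y (Tc n) j)"
proof -
  have rel: "a \<in> tn_rels_B n \<Longrightarrow> a \<in> I" for a
    by (rule I_rel) (simp add: hecke_rels_def ty)
  have m: "moved_x (Tc n) j = (if j = n then smul (-1) (xg n * tg n) else zg * xg j * tg n)"
    "moved_y (Tc n) j = (if j = n then smul (-1) (yg n * tg n) else yg j * tg n)"
    unfolding moved_x_def moved_y_def tg_eq unfolding ty by simp_all
  have "cong (tg n * xg j) (if j = n then smul (-1) (xg n * tg n) else zg * xg j * tg n)"
    "cong (tg n * yg j) (if j = n then smul (-1) (yg n * tg n) else yg j * tg n)"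
    unfolding cong_def by (rule rel; use j in \<open>auto simp: tn_rels_B_def smul_distribs\<close>)+
  then show "cong (tg n * xg j) (moved_x (Tc n) j)" "cong (tg n * yg j) (moved_y (Tc n) j)"
    unfolding m by blast+
qed

lemma move_n_D:
  assumes ty: "ty = TypeD" and j: "j \<in> {1..n}"
  shows "cong (tg n * xg j) (moved_x (Tc n) j)" "cong (tg n * yg j) (moved_y (Tc n) j)"
proof -
  have "ty \<noteq> TypeA" using ty by simp
  then have g: "CA.gen_index n" and n: "4 \<le> n" using CA.rank(3)[OF ty] by simp_all
  have rel: "a \<in> tn_rels_D n \<Longrightarrow> a \<in> I" for a
    by (rule I_rel) (simp add: hecke_rels_def ty)
  have m: "moved_x (Tc n) j = (if j = n - 1 \<or> j = n then smul (-1) (xg (transpose (n - 1) n j) * tg n) else zg * xg j * tg n)"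
    "moved_y (Tc n) j = (if j = n - 1 \<or> j = n then smul (-1) (yg (transpose (n - 1) n j) * tg n) else yg j * tg n)"
    unfolding moved_x_def moved_y_def tg_eq unfolding ty by auto
  have X: "cong (tg n * xg n) (smul (-1) (xg (n - 1) * tg n))" and Y: "cong (tg n * yg n) (smul (-1) (yg (n - 1) * tg n))"
    unfolding cong_def by (rule rel; use j in \<open>auto simp: tn_rels_D_def smul_distribs\<close>)+
  have X': "cong (tg n * xg (n - 1)) (smul (-1) (xg n * tg n))" and Y': "cong (tg n * yg (n - 1)) (smul (-1) (yg n * tg n))"
    using swap_sign[OF g _ _ _ X] swap_sign[OF g _ _ _ Y] n by simp_all
  have "cong (tg n * xg j) (zg * xg j * tg n)" "cong (tg n * yg j) (yg j * tg n)" if "j \<noteq> n - 1" "j \<noteq> n"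
    unfolding cong_def by (rule rel; use j that in \<open>auto simp: tn_rels_D_def\<close>)+
  then show "cong (tg n * xg j) (moved_x (Tc n) j)" "cong (tg n * yg j) (moved_y (Tc n) j)"
    unfolding m using X Y X' Y' n by auto
qed

lemma move:
  assumes c: "c \<in> cover_gens ty n" and j: "j \<in> {1..n}"
  shows "cong (monomial [GW c] * xg j) (moved_x c j)" "cong (monomial [GW c] * yg j) (moved_y c j)"
proof -
  have "cong (monomial [GW c] * xg j) (moved_x c j) \<and> cong (monomial [GW c] * yg j) (moved_y c j)"
  proof (cases c)
    case Zc
    then show ?thesis
      using z_central[of "GX j"] z_central[of "GY j"] j
      by (simp add: moved_x_def moved_y_def zg_eq xg_def yg_def gens_def)
  next
    case (Tc i)
    then have i: "i \<in> {1..<n} \<or> i = n \<and> ty \<noteq> TypeA" using c by (auto simp: cover_gens_def split: if_splits)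
    consider "i \<in> {1..<n}" | "i = n" "ty = TypeB" | "i = n" "ty = TypeD" using i by (cases ty) auto
    then show ?thesis
      using move_less[of i j] move_n_B[of j] move_n_D[of j] j unfolding Tc tg_eq by cases simp_all
  qed
  then show "cong (monomial [GW c] * xg j) (moved_x c j)" "cong (monomial [GW c] * yg j) (moved_y c j)" by blast+
qed

lemma index_perm_range: "c \<in> cover_gens ty n \<Longrightarrow> j \<in> {1..n} \<Longrightarrow> index_perm ty n c j \<in> {1..n}"
  using refl_perm_range[OF adm] by (auto simp: index_perm_def cover_gens_def split: cover_gen.splits if_splits)

lemma index_perm_involution: "index_perm ty n c (index_perm ty n c j) = j"
  by (cases c) (simp_all add: index_perm_def)

section \<open>Products with x to the left, y to the right\<close>

definition W :: "nat list \<Rightarrow> cover_gen list \<Rightarrow> nat list \<Rightarrow> free_elt" where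
  "W a l c = monomial (map GX a @ map GW l @ map GY c)"

lemma W_Cons: "W (j # a) l c = xg j * W a l c" "W [] (d # l) c = monomial [GW d] * W [] l c"
  "W [] [] (k # c) = yg k * W [] [] c"
  by (simp_all add: W_def xg_def yg_def monomial_mult)

lemma W_F: "set a \<subseteq> {1..n} \<Longrightarrow> l \<in> lists (cover_gens ty n) \<Longrightarrow> set c \<subseteq> {1..n} \<Longrightarrow> W a l c \<in> carrier F"
  by (auto simp: W_def gens_iff subset_iff)

text \<open>Including the ideal permits work with congruences inside the free algebra. Stability
  under left multiplication by each generator then shows that the set contains the whole
  carrier.\<close>

inductive_set ordered_span :: "free_elt set" where
  ideal: "a \<in> I \<Longrightarrow> a \<in> ordered_span"
| W: "set a \<subseteq> {1..n} \<Longrightarrow> l \<in> lists (cover_gens ty n) \<Longrightarrow> set c \<subseteq> {1..n} \<Longrightarrow> W a l c \<in> ordered_span"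
| add: "a \<in> ordered_span \<Longrightarrow> b \<in> ordered_span \<Longrightarrow> a + b \<in> ordered_span"
| smul: "a \<in> ordered_span \<Longrightarrow> smul s a \<in> ordered_span"

lemma ordered_span_cong: "cong a b \<Longrightarrow> b \<in> ordered_span \<Longrightarrow> a \<in> ordered_span"
  using ordered_span.add[OF ordered_span.ideal, of "a - b" b] by (simp add: cong_def)

lemma ordered_span_mult:
  assumes g: "g \<in> carrier F"
    and W: "\<And>a l c. set a \<subseteq> {1..n} \<Longrightarrow> l \<in> lists (cover_gens ty n) \<Longrightarrow> set c \<subseteq> {1..n} \<Longrightarrow> g * W a l c \<in> ordered_span"
  shows "m \<in> ordered_span \<Longrightarrow> g * m \<in> ordered_span"
proof (induction rule: ordered_span.induct)
  case (ideal a)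
  then show ?case using I_mult(2)[OF _ g] by (auto intro: ordered_span.ideal)
next
  case (W a l c)
  then show ?case by (rule assms(2))
qed (simp_all add: distrib_left smul_mult ordered_span.add ordered_span.smul)

lemma x_ordered_span: "j \<in> {1..n} \<Longrightarrow> m \<in> ordered_span \<Longrightarrow> xg j * m \<in> ordered_span"
proof (rule ordered_span_mult)
  fix a l c assume "j \<in> {1..n}" "set a \<subseteq> {1..n}" "l \<in> lists (cover_gens ty n)" "set c \<subseteq> {1..n}"
  then show "xg j * W a l c \<in> ordered_span"
    using ordered_span.W[of "j # a" l c] by (simp add: W_Cons)
qed simp_all

text \<open>Moving \<open>d\<close> past an x may create a factor \<open>z\<close>, so stability
  under \<open>z\<close> is assumed. For \<open>d = Zc\<close> the exponent \<open>gen_z\<close> is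
  0 and the assumption is vacuous; this yields \<open>z_ordered_span\<close> and through it the
  general case.\<close>

lemma gw_ordered_span_aux:
  assumes d: "d \<in> cover_gens ty n" and z: "\<And>j m. gen_z ty n d j \<noteq> 0 \<Longrightarrow> m \<in> ordered_span \<Longrightarrow> zg * m \<in> ordered_span"
  shows "m \<in> ordered_span \<Longrightarrow> monomial [GW d] * m \<in> ordered_span"
proof (rule ordered_span_mult)
  fix a l c assume "set a \<subseteq> {1..n}" "l \<in> lists (cover_gens ty n)" "set c \<subseteq> {1..n}"
  then show "monomial [GW d] * W a l c \<in> ordered_span"
  proof (induction a)
    case Nil
    then show ?case using ordered_span.W[of "[]" "d # l" c] d by (simp add: W_Cons)
  next
    case (Cons j a)
    let ?j = "index_perm ty n d j" and ?k = "gen_z ty n d j"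
    have j: "j \<in> {1..n}" and W: "W a l c \<in> carrier F" using Cons W_F by auto
    have IH: "xg ?j * (monomial [GW d] * W a l c) \<in> ordered_span"
      using Cons index_perm_range[OF d j] by (auto intro: x_ordered_span)
    have "zg ^ k * m \<in> ordered_span" if "k = 0 \<or> gen_z ty n d j \<noteq> 0" "m \<in> ordered_span" for k m
      using that by (induction k) (auto simp: mult.assoc intro: z)
    from this[OF _ IH, of ?k]
    have S: "smul (gen_sign ty n d j) (zg ^ ?k * (xg ?j * (monomial [GW d] * W a l c))) \<in> ordered_span"
      by (intro ordered_span.smul) auto
    have C: "cong (monomial [GW d] * xg j * W a l c) (moved_x d j * W a l c)"
      using move(1)[OF d j] W by (rule cong_mult_right)
    have "moved_x d j * W a l c \<in> ordered_span"
      using S by (simp only: mult.assoc moved_x_def smul_mult)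
    with C have "monomial [GW d] * xg j * W a l c \<in> ordered_span" by (rule ordered_span_cong)
    then show ?case by (simp only: W_Cons mult.assoc)
  qed
qed (use gw_F[OF d] in blast)+

lemma z_ordered_span: "m \<in> ordered_span \<Longrightarrow> zg * m \<in> ordered_span"
  unfolding zg_eq by (rule gw_ordered_span_aux) simp_all

lemma gw_ordered_span: "d \<in> cover_gens ty n \<Longrightarrow> m \<in> ordered_span \<Longrightarrow> monomial [GW d] * m \<in> ordered_span"
  by (rule gw_ordered_span_aux) (auto intro: z_ordered_span)

lemma wd_ordered_span: "l \<in> lists (cover_gens ty n) \<Longrightarrow> m \<in> ordered_span \<Longrightarrow> wd l * m \<in> ordered_span"
proof (induction l)
  case (Cons d l)
  have "wd (d # l) = monomial [GW d] * wd l" by (simp add: wd_def monomial_mult)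
  then show ?case using Cons by (auto simp: mult.assoc intro: gw_ordered_span)
qed (simp add: wd_def monomial_Nil)

lemma ordered_span_zero: "0 \<in> ordered_span"
  by (intro ordered_span.ideal I_zero)

lemma ordered_span_minus: "a \<in> ordered_span \<Longrightarrow> - a \<in> ordered_span"
  using ordered_span.smul[of a "-1"] by (simp add: smul_distribs)

lemma ordered_span_diff: "a \<in> ordered_span \<Longrightarrow> b \<in> ordered_span \<Longrightarrow> a - b \<in> ordered_span"
  using ordered_span.add[OF _ ordered_span_minus, of a b] by simp

lemma ordered_span_sum: "(\<And>k. k \<in> K \<Longrightarrow> g k \<in> ordered_span) \<Longrightarrow> sum g K \<in> ordered_span"
  by (induction K rule: infinite_finite_induct) (auto intro: ordered_span_zero ordered_span.add)

lemma yx_ordered_span: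
  assumes ij: "i \<in> {1..n}" "j \<in> {1..n}" and m: "m \<in> ordered_span"
  shows "yx_value ty n p q j i * m \<in> ordered_span"
proof -
  define bar where "bar = (\<lambda>k. if ty = TypeA then 0 else wd (root_elt_bar ty n i k))"
  have root: "wd (root_elt i k) * m \<in> ordered_span" if "k \<in> {1..n}" "k \<noteq> i" for k
    using root_elts_lists(1)[OF adm, of i k] that ij m by (auto intro: wd_ordered_span)
  have bar: "bar k * m \<in> ordered_span" if "k \<in> {1..n}" for k
  proof (cases "ty = TypeA")
    case True
    then have "bar k = 0" by (simp add: bar_def)
    then show ?thesis by (simp add: ordered_span_zero)
  next
    case False
    then have "bar k = wd (root_elt_bar ty n i k)" by (simp add: bar_def)
    then show ?thesis
      using root_elts_lists(2)[OF adm, of i k ty] False that ij m by (simp add: wd_ordered_span del: in_lists_conv_set)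
  qed
  have single: "ty = TypeB \<Longrightarrow> wd (root_elt_single n i) * m \<in> ordered_span"
    by (rule wd_ordered_span[OF root_elts_lists(3)[OF adm ij(1) ij(1)] m]) simp
  have "yx_value ty n p q j i = (if j \<noteq> i then scal p * zg * (wd (root_elt i j) - bar j)
     else - (scal p * zg * (\<Sum>k\<in>{1..n} - {i}. wd (root_elt i k) + bar k))
       - (if ty = TypeB then scal q * zg * wd (root_elt_single n i) else 0))"
    unfolding yx_value_eq bar_def Let_def ..
  then have "yx_value ty n p q j i * m =
    (if j \<noteq> i then smul p (zg * (wd (root_elt i j) * m - bar j * m))
     else - smul p (zg * (\<Sum>k\<in>{1..n} - {i}. wd (root_elt i k) * m + bar k * m))
       - (if ty = TypeB then smul q (zg * (wd (root_elt_single n i) * m)) else 0))"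
    by (simp add: smul_eq_scal_mult left_diff_distrib distrib_right mult.assoc sum_distrib_right)
  also have "\<dots> \<in> ordered_span"
  proof (cases "j \<noteq> i")
    case True
    show ?thesis
      unfolding if_P[OF True]
      by (intro ordered_span.smul z_ordered_span ordered_span_diff root bar) (use True ij in auto)
  next
    case False
    have s: "(if ty = TypeB then smul q (zg * (wd (root_elt_single n i) * m)) else 0) \<in> ordered_span"
    proof (cases "ty = TypeB")
      case True
      show ?thesis unfolding if_P[OF True] by (intro ordered_span.smul z_ordered_span single True)
    next
      case False
      show ?thesis unfolding if_not_P[OF False] by (rule ordered_span_zero)
    qed
    show ?thesis
      unfolding if_not_P[OF False]
      by (intro ordered_span_diff[OF _ s] ordered_span_minus ordered_span.smul z_ordered_span
          ordered_span_sum ordered_span.add root bar) auto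
  qed
  finally show ?thesis .
qed

text \<open>Past an x-letter \<open>y_k\<close> leaves a commutator, whose words multiply a product
  with fewer x-letters and are handled by \<open>yx_ordered_span\<close>; past a generator of the
  cover it only changes index and sign.\<close>

lemma y_ordered_span: "k \<in> {1..n} \<Longrightarrow> m \<in> ordered_span \<Longrightarrow> yg k * m \<in> ordered_span"
proof (rule ordered_span_mult)
  assume k: "k \<in> {1..n}"
  fix a l c assume "set a \<subseteq> {1..n}" and l: "l \<in> lists (cover_gens ty n)" and c: "set c \<subseteq> {1..n}"
  then show "yg k * W a l c \<in> ordered_span"
  proof (induction a)
    case Nil
    show ?case using l k
    proof (induction l arbitrary: k)
      case Nil
      then show ?case using ordered_span.W[of "[]" "[]" "k # c"] c by (simp add: W_Cons)
    next
      case (Cons d l)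
      let ?k = "index_perm ty n d k" and ?W = "W [] l c"
      have k': "?k \<in> {1..n}" using index_perm_range Cons by auto
      have s: "gen_sign ty n d ?k * gen_sign ty n d ?k = 1" by (simp add: gen_sign_def)
      have W: "?W \<in> carrier F" using W_F c Cons by auto
      \<comment> \<open>The move relation is taken at the permuted index: as
        \<open>index_perm\<close> is an involution, \<open>y_k\<close> appears on the right-hand
        side, and the sign is brought over since its square is 1.\<close>
      have A: "cong (monomial [GW d] * yg ?k) (smul (gen_sign ty n d ?k) (yg k * monomial [GW d]))"
        using move(2)[of d ?k] Cons k' by (simp add: moved_y_def index_perm_involution)
      have "cong (smul (gen_sign ty n d ?k) (monomial [GW d] * yg ?k)) (yg k * monomial [GW d])"
        using cong_smul[OF A, of "gen_sign ty n d ?k"] by (simp only: smul_simps s)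
      then have C: "cong (yg k * monomial [GW d] * ?W) (smul (gen_sign ty n d ?k) (monomial [GW d] * yg ?k) * ?W)"
        using W by (rule cong_mult_right[OF cong_sym])
      have "smul (gen_sign ty n d ?k) (monomial [GW d] * (yg ?k * ?W)) \<in> ordered_span"
        using Cons k' by (intro ordered_span.smul gw_ordered_span) auto
      then have "smul (gen_sign ty n d ?k) (monomial [GW d] * yg ?k) * ?W \<in> ordered_span"
        by (simp only: smul_mult mult.assoc)
      with C have "yg k * monomial [GW d] * ?W \<in> ordered_span" by (rule ordered_span_cong)
      then show ?case by (simp only: W_Cons mult.assoc)
    qed
  next
    case (Cons j a)
    let ?W = "W a l c"
    have j: "j \<in> {1..n}" and W: "?W \<in> carrier F" "?W \<in> ordered_span"
      using Cons W_F l c ordered_span.W[of a l c] by auto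
    have "commutator (yg k) (xg j) - yx_value ty n p q k j \<in> I"
      by (rule I_rel) (use j k in \<open>auto simp: hecke_rels_def\<close>)
    then have "cong (yg k * xg j) (xg j * yg k + yx_value ty n p q k j)"
      by (simp add: cong_def commutator_def algebra_simps)
    then have C: "cong (yg k * xg j * ?W) ((xg j * yg k + yx_value ty n p q k j) * ?W)"
      using W by (intro cong_mult_right)
    have "xg j * (yg k * ?W) + yx_value ty n p q k j * ?W \<in> ordered_span"
      using Cons j k W by (intro ordered_span.add x_ordered_span yx_ordered_span) auto
    then have "(xg j * yg k + yx_value ty n p q k j) * ?W \<in> ordered_span"
      by (simp only: distrib_right mult.assoc)
    with C have "yg k * xg j * ?W \<in> ordered_span" by (rule ordered_span_cong)
    then show ?case by (simp only: W_Cons mult.assoc)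
  qed
qed simp_all

lemma vec_keys_induct:
  assumes "a \<in> carrier F" "0 \<in> M" "\<And>v w. v \<in> M \<Longrightarrow> w \<in> M \<Longrightarrow> v + w \<in> M"
    "\<And>c w. w \<in> lists (gens ty n) \<Longrightarrow> smul c (monomial w) \<in> M"
  shows "a \<in> M"
proof -
  have "Poly_Mapping.single k (Poly_Mapping.lookup a k) \<in> M" if "k \<in> Poly_Mapping.keys a" for k
    using assms(4)[of "letters k" "Poly_Mapping.lookup a k"] assms(1) that
    by (auto simp: free_algebra_carrier monomial_def)
  then have "(\<Sum>k\<in>K. Poly_Mapping.single k (Poly_Mapping.lookup a k)) \<in> M" if "K \<subseteq> Poly_Mapping.keys a" for K
    using that by (induction K rule: infinite_finite_induct) (auto intro: assms)
  then show ?thesis by (subst vec_expand) blast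
qed

lemma carrier_ordered_span:
  assumes "a \<in> carrier F" shows "a \<in> ordered_span"
  using assms
proof (rule vec_keys_induct)
  show "smul c (monomial w) \<in> ordered_span" if "w \<in> lists (gens ty n)" for c w
    using that
  proof (intro ordered_span.smul, induction w)
    case Nil
    then show ?case using ordered_span.W[of "[]" "[]" "[]"] by (simp add: W_def)
  next
    case (Cons g w)
    have "monomial (g # w) = monomial [g] * monomial w" by (simp add: monomial_mult)
    moreover have "monomial [g] * monomial w \<in> ordered_span"
      using Cons x_ordered_span y_ordered_span gw_ordered_span
      by (cases g) (auto simp: gens_def xg_def yg_def)
    ultimately show ?case by simp
  qed
qed (auto intro: ordered_span_zero ordered_span.add)

section \<open>Sorting the letters\<close>

inductive_set pbw_span :: "free_elt set" where
  ideal: "a \<in> I \<Longrightarrow> a \<in> pbw_span"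
| pbw: "\<alpha> \<in> exponents n \<Longrightarrow> l \<in> lists (cover_gens ty n) \<Longrightarrow> \<gamma> \<in> exponents n \<Longrightarrow>
    x_pow n \<alpha> * wd l * y_pow n \<gamma> \<in> pbw_span"
| add: "a \<in> pbw_span \<Longrightarrow> b \<in> pbw_span \<Longrightarrow> a + b \<in> pbw_span"
| smul: "a \<in> pbw_span \<Longrightarrow> smul s a \<in> pbw_span"

lemma z_W: "set a \<subseteq> {1..n} \<Longrightarrow> l \<in> lists (cover_gens ty n) \<Longrightarrow> set c \<subseteq> {1..n} \<Longrightarrow>
    cong (zg * W a l c) (W a (Zc # l) c)"
proof (induction a)
  case Nil
  then show ?case by (simp add: W_Cons zg_eq cong_refl)
next
  case (Cons j a)
  have j: "j \<in> {1..n}" and W: "W a l c \<in> carrier F" using Cons W_F by auto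
  have A: "cong (zg * xg j * W a l c) (xg j * zg * W a l c)"
    using z_central[of "GX j"] j W by (intro cong_mult_right) (auto simp: xg_def gens_def)
  have B: "cong (xg j * (zg * W a l c)) (xg j * W a (Zc # l) c)"
    using Cons j by (intro cong_mult_left) auto
  show ?case using cong_trans[OF A[unfolded mult.assoc] B] by (simp only: W_Cons mult.assoc)
qed

text \<open>Reordering the x costs powers of \<open>z\<close>, which have to be absorbed into the
  cover word. Letting \<open>l\<close> range over all words makes the relation transitive.\<close>

definition x_equiv :: "nat list \<Rightarrow> nat list \<Rightarrow> bool" where
  "x_equiv a b \<longleftrightarrow> (\<forall>l\<in>lists (cover_gens ty n). \<exists>l'\<in>lists (cover_gens ty n). \<forall>c. set c \<subseteq> {1..n} \<longrightarrow>
     cong (W a l c) (W b l' c))"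

lemma x_equiv_refl: "x_equiv a a"
  using cong_refl by (auto simp: x_equiv_def)

lemma x_equiv_trans: "x_equiv a b \<Longrightarrow> x_equiv b d \<Longrightarrow> x_equiv a d"
  unfolding x_equiv_def by (meson cong_trans)

lemma x_equiv_Cons: "x_equiv a b \<Longrightarrow> j \<in> {1..n} \<Longrightarrow> x_equiv (j # a) (j # b)"
  unfolding x_equiv_def W_Cons by (meson cong_mult_left x_F)

lemma x_equiv_swap:
  assumes "i \<in> {1..n}" "j \<in> {1..n}" "i \<noteq> j" "set a \<subseteq> {1..n}"
  shows "x_equiv (i # j # a) (j # i # a)"
  unfolding x_equiv_def
proof (intro ballI bexI allI impI)
  fix l c assume l: "l \<in> lists (cover_gens ty n)" and c: "set c \<subseteq> {1..n}"
  have "cong (xg i * xg j) (zg * xg j * xg i)"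
    unfolding cong_def by (rule common_rel) (use assms in \<open>auto simp: common_rels_def\<close>)
  then have "cong (xg i * xg j * W a l c) (zg * xg j * xg i * W a l c)"
    using W_F[OF assms(4) l c] by (rule cong_mult_right)
  then have A: "cong (W (i # j # a) l c) (zg * W (j # i # a) l c)"
    by (simp only: W_Cons mult.assoc)
  have B: "cong (zg * W (j # i # a) l c) (W (j # i # a) (Zc # l) c)"
    using assms l c by (intro z_W) auto
  show "cong (W (i # j # a) l c) (W (j # i # a) (Zc # l) c)"
    using cong_trans[OF A B] .
qed simp

lemma x_equiv_insort: "j \<in> {1..n} \<Longrightarrow> set a \<subseteq> {1..n} \<Longrightarrow> x_equiv (j # a) (insort j a)"
proof (induction a)
  case (Cons i a)
  show ?case
  proof (cases "j \<le> i")
    case False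
    have A: "x_equiv (j # i # a) (i # j # a)" using Cons False by (intro x_equiv_swap) auto
    have B: "x_equiv (i # j # a) (i # insort j a)" using Cons by (intro x_equiv_Cons) auto
    show ?thesis using False x_equiv_trans[OF A B] by simp
  qed (simp add: x_equiv_refl)
qed (simp add: x_equiv_refl)

lemma x_equiv_sort: "set a \<subseteq> {1..n} \<Longrightarrow> x_equiv a (sort a)"
proof (induction a)
  case (Cons j a)
  then have A: "x_equiv (j # a) (j # sort a)" by (intro x_equiv_Cons) auto
  have B: "x_equiv (j # sort a) (insort j (sort a))" using Cons by (intro x_equiv_insort) auto
  show ?case using x_equiv_trans[OF A B] by simp
qed (simp add: x_equiv_refl)

lemma y_insort: "j \<in> {1..n} \<Longrightarrow> set c \<subseteq> {1..n} \<Longrightarrow> cong (W [] [] (j # c)) (W [] [] (insort j c))"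
proof (induction c)
  case (Cons i c)
  show ?case
  proof (cases "j \<le> i")
    case False
    have "cong (yg j * yg i) (yg i * yg j)"
      unfolding cong_def
      \<comment> \<open>The chain of union rules selects the fourth of the eight sets of relations,
        the one between two y.\<close>
      by (rule common_rel, unfold common_rels_def, rule UnI1[OF UnI1[OF UnI1[OF UnI1[OF UnI2]]]])
        (use Cons False in force)
    then have "cong (yg j * yg i * W [] [] c) (yg i * yg j * W [] [] c)"
      using W_F[of "[]" "[]" c] Cons by (intro cong_mult_right) auto
    then have A: "cong (W [] [] (j # i # c)) (yg i * W [] [] (j # c))"
      by (simp only: W_Cons mult.assoc)
    have B: "cong (yg i * W [] [] (j # c)) (yg i * W [] [] (insort j c))"
      using Cons by (intro cong_mult_left) auto
    show ?thesis using False cong_trans[OF A B] by (simp add: W_Cons)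
  qed (simp add: cong_refl)
qed (simp add: cong_refl)

lemma y_sort: "set c \<subseteq> {1..n} \<Longrightarrow> cong (W [] [] c) (W [] [] (sort c))"
proof (induction c)
  case (Cons j c)
  then have A: "cong (W [] [] (j # c)) (W [] [] (j # sort c))"
    by (auto simp: W_Cons intro: cong_mult_left)
  have B: "cong (W [] [] (j # sort c)) (W [] [] (insort j (sort c)))" using Cons by (intro y_insort) auto
  show ?case using cong_trans[OF A B] by simp
qed (simp add: cong_refl)

lemma exp_word_count:
  assumes "set a \<subseteq> {1..n}"
  shows "exp_word n (restrict (count (mset a)) {1..n}) = sort a"
proof (rule properties_for_sort[symmetric])
  show "mset (exp_word n (restrict (count (mset a)) {1..n})) = mset a"
    using assms by (intro multiset_eqI) (auto simp: count_exp_word count_eq_zero_iff)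
qed (rule sorted_exp_word)

lemma W_pbw_span:
  assumes a: "set a \<subseteq> {1..n}" and l: "l \<in> lists (cover_gens ty n)" and c: "set c \<subseteq> {1..n}"
  shows "W a l c \<in> pbw_span"
proof -
  have sc: "set (sort c) \<subseteq> {1..n}" using c by simp
  have split: "W a l c = monomial (map GX a @ map GW l) * W [] [] c" for c
    by (simp add: W_def monomial_mult)
  have "monomial (map GX a @ map GW l) \<in> carrier F" using a l by (auto simp: gens_iff subset_iff)
  then have "cong (W a l c) (W a l (sort c))"
    unfolding split[of c] split[of "sort c"] using y_sort[OF c] by (intro cong_mult_left)
  moreover obtain l' where l': "l' \<in> lists (cover_gens ty n)" "cong (W a l (sort c)) (W (sort a) l' (sort c))"
    using x_equiv_sort[OF a] l sc unfolding x_equiv_def by blast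
  ultimately have "cong (W a l c) (W (sort a) l' (sort c))" using cong_trans by blast
  moreover define \<alpha> where "\<alpha> = restrict (count (mset a)) {1..n}"
  moreover define \<gamma> where "\<gamma> = restrict (count (mset c)) {1..n}"
  ultimately have "W a l c - x_pow n \<alpha> * wd l' * y_pow n \<gamma> \<in> I"
    unfolding x_pow_monomial y_pow_monomial
    using exp_word_count[OF a] exp_word_count[OF c] by (simp add: cong_def W_def wd_def monomial_mult)
  moreover have "x_pow n \<alpha> * wd l' * y_pow n \<gamma> \<in> pbw_span"
    using l' by (intro pbw_span.pbw) (auto simp: \<alpha>_def \<gamma>_def exponents_def)
  ultimately show ?thesis
    using pbw_span.add[OF pbw_span.ideal, of "W a l c - x_pow n \<alpha> * wd l' * y_pow n \<gamma>"] by fastforce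
qed

lemma carrier_pbw_span:
  assumes "a \<in> carrier F" shows "a \<in> pbw_span"
  using carrier_ordered_span[OF assms]
proof induction
  case (W a l c)
  then show ?case by (rule W_pbw_span)
qed (auto intro: pbw_span.ideal pbw_span.add pbw_span.smul)

end

section \<open>The basis\<close>

context daha_rep
begin

abbreviation H where "H \<equiv> covering_daha ty n p q"
abbreviation cls where "cls \<equiv> daha_class ty n p q"

lemma cls_hom: "cls \<in> Ring.ring_hom F H"
  unfolding daha_class_def covering_daha_def using alg_class_hom[OF hecke_rels_carrier[OF adm]] .

lemma carrier_H: "carrier H = cls ` carrier F"
  unfolding daha_class_def covering_daha_def using alg_class_surj[OF hecke_rels_carrier[OF adm]] .

lemma cls_mult: "a \<in> carrier F \<Longrightarrow> b \<in> carrier F \<Longrightarrow> cls (a * b) = cls a \<otimes>\<^bsub>H\<^esub> cls b"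
  and cls_add: "a \<in> carrier F \<Longrightarrow> b \<in> carrier F \<Longrightarrow> cls (a + b) = cls a \<oplus>\<^bsub>H\<^esub> cls b"
  using ring_hom_mult[OF cls_hom, of a b] ring_hom_add[OF cls_hom, of a b] by simp_all

lemma cls_smul: "a \<in> carrier F \<Longrightarrow> cls (smul c a) = c \<odot>\<^bsub>H\<^esub> cls a"
  using cls_mult[of "scal c" a] presented_algebra_sel(6)[OF hecke_rels_carrier[OF adm, of p q]]
  by (simp add: smul_eq_scal_mult covering_daha_def daha_class_def)

lemma cls_eq_iff:
  assumes "a \<in> carrier F" "b \<in> carrier F" shows "cls a = cls b \<longleftrightarrow> a - b \<in> I"
proof -
  interpret I: ideal I F by (rule ideal_I)
  have cls: "cls x = I +>\<^bsub>F\<^esub> x" for x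
    by (simp add: daha_class_def alg_class_def I_def)
  show ?thesis
  proof
    assume "cls a = cls b"
    then have "a \<in> I +>\<^bsub>F\<^esub> b" using I.a_rcos_self[OF assms(1)] by (simp add: cls)
    then obtain h where "h \<in> I" "a = h + b" by (auto simp: a_r_coset_def')
    then show "a - b \<in> I" by simp
  next
    assume "a - b \<in> I"
    then have "a \<in> I +>\<^bsub>F\<^esub> b" by (auto simp: a_r_coset_def' intro: bexI[of _ "a - b"])
    then show "cls a = cls b" unfolding cls using I.a_repr_independence[OF _ assms(2) I.a_subgroup] by simp
  qed
qed

lemma cls_zero: "cls 0 = \<zero>\<^bsub>H\<^esub>"
proof -
  interpret H: ring H by (rule covering_daha_algebra(1)[OF adm])
  have "cls 0 \<in> carrier H" unfolding carrier_H by simp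
  moreover have "cls 0 \<oplus>\<^bsub>H\<^esub> cls 0 = cls 0" using cls_add[of 0 0] by simp
  ultimately show ?thesis by (metis H.add.l_cancel_one)
qed

lemma cls_eq_zero: "a \<in> carrier F \<Longrightarrow> cls a = \<zero>\<^bsub>H\<^esub> \<Longrightarrow> a \<in> I"
  using cls_eq_iff[of a 0] by (simp add: cls_zero)

text \<open>The same chosen word enters \<open>pbw_rep\<close> and \<open>pbw_key\<close>, so the
  permutation in the key is the one that the representative produces.\<close>

definition rep_word :: "cover_gen list set \<Rightarrow> cover_gen list" where
  "rep_word w = (SOME l. l \<in> lists (cover_gens ty n) \<and> w = word_class l)"

lemma rep_word:
  assumes "w \<in> carrier (weyl_cover ty n)"
  shows "rep_word w \<in> lists (cover_gens ty n)" "word_class (rep_word w) = w"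
proof -
  have "\<exists>l. l \<in> lists (cover_gens ty n) \<and> w = word_class l"
    using assms unfolding carrier_weyl_cover by (rule quotientE) (auto simp: word_class_def)
  from someI_ex[OF this] show "rep_word w \<in> lists (cover_gens ty n)" "word_class (rep_word w) = w"
    unfolding rep_word_def by auto
qed

lemma pow_F: "x_pow n \<alpha> \<in> carrier F" "y_pow n \<alpha> \<in> carrier F"
  using set_exp_word[of n \<alpha>] unfolding x_pow_monomial y_pow_monomial
  by (auto simp: gens_iff subset_iff)

lemma pbw_F: "l \<in> lists (cover_gens ty n) \<Longrightarrow> x_pow n \<alpha> * wd l * y_pow n \<gamma> \<in> carrier F"
  by (intro free_algebra_closed pow_F) (simp_all add: wd_in_free_algebra del: in_lists_conv_set)

lemma cls_pbw:
  assumes "l \<in> lists (cover_gens ty n)"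
  shows "cls (x_pow n \<alpha> * wd l * y_pow n \<gamma>) = pbw_element ty n p q \<alpha> (word_class l) \<gamma>"
proof -
  have w: "wd l \<in> carrier F" using assms by (simp only: wd_in_free_algebra)
  show ?thesis
    using cls_mult[OF free_algebra_closed(4)[OF pow_F(1) w] pow_F(2)] cls_mult[OF pow_F(1) w]
      cover_map_class[OF adm assms, of p q]
    by (simp add: pbw_element_def word_class_def)
qed

definition pbw_index :: "((nat \<Rightarrow> nat) \<times> cover_gen list set \<times> (nat \<Rightarrow> nat)) set" where
  "pbw_index = exponents n \<times> carrier (weyl_cover ty n) \<times> exponents n"

definition pbw_class :: "(nat \<Rightarrow> nat) \<times> cover_gen list set \<times> (nat \<Rightarrow> nat) \<Rightarrow> free_elt set" where
  "pbw_class = (\<lambda>(\<alpha>, w, \<gamma>). pbw_element ty n p q \<alpha> w \<gamma>)"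

definition pbw_rep :: "(nat \<Rightarrow> nat) \<times> cover_gen list set \<times> (nat \<Rightarrow> nat) \<Rightarrow> free_elt" where
  "pbw_rep = (\<lambda>(\<alpha>, w, \<gamma>). x_pow n \<alpha> * wd (rep_word w) * y_pow n \<gamma>)"

definition pbw_key ::
  "(nat \<Rightarrow> nat) \<times> cover_gen list set \<times> (nat \<Rightarrow> nat) \<Rightarrow> nat multiset \<times> nat multiset \<times> cover_gen list set" where
  "pbw_key = (\<lambda>(\<alpha>, w, \<gamma>). (mset (exp_word n \<alpha>), image_mset (word_perm ty n (rep_word w)) (mset (exp_word n \<gamma>)), w))"

lemma pbw_rep_F: "t \<in> pbw_index \<Longrightarrow> pbw_rep t \<in> carrier F"
  by (auto simp: pbw_index_def pbw_rep_def intro!: pbw_F rep_word simp del: in_lists_conv_set)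

lemma cls_pbw_rep: "t \<in> pbw_index \<Longrightarrow> cls (pbw_rep t) = pbw_class t"
  using cls_pbw rep_word by (auto simp: pbw_index_def pbw_rep_def pbw_class_def simp del: in_lists_conv_set)

text \<open>The last component gives \<open>w\<close>, hence its chosen word; the permutation of
  this word is injective, so the y-exponents can be recovered.\<close>

lemma pbw_key_inj: "inj_on pbw_key pbw_index"
proof (rule inj_onI, clarsimp simp: pbw_key_def pbw_index_def)
  fix \<alpha> w \<gamma> \<alpha>' \<gamma>'
  assume "\<alpha> \<in> exponents n" "\<alpha>' \<in> exponents n" "\<gamma> \<in> exponents n" "\<gamma>' \<in> exponents n"
    and "mset (exp_word n \<alpha>) = mset (exp_word n \<alpha>')"
    and "image_mset (word_perm ty n (rep_word w)) (mset (exp_word n \<gamma>)) =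
      image_mset (word_perm ty n (rep_word w)) (mset (exp_word n \<gamma>'))"
  then show "\<alpha> = \<alpha>' \<and> \<gamma> = \<gamma>'"
    using multiset.inj_map[OF inj_word_perm] exp_word_inj by (metis injD)
qed

lemma coord_pbw_rep:
  assumes "t \<in> pbw_index"
  obtains c where "c \<noteq> 0" "coord (pbw_rep t) = Poly_Mapping.single (pbw_key t) c"
proof -
  obtain \<alpha> w \<gamma> where t: "t = (\<alpha>, w, \<gamma>)" by (cases t)
  have w: "w \<in> carrier (weyl_cover ty n)" using assms by (simp add: t pbw_index_def)
  show thesis
    using that coord_pbw[OF rep_word(1)[OF w], of \<alpha> \<gamma>] rep_word(2)[OF w]
    by (auto simp: t pbw_rep_def pbw_key_def nbasis_def)
qed

lemma coord_I: "a \<in> I \<Longrightarrow> coord a = 0"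
  unfolding I_def by (rule coord_genideal)

text \<open>Equal classes have congruent representatives, whose coordinates agree; each is a nonzero
  multiple of one basis vector, labelled by the key.\<close>

lemma pbw_class_inj: "inj_on pbw_class pbw_index"
proof (rule inj_onI)
  fix s t assume st: "s \<in> pbw_index" "t \<in> pbw_index" "pbw_class s = pbw_class t"
  then have "pbw_rep s - pbw_rep t \<in> I"
    using cls_eq_iff[OF pbw_rep_F pbw_rep_F, of s t] by (simp add: cls_pbw_rep)
  then have eq: "coord (pbw_rep s) = coord (pbw_rep t)"
    using coord_I linD(5)[OF lin_coord] by fastforce
  obtain c d where "c \<noteq> 0" "coord (pbw_rep s) = Poly_Mapping.single (pbw_key s) c"
    "d \<noteq> 0" "coord (pbw_rep t) = Poly_Mapping.single (pbw_key t) d"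
    using st coord_pbw_rep by metis
  then have "pbw_key s = pbw_key t" using eq by (metis lookup_single_eq lookup_single_not_eq)
  then show "s = t" using pbw_key_inj st by (simp add: inj_on_def)
qed

lemma pbw_class_carrier: "pbw_class ` pbw_index \<subseteq> carrier H"
  using cls_pbw_rep pbw_rep_F unfolding carrier_H by force

lemma pbw_basis: "vectorspace.basis class_ring H (pbw_class ` pbw_index)"
proof -
  interpret V: vectorspace "class_ring :: complex ring" H by (rule covering_daha_algebra(2)[OF adm])
  have "\<not> V.lin_dep (pbw_class ` pbw_index)"
  proof
    assume "V.lin_dep (pbw_class ` pbw_index)"
    then obtain A a x where A: "finite A" "A \<subseteq> pbw_class ` pbw_index" "V.lincomb a A = \<zero>\<^bsub>H\<^esub>"
      and x: "x \<in> A" "a x \<noteq> 0"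
      unfolding V.lin_dep_def by auto
    define t where "t = inv_into pbw_index pbw_class"
    have t: "t y \<in> pbw_index" "pbw_class (t y) = y" if "y \<in> A" for y
      using that A(2) by (auto simp: t_def inv_into_into f_inv_into_f)
    \<comment> \<open>Linear combinations are lifted from the quotient to the free algebra, where
      \<open>coord\<close> is defined.\<close>
    have "(\<Sum>y\<in>B. smul (a y) (pbw_rep (t y))) \<in> carrier F \<and>
        V.lincomb a B = cls (\<Sum>y\<in>B. smul (a y) (pbw_rep (t y)))" if "B \<subseteq> A" for B
    proof -
      have "finite B" using that A(1) finite_subset by blast
      then show ?thesis using that
      proof (induction B)
        case empty
        then show ?case by (simp add: V.lincomb_def cls_zero)
      next
        case (insert y B)
        then have y: "y \<in> A" and B: "B \<subseteq> A" by auto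
        have F: "smul (a y) (pbw_rep (t y)) \<in> carrier F"
          using smul_in_free_algebra pbw_rep_F t y by simp
        have "cls (smul (a y) (pbw_rep (t y))) = a y \<odot>\<^bsub>H\<^esub> y"
          using cls_smul[OF pbw_rep_F] cls_pbw_rep t[OF y] by simp
        moreover have "V.lincomb a (insert y B) = (a y \<odot>\<^bsub>H\<^esub> y) \<oplus>\<^bsub>H\<^esub> V.lincomb a B"
        proof -
          have "z \<in> carrier H" if "z \<in> A" for z using that A(2) pbw_class_carrier by auto
          then show ?thesis
            unfolding V.lincomb_def using insert.hyps y B
            by (subst V.M.finsum_insert) (auto intro!: V.smult_closed)
        qed
        ultimately show ?case
          using insert B F cls_add[of "smul (a y) (pbw_rep (t y))" "\<Sum>y\<in>B. smul (a y) (pbw_rep (t y))"]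
          by (simp add: free_algebra_closed)
      qed
    qed
    from this[of A] have "(\<Sum>y\<in>A. smul (a y) (pbw_rep (t y))) \<in> I"
      using A(3) cls_eq_zero by simp
    from coord_I[OF this] have zero: "(\<Sum>y\<in>A. smul (a y) (coord (pbw_rep (t y)))) = 0"
      by (simp only: linD(2,6)[OF lin_coord])
    obtain c where c: "c \<noteq> 0" "coord (pbw_rep (t x)) = Poly_Mapping.single (pbw_key (t x)) c"
      using coord_pbw_rep[OF t(1)[OF x(1)]] .
    \<comment> \<open>At the key of \<open>x\<close> only the term of \<open>x\<close> contributes,
      because distinct elements have distinct keys; this isolates the coefficient
      \<open>a x\<close>.\<close>
    have "Poly_Mapping.lookup (smul (a y) (coord (pbw_rep (t y)))) (pbw_key (t x)) = (if y = x then a x * c else 0)"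
      if yA: "y \<in> A" for y
    proof (cases "y = x")
      case False
      have "pbw_key (t y) \<noteq> pbw_key (t x)"
        using pbw_key_inj t yA x(1) False by (metis inj_onD)
      moreover obtain d where "coord (pbw_rep (t y)) = Poly_Mapping.single (pbw_key (t y)) d"
        using coord_pbw_rep[OF t(1)[OF yA]] .
      ultimately show ?thesis using False by (simp add: lookup_single_not_eq)
    qed (simp add: c)
    then have "Poly_Mapping.lookup (\<Sum>y\<in>A. smul (a y) (coord (pbw_rep (t y)))) (pbw_key (t x)) = a x * c"
      using A(1) x(1) by (simp add: lookup_sum del: lookup_smul)
    then show False using zero c x by simp
  qed
  moreover have "V.span (pbw_class ` pbw_index) = carrier H"
  proof
    show "V.span (pbw_class ` pbw_index) \<subseteq> carrier H"
      using pbw_class_carrier by (rule V.span_is_subset2)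
    interpret S: submodule "class_ring :: complex ring" "V.span (pbw_class ` pbw_index)" H
      using pbw_class_carrier by (rule V.span_is_submodule)
    \<comment> \<open>Membership in the carrier is carried through the induction because additivity
      and homogeneity of \<open>cls\<close> are available for elements of the carrier.\<close>
    have "a \<in> carrier F \<and> cls a \<in> V.span (pbw_class ` pbw_index)" if "a \<in> pbw_span" for a
      using that
    proof induction
      case (ideal a)
      then have "cls a = \<zero>\<^bsub>H\<^esub>" using cls_eq_iff[of a 0] I_carrier cls_zero by simp
      then show ?case using ideal I_carrier by simp
    next
      case (pbw \<alpha> l \<gamma>)
      then have "cls (x_pow n \<alpha> * wd l * y_pow n \<gamma>) = pbw_class (\<alpha>, word_class l, \<gamma>)"
        using cls_pbw by (simp add: pbw_class_def del: in_lists_conv_set)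
      moreover have "(\<alpha>, word_class l, \<gamma>) \<in> pbw_index"
        using pbw word_class_carrier by (simp add: pbw_index_def word_class_def del: in_lists_conv_set)
      ultimately show ?case
        using V.in_own_span[OF pbw_class_carrier] pbw_F[OF pbw(2)] by auto
    next
      case (add a b)
      then show ?case using cls_add S.m_closed by (simp add: free_algebra_closed)
    next
      case (smul a s)
      then show ?case using cls_smul S.smult_closed[of s] by (simp add: smul_in_free_algebra)
    qed
    then show "carrier H \<subseteq> V.span (pbw_class ` pbw_index)"
      using carrier_pbw_span unfolding carrier_H by blast
  qed
  ultimately show ?thesis
    unfolding V.basis_def using pbw_class_carrier by simp
qed

end

theorem theorem7p6:
  fixes ty :: weyl_type and n :: nat and u v :: complex
  assumes "admissible_rank ty n"
  shows "inj_on (\<lambda>(\<alpha>, w, \<gamma>). pbw_element ty n u v \<alpha> w \<gamma>)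
           (exponents n \<times> carrier (weyl_cover ty n) \<times> exponents n)
       \<and> vectorspace.basis class_ring (covering_daha ty n u v)
           {pbw_element ty n u v \<alpha> w \<gamma> | \<alpha> w \<gamma>.
              \<alpha> \<in> exponents n \<and> w \<in> carrier (weyl_cover ty n) \<and> \<gamma> \<in> exponents n}"
proof -
  interpret daha_rep ty n u v by unfold_locales (rule assms)
  have "pbw_class ` pbw_index = {pbw_element ty n u v \<alpha> w \<gamma> | \<alpha> w \<gamma>.
              \<alpha> \<in> exponents n \<and> w \<in> carrier (weyl_cover ty n) \<and> \<gamma> \<in> exponents n}"
    by (force simp: pbw_class_def pbw_index_def)
  then show ?thesis
    using pbw_class_inj pbw_basis unfolding pbw_class_def pbw_index_def by simp
qed

end
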